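(* Let $0.046\le p<1/2$ be the transition probability of the binary symmetric channel. Then the channel reliability satisfies $E(R,p)=E_0(R,p)$ for all $R_1\le R\le R_{\mathrm{crit}}$.
   Context: Logarithms base 2, $h$ binary entropy, $D(x\|y)=x\log\frac xy+(1-x)\log\frac{1-x}{1-y}$. For a binary code $C\subseteq\{0,1\}^n$ of size $M$, its rate is $\frac1n\log M$ and $P_e(C,p)$ is its average probability of error under maximum-likelihood decoding on the BSC with crossover probability $p$. The reliability function is $E(R,p)=\limsup_{n\to\infty}\frac1n\log\max_{C\subseteq\{0,1\}^n,\,R(C)=R}\frac1{P_e(C,p)}$. Let $\rho=\frac{\sqrt p}{\sqrt p+\sqrt{1-p}}$, $R_{\mathrm{crit}}=1-h(\rho)$, $E_0(R,p)=D(\rho\|p)+R_{\mathrm{crit}}-R$, $\delta_1=2\rho(1-\rho)$. Let $\tau_\nu(\xi)=\frac12\Big(1-\sqrt{1-4\big(\sqrt{\nu(1-\nu)-\xi(1-\xi)}-\xi\big)^2}\Big)$, $\bar R(\delta)=1+\min_{\frac12(1-\sqrt{1-2\delta})\le\alpha\le\frac12}\big(h(\tau_\alpha(\delta/2))-h(\alpha)\big)$, and $R_1=\bar R(\delta_1)$. *)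

theory Defs
  imports "HOL-Analysis.Analysis"
begin

definition h :: "real \<Rightarrow> real" where
  "h x = - x * log 2 x - (1 - x) * log 2 (1 - x)"

definition D :: "real \<Rightarrow> real \<Rightarrow> real" where
  "D x y = x * log 2 (x / y) + (1 - x) * log 2 ((1 - x) / (1 - y))"

definition words :: "nat \<Rightarrow> bool list set" where
  "words n = {xs. length xs = n}"

definition hdist :: "bool list \<Rightarrow> bool list \<Rightarrow> nat" where
  "hdist x y = card {i. i < length x \<and> x ! i \<noteq> y ! i}"

definition bsc :: "real \<Rightarrow> bool list \<Rightarrow> bool list \<Rightarrow> real" where
  "bsc p x y = p ^ hdist x y * (1 - p) ^ (length x - hdist x y)"

(* average error probability of C (uniform messages) under maximum-likelihood decoding:
   the probability of correct ML decoding is (1/M) sum_y max_{c in C} W(y|c),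
   independent of tie-breaking *)
definition Pe :: "bool list set \<Rightarrow> nat \<Rightarrow> real \<Rightarrow> real" where
  "Pe C n p = 1 - (\<Sum>y\<in>words n. Max ((\<lambda>c. bsc p c y) ` C)) / real (card C)"

definition codes :: "nat \<Rightarrow> real \<Rightarrow> bool list set set" where
  "codes n R = {C. C \<subseteq> words n \<and> card C = nat \<lceil>2 powr (real n * R)\<rceil>}"

definition reliability :: "real \<Rightarrow> real \<Rightarrow> ereal" where
  "reliability R p = limsup (\<lambda>n. ereal ((1 / real n) *
      log 2 (Max ((\<lambda>C. 1 / Pe C n p) ` codes n R))))"

definition rho :: "real \<Rightarrow> real" where
  "rho p = sqrt p / (sqrt p + sqrt (1 - p))"

definition Rcrit :: "real \<Rightarrow> real" where
  "Rcrit p = 1 - h (rho p)"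

definition E0 :: "real \<Rightarrow> real \<Rightarrow> real" where
  "E0 R p = D (rho p) p + Rcrit p - R"

definition delta1 :: "real \<Rightarrow> real" where
  "delta1 p = 2 * rho p * (1 - rho p)"

definition tau :: "real \<Rightarrow> real \<Rightarrow> real" where
  "tau \<nu> \<xi> = (1 - sqrt (1 - 4 * (sqrt (\<nu> * (1 - \<nu>) - \<xi> * (1 - \<xi>)) - \<xi>)^2)) / 2"

definition Rbar :: "real \<Rightarrow> real" where
  "Rbar \<delta> = 1 + (INF \<alpha>\<in>{(1 - sqrt (1 - 2 * \<delta>)) / 2 .. 1/2}. h (tau \<alpha> (\<delta> / 2)) - h \<alpha>)"

definition R1 :: "real \<Rightarrow> real" where
  "R1 p = Rbar (delta1 p)"

end

theory Submission
  imports Defs "HOL-Computational_Algebra.Polynomial" "HOL-Real_Asymp.Real_Asymp"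
begin

text \<open>
  Write \<open>s = sqrt (p / (1 - p))\<close>, \<open>Z = 2 s / (1 + s^2)\<close> and \<open>R0 = 1 - log 2 (1 + Z)\<close>. Then
  \<open>delta1 = Z / (1 + Z)\<close> is the distance that dominates the union bound for random codes, and
  \<open>E0 R = R0 - R\<close>. A greedily chosen code meets the union bound, which gives the lower bound.

  For the upper bound, Delsarte's inequality is applied to a test function concentrated on weights close
  to \<open>tau n\<close>, where \<open>tau = 1/2 - sqrt (delta1 (1 - delta1))\<close>. Below \<open>delta1 n\<close> its Fourier transform grows
  by a factor at least \<open>sqrt Z\<close> per unit of distance, so every code of rate at least \<open>h tau\<close> satisfies
  \<open>SUM Z^d >= 2^(-n E0)\<close> per codeword, the sum being over the neighbours at distance \<open>d <= delta1 n\<close>.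
  After an iterative removal of codewords with too many close neighbours, many codewords have, for one
  distance, exactly as many neighbours as needed for the error exponent; a second moment argument shows
  that the corresponding error events hardly overlap. This needs one inequality between explicit
  functions of \<open>p\<close>, which is where \<open>p >= 0.046\<close> enters; the same assumption makes \<open>alpha = 1/2\<close> optimal in
  \<open>Rbar delta1\<close>, so that \<open>R1 = h tau\<close>. Rates between \<open>R1\<close> and \<open>Rcrit\<close> are reduced to \<open>R1\<close> by fixing the
  distance of a prefix of the codewords to the received prefix.
\<close>

section \<open>Fourier analysis on the Hamming cube\<close>

text \<open>The obstacle is to reverse the union bound: a codeword may have exponentially many
  rivals whose error events nearly coincide. The order of removal is the cure. Distances
  \<open>k\<close> are treated increasingly, so the rivals of a word removed at stage
  \<open>k\<close> have all survived the smaller distances and are themselves sparse there; keeping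
  only about \<open>\<Theta> / Z ^ k\<close> of them also limits the pairs at distance
  \<open>k\<close> or more. The resulting overlap exponent is affine in \<open>k\<close>, so only
  the ends k = 0 and k = delta1 n matter: the first is an elementary inequality for all s in (0,1),
  the second is \<open>gap\<close>. The bound 0.046 is used through s >= 9/41, slightly weaker but
  with rational consequences: (1 - s) / (1 + s) <= 16/25, its square is at most 256/625, and delta1
  >= 59/200. Received words where a codeword is not the unique maximiser count as errors; this costs
  a factor 2 and makes the argument independent of the decoding rule. Polynomial factors and factors
  \<open>2 powr (n * \<epsilon>)\<close> are lost freely.\<close>

definition chi :: "'a set \<Rightarrow> 'a set \<Rightarrow> real" where
  "chi x S = (-1) ^ card (x \<inter> S)"

definition sdist :: "'a set \<Rightarrow> 'a set \<Rightarrow> nat" where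
  "sdist x y = card (sym_diff x y)"

definition fourier :: "'a set \<Rightarrow> ('a set \<Rightarrow> real) \<Rightarrow> 'a set \<Rightarrow> real" where
  "fourier U \<phi> x = (\<Sum>S\<in>Pow U. \<phi> S * chi x S)"

definition adjacency :: "'a set \<Rightarrow> ('a set \<Rightarrow> real) \<Rightarrow> 'a set \<Rightarrow> real" where
  "adjacency U \<phi> S = (\<Sum>u\<in>U. \<phi> (sym_diff S {u}))"

lemma chi_commute: "chi x S = chi S x"
  by (simp add: chi_def Int_commute)

lemma chi_empty [simp]: "chi x {} = 1" "chi {} x = 1"
  by (simp_all add: chi_def)

lemma chi_prod:
  assumes "finite S"
  shows "chi x S = (\<Prod>u\<in>S. if u \<in> x then -1 else 1)"
  using assms by (simp add: chi_def prod.If_cases Int_commute)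

lemma chi_sym_diff:
  assumes "finite S" "finite T"
  shows "chi x (sym_diff S T) = chi x S * chi x T"
proof -
  have 1: "card (x \<inter> sym_diff S T) = card (x \<inter> (S - T)) + card (x \<inter> (T - S))"
    using assms by (subst card_Un_disjoint [symmetric]) (auto intro: arg_cong [where f = card])
  have 2: "card (x \<inter> S) = card (x \<inter> (S - T)) + card (x \<inter> (S \<inter> T))"
    using assms by (subst card_Un_disjoint [symmetric]) (auto intro: arg_cong [where f = card])
  have 3: "card (x \<inter> T) = card (x \<inter> (T - S)) + card (x \<inter> (S \<inter> T))"
    using assms by (subst card_Un_disjoint [symmetric]) (auto intro: arg_cong [where f = card])
  show ?thesis
    by (simp add: chi_def 1 2 3 power_add flip: power_mult_distrib)
qed

lemma chi_sym_diff':
  assumes "finite S" "finite T"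
  shows "chi (sym_diff S T) x = chi S x * chi T x"
  using chi_sym_diff [OF assms, of x] by (simp add: chi_commute)

lemma sum_Pow_prod:
  fixes f :: "'a \<Rightarrow> 'b :: comm_semiring_1"
  assumes "finite U"
  shows "(\<Sum>S\<in>Pow U. \<Prod>u\<in>S. f u) = (\<Prod>u\<in>U. 1 + f u)"
  using prod_add [OF assms, of f "\<lambda>_. 1"] by (simp add: add.commute)

lemma sum_chi:
  assumes "finite U" "V \<subseteq> U"
  shows "(\<Sum>x\<in>Pow U. chi x V) = (if V = {} then 2 ^ card U else 0)"
proof -
  have "(\<Sum>x\<in>Pow U. chi x V) = (\<Sum>x\<in>Pow U. \<Prod>u\<in>x. if u \<in> V then -1 else 1)"
    using assms by (intro sum.cong refl) (metis Pow_iff chi_commute chi_prod finite_subset)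
  also have "\<dots> = (\<Prod>u\<in>U. 1 + (if u \<in> V then -1 else 1))"
    using assms by (intro sum_Pow_prod)
  also have "\<dots> = (if V = {} then 2 ^ card U else 0)"
    using assms by auto
  finally show ?thesis .
qed

lemma sym_diff_cancel: "sym_diff A (sym_diff A B) = B"
  by auto

lemma sum_Pow_translate:
  assumes "x \<subseteq> U"
  shows "(\<Sum>y\<in>Pow U. f (sym_diff x y)) = (\<Sum>y\<in>Pow U. f y)"
  by (rule sum.reindex_bij_witness [of _ "sym_diff x" "sym_diff x"])
    (use assms in \<open>auto simp: sym_diff_cancel\<close>)

lemma parseval:
  assumes U: "finite U"
  shows "(\<Sum>x\<in>Pow U. (fourier U \<phi> x)\<^sup>2) = 2 ^ card U * (\<Sum>S\<in>Pow U. (\<phi> S)\<^sup>2)"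
proof -
  have fin: "finite S" if "S \<in> Pow U" for S using that U finite_subset by auto
  have "(\<Sum>x\<in>Pow U. (fourier U \<phi> x)\<^sup>2)
      = (\<Sum>x\<in>Pow U. \<Sum>S\<in>Pow U. \<Sum>T\<in>Pow U. \<phi> S * \<phi> T * chi x (sym_diff S T))"
    unfolding fourier_def power2_eq_square sum_product
    by (intro sum.cong refl) (simp add: chi_sym_diff fin algebra_simps)
  also have "\<dots> = (\<Sum>S\<in>Pow U. \<Sum>T\<in>Pow U. \<phi> S * \<phi> T * (\<Sum>x\<in>Pow U. chi x (sym_diff S T)))"
    by (subst sum.swap, rule sum.cong [OF refl], subst sum.swap) (simp add: sum_distrib_left)
  also have "\<dots> = (\<Sum>S\<in>Pow U. \<Sum>T\<in>Pow U. if T = S then \<phi> S * \<phi> S * 2 ^ card U else 0)"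
  proof (intro sum.cong refl)
    fix S T assume ST: "S \<in> Pow U" "T \<in> Pow U"
    have "(sym_diff S T = {}) = (T = S)" by auto
    moreover have "sym_diff S T \<subseteq> U" using ST by auto
    ultimately show "\<phi> S * \<phi> T * (\<Sum>x\<in>Pow U. chi x (sym_diff S T)) =
       (if T = S then \<phi> S * \<phi> S * 2 ^ card U else 0)"
      using sum_chi [OF U, of "sym_diff S T"] by simp
  qed
  also have "\<dots> = (\<Sum>S\<in>Pow U. \<phi> S * \<phi> S * 2 ^ card U)"
    using U by simp
  finally show ?thesis
    by (simp add: sum_distrib_left power2_eq_square algebra_simps)
qed

text \<open>With \<open>g V\<close> the sum over the family of the characters at \<open>V\<close>,
  the right side is the sum of \<open>\<psi> S * \<phi> T * (g (sym_diff S T))\<^sup>2\<close> over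
  all \<open>S\<close> and \<open>T\<close>. Every term is nonnegative, and the diagonal
  \<open>S = T\<close> alone gives the left side, since \<open>g {}\<close> is the number of
  indices.\<close>

lemma delsarte_inequality:
  assumes U: "finite U" and I: "finite I" and c: "\<And>i. i \<in> I \<Longrightarrow> c i \<subseteq> U"
    and \<psi>: "\<And>S. S \<subseteq> U \<Longrightarrow> 0 \<le> \<psi> S" and \<phi>: "\<And>S. S \<subseteq> U \<Longrightarrow> 0 \<le> \<phi> S"
  shows "(real (card I))\<^sup>2 * (\<Sum>S\<in>Pow U. \<psi> S * \<phi> S)
     \<le> (\<Sum>i\<in>I. \<Sum>j\<in>I. fourier U \<psi> (sym_diff (c i) (c j)) * fourier U \<phi> (sym_diff (c i) (c j)))"
proof -
  have fin: "finite S" if "S \<in> Pow U" for S using that U finite_subset by auto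
  have finc: "finite (c i)" if "i \<in> I" for i using that U c finite_subset by metis
  define g where "g V = (\<Sum>i\<in>I. chi (c i) V)" for V
  have g: "(\<Sum>i\<in>I. \<Sum>j\<in>I. chi (sym_diff (c i) (c j)) V) = (g V)\<^sup>2" for V
    unfolding g_def power2_eq_square sum_product
    by (intro sum.cong refl chi_sym_diff' finc)
  have "(\<Sum>i\<in>I. \<Sum>j\<in>I. fourier U \<psi> (sym_diff (c i) (c j)) * fourier U \<phi> (sym_diff (c i) (c j)))
     = (\<Sum>i\<in>I. \<Sum>j\<in>I. \<Sum>S\<in>Pow U. \<Sum>T\<in>Pow U. \<psi> S * \<phi> T * chi (sym_diff (c i) (c j)) (sym_diff S T))"
    unfolding fourier_def sum_product
    by (intro sum.cong refl) (simp add: chi_sym_diff fin algebra_simps)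
  also have "\<dots> = (\<Sum>i\<in>I. \<Sum>S\<in>Pow U. \<Sum>T\<in>Pow U. \<psi> S * \<phi> T * (\<Sum>j\<in>I. chi (sym_diff (c i) (c j)) (sym_diff S T)))"
    by (rule sum.cong [OF refl], subst sum.swap, rule sum.cong [OF refl], subst sum.swap)
      (simp add: sum_distrib_left)
  also have "\<dots> = (\<Sum>S\<in>Pow U. \<Sum>T\<in>Pow U. \<psi> S * \<phi> T * (\<Sum>i\<in>I. \<Sum>j\<in>I. chi (sym_diff (c i) (c j)) (sym_diff S T)))"
    by (subst sum.swap, rule sum.cong [OF refl], subst sum.swap)
      (simp add: sum_distrib_left)
  also have "\<dots> = (\<Sum>S\<in>Pow U. \<Sum>T\<in>Pow U. \<psi> S * \<phi> T * (g (sym_diff S T))\<^sup>2)"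
    by (simp only: g)
  finally have eq: "(\<Sum>i\<in>I. \<Sum>j\<in>I. fourier U \<psi> (sym_diff (c i) (c j)) * fourier U \<phi> (sym_diff (c i) (c j))) = \<dots>" .
  have "(real (card I))\<^sup>2 * (\<Sum>S\<in>Pow U. \<psi> S * \<phi> S) = (\<Sum>S\<in>Pow U. \<psi> S * \<phi> S * (g (sym_diff S S))\<^sup>2)"
    by (simp add: g_def sum_distrib_left algebra_simps)
  also have "\<dots> \<le> (\<Sum>S\<in>Pow U. \<Sum>T\<in>Pow U. \<psi> S * \<phi> T * (g (sym_diff S T))\<^sup>2)"
  proof (intro sum_mono)
    fix S assume S: "S \<in> Pow U"
    show "\<psi> S * \<phi> S * (g (sym_diff S S))\<^sup>2 \<le> (\<Sum>T\<in>Pow U. \<psi> S * \<phi> T * (g (sym_diff S T))\<^sup>2)"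
      using S U \<psi> \<phi> by (intro member_le_sum) auto
  qed
  finally show ?thesis using eq by simp
qed

text \<open>Flipping coordinate \<open>u\<close> multiplies the character at \<open>x\<close> by -1
  exactly when \<open>u\<close> lies in \<open>x\<close>. Summing over \<open>u\<close> shows that
  the adjacency operator of the cube is diagonal in the basis of characters.\<close>

lemma fourier_adjacency:
  assumes U: "finite U" and x: "x \<subseteq> U"
  shows "fourier U (adjacency U \<phi>) x = (real (card U) - 2 * real (card x)) * fourier U \<phi> x"
proof -
  have fin: "finite S" if "S \<in> Pow U" for S using that U finite_subset by auto
  have "fourier U (adjacency U \<phi>) x = (\<Sum>u\<in>U. \<Sum>S\<in>Pow U. \<phi> (sym_diff S {u}) * chi x S)"
    unfolding fourier_def adjacency_def by (subst sum.swap) (simp add: sum_distrib_right)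
  also have "\<dots> = (\<Sum>u\<in>U. chi x {u} * fourier U \<phi> x)"
  proof (intro sum.cong refl)
    fix u assume u: "u \<in> U"
    have "(\<Sum>S\<in>Pow U. \<phi> (sym_diff S {u}) * chi x S)
        = (\<Sum>S\<in>Pow U. (\<lambda>S. \<phi> (sym_diff S {u}) * chi x S) (sym_diff {u} S))"
      using u by (intro sum_Pow_translate [symmetric]) auto
    also have "\<dots> = (\<Sum>S\<in>Pow U. \<phi> S * chi x S * chi x {u})"
    proof (intro sum.cong refl)
      fix S assume S: "S \<in> Pow U"
      have "sym_diff (sym_diff {u} S) {u} = S" by auto
      moreover have "chi x (sym_diff {u} S) = chi x {u} * chi x S"
        using S fin by (intro chi_sym_diff) auto
      ultimately show "\<phi> (sym_diff (sym_diff {u} S) {u}) * chi x (sym_diff {u} S) = \<phi> S * chi x S * chi x {u}"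
        by simp
    qed
    finally show "(\<Sum>S\<in>Pow U. \<phi> (sym_diff S {u}) * chi x S) = chi x {u} * fourier U \<phi> x"
      by (simp add: fourier_def sum_distrib_left algebra_simps)
  qed
  also have "\<dots> = (\<Sum>u\<in>U. if u \<in> x then -1 else 1) * fourier U \<phi> x"
    unfolding sum_distrib_right [symmetric]
    by (intro arg_cong2 [where f = "(*)"] sum.cong refl) (auto simp: chi_def)
  also have "(\<Sum>u\<in>U. if u \<in> x then -1 else (1::real)) = real (card U) - 2 * real (card x)"
  proof -
    have "real (card U) = card x + card (U - x)"
      using x U by (metis card_Diff_subset card_mono finite_subset le_add_diff_inverse of_nat_add)
    moreover have "U \<inter> {u. u \<in> x} = x" "U \<inter> - {u. u \<in> x} = U - x" using x by auto
    ultimately show ?thesis using U by (simp add: sum.If_cases)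
  qed
  finally show ?thesis .
qed

text \<open>\<open>t\<close> is the degree and \<open>i\<close> the argument. The generating
  function serves as definition because a character sum over all subsets factorises over coordinates
  in just this form.\<close>

definition krawtchouk :: "nat \<Rightarrow> nat \<Rightarrow> nat \<Rightarrow> real" where
  "krawtchouk n t i = coeff ([:1, -1:] ^ i * [:1, 1:] ^ (n - i)) t"

lemma sum_chi_level:
  assumes U: "finite U" and x: "x \<subseteq> U"
  shows "(\<Sum>S | S \<subseteq> U \<and> card S = t. chi x S) = krawtchouk (card U) t (card x)"
proof -
  \<comment> \<open>Each coordinate contributes a factor \<open>1 + f u\<close>. The degree of the
    monomial of a subset records its size, so the coefficient at \<open>t\<close> picks out one
    level.\<close>
  define f :: "'a \<Rightarrow> real poly" where "f u = monom (if u \<in> x then -1 else 1) 1" for u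
  have fS: "(\<Prod>u\<in>S. f u) = monom (chi x S) (card S)" if "finite S" for S
    using that unfolding chi_prod [OF that] f_def
    by (induction S) (auto simp: mult_monom)
  have "[:1, -1:] ^ card x * [:1, 1:] ^ (card U - card x) = (\<Prod>u\<in>U. 1 + f u)"
  proof -
    have fx: "finite x" using x U finite_subset by auto
    have "(\<Prod>u\<in>U. 1 + f u) = (\<Prod>u\<in>x. 1 + f u) * (\<Prod>u\<in>U - x. 1 + f u)"
      using x U by (simp add: prod.subset_diff mult.commute)
    also have "(\<Prod>u\<in>x. 1 + f u) = (\<Prod>u\<in>x. [:1, -1:])"
      by (intro prod.cong refl) (simp add: f_def monom_altdef one_pCons)
    also have "(\<Prod>u\<in>U - x. 1 + f u) = (\<Prod>u\<in>U - x. [:1, 1:])"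
      by (intro prod.cong refl) (simp add: f_def monom_altdef one_pCons)
    finally show ?thesis using x fx by (simp add: card_Diff_subset)
  qed
  also have "\<dots> = (\<Sum>S\<in>Pow U. \<Prod>u\<in>S. f u)"
    by (rule sum_Pow_prod [symmetric, OF U])
  also have "\<dots> = (\<Sum>S\<in>Pow U. monom (chi x S) (card S))"
    using U by (intro sum.cong refl fS) (auto intro: finite_subset)
  finally have "krawtchouk (card U) t (card x) = (\<Sum>S\<in>Pow U. if card S = t then chi x S else 0)"
    unfolding krawtchouk_def by (simp add: coeff_sum)
  also have "\<dots> = (\<Sum>S | S \<subseteq> U \<and> card S = t. chi x S)"
    using U by (simp add: sum.inter_filter [symmetric] Pow_def)
  finally show ?thesis by simp
qed

lemma sum_level:
  assumes U: "finite U"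
  shows "(\<Sum>S\<in>Pow U. f S) = (\<Sum>t\<le>card U. \<Sum>S | S \<subseteq> U \<and> card S = t. f S)"
proof -
  have "(\<Sum>S\<in>Pow U. f S) = (\<Sum>t\<in>{..card U}. \<Sum>S | S \<in> Pow U \<and> card S = t. f S)"
    using U by (intro sum.group [symmetric]) (auto intro: card_mono)
  then show ?thesis by simp
qed

lemma card_level: "finite U \<Longrightarrow> card {S. S \<subseteq> U \<and> card S = t} = card U choose t"
  by (rule n_subsets)

lemma fourier_radial:
  assumes U: "finite U" and x: "x \<subseteq> U"
  shows "fourier U (\<lambda>S. w (card S)) x = (\<Sum>t\<le>card U. w t * krawtchouk (card U) t (card x))"
  unfolding fourier_def sum_level [OF U] 
  by (intro sum.cong refl) (simp add: sum_chi_level [OF assms, symmetric] sum_distrib_left)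

lemma card_sym_diff_single:
  assumes "finite S"
  shows "card (sym_diff S {u}) = (if u \<in> S then card S - 1 else card S + 1)"
proof (cases "u \<in> S")
  case True
  then have "sym_diff S {u} = S - {u}" by auto
  then show ?thesis using True assms by simp
next
  case False
  then have "sym_diff S {u} = insert u S" by auto
  then show ?thesis using False assms by simp
qed

lemma adjacency_radial:
  assumes U: "finite U" and S: "S \<subseteq> U"
  shows "adjacency U (\<lambda>S. w (card S)) S
    = real (card S) * w (card S - 1) + (real (card U) - real (card S)) * w (card S + 1)"
proof -
  have fS: "finite S" using U S finite_subset by auto
  have "adjacency U (\<lambda>S. w (card S)) S = (\<Sum>u\<in>U. if u \<in> S then w (card S - 1) else w (card S + 1))"
    unfolding adjacency_def by (intro sum.cong refl) (simp add: card_sym_diff_single fS)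
  moreover have "U \<inter> {u. u \<in> S} = S" "U \<inter> - {u. u \<in> S} = U - S" using S by auto
  moreover have "real (card (U - S)) = real (card U) - real (card S)"
    using S U fS by (simp add: card_Diff_subset card_mono of_nat_diff)
  ultimately show ?thesis using U by (simp add: sum.If_cases)
qed

text \<open>This recurrence runs in the argument \<open>i\<close>, not in the degree
  \<open>t\<close>: the character sum over a level is an eigenfunction of adjacency with eigenvalue
  n - 2 t, and adjacency moves a radial function to the two neighbouring weights. At
  \<open>i = 0\<close> the truncated \<open>i - 1\<close> is harmless because its coefficient is
  0.\<close>

lemma krawtchouk_recurrence:
  assumes "i \<le> n"
  shows "real i * krawtchouk n t (i - 1) + (real n - real i) * krawtchouk n t (i + 1) = (real n - 2 * real t) * krawtchouk n t i"
proof -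
  define U where "U = {..<n}"
  have U: "finite U" "card U = n" by (auto simp: U_def)
  define F where "F x = (\<Sum>S | S \<subseteq> U \<and> card S = t. chi x S)" for x
  define x where "x = {..<i}"
  have x: "x \<subseteq> U" "card x = i" using assms by (auto simp: x_def U_def)
  have F: "F y = krawtchouk n t (card y)" if "y \<subseteq> U" for y
    unfolding F_def using sum_chi_level [OF U(1) that] U by simp
  have fin: "finite S" if "S \<subseteq> U" for S using that U finite_subset by auto
  have "(\<Sum>u\<in>U. F (sym_diff x {u})) = (real n - 2 * real t) * F x"
  proof -
    have "(\<Sum>u\<in>U. F (sym_diff x {u})) = (\<Sum>S | S \<subseteq> U \<and> card S = t. \<Sum>u\<in>U. chi x S * chi S {u})"
      unfolding F_def 
      by (subst sum.swap, intro sum.cong refl)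
        (use fin x in \<open>simp add: chi_sym_diff' chi_commute [of _ "{_}"]\<close>)
    also have "\<dots> = (\<Sum>S | S \<subseteq> U \<and> card S = t. chi x S * (real n - 2 * real t))"
    proof (intro sum.cong refl)
      fix S assume S: "S \<in> {S. S \<subseteq> U \<and> card S = t}"
      have "(\<Sum>u\<in>U. chi S {u}) = (\<Sum>u\<in>U. if u \<in> S then -1 else 1)"
        by (intro sum.cong refl) (auto simp: chi_def)
      also have "\<dots> = real n - 2 * real t"
      proof -
        have "real n = t + card (U - S)"
          using S U by (simp add: card_Diff_subset fin of_nat_diff card_mono)
            (metis (no_types, lifting) U card_mono le_add_diff_inverse of_nat_add)
        moreover have "U \<inter> {u. u \<in> S} = S" "U \<inter> - {u. u \<in> S} = U - S" using S by auto
        ultimately show ?thesis using U S by (simp add: sum.If_cases)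
      qed
      finally show "(\<Sum>u\<in>U. chi x S * chi S {u}) = chi x S * (real n - 2 * real t)"
        by (simp add: sum_distrib_left [symmetric])
    qed
    finally show ?thesis by (simp add: F_def sum_distrib_left mult.commute)
  qed
  moreover have "(\<Sum>u\<in>U. F (sym_diff x {u})) = adjacency U (\<lambda>S. krawtchouk n t (card S)) x"
    unfolding adjacency_def using x by (intro sum.cong refl F) auto
  ultimately show ?thesis
    using adjacency_radial [OF U(1) x(1), of "krawtchouk n t"] x U F [OF x(1)] by simp
qed

lemma krawtchouk_0: "krawtchouk n t 0 = real (n choose t)"
proof -
  have "krawtchouk n t 0 = (\<Sum>S | S \<subseteq> {..<n} \<and> card S = t. chi {} S)"
    using sum_chi_level [of "{..<n}" "{}" t] by simp
  then show ?thesis using card_level [of "{..<n}" t] by simp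
qed

section \<open>Binomial estimates and growth of Krawtchouk polynomials\<close>

lemma Suc_choose_mult:
  assumes "k \<le> n"
  shows "real (Suc k) * real (n choose Suc k) = (real n - real k) * real (n choose k)"
proof -
  have "Suc k * (n choose Suc k) = (n - k) * (n choose k)"
    by (simp add: binomial_absorption binomial_absorb_comp del: mult_Suc)
  then have "real (Suc k * (n choose Suc k)) = real ((n - k) * (n choose k))" by simp
  then show ?thesis using assms by (simp add: of_nat_diff algebra_simps)
qed

text \<open>The terms of the expansion of (1 + Z)^n increase as long as k + 1 <= (n - k) Z, which
  means up to \<open>s\<close>; so the term at \<open>s\<close> is the largest of n + 1. Later
  instances take Z, s^2, 1 and s as the ratio.\<close>

lemma binomial_mode:
  fixes Z :: real
  assumes Z: "Z > 0" and s: "s = nat \<lfloor>(real n + 1) * (Z / (1 + Z))\<rfloor>"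
  shows "(1 + Z) ^ n \<le> (real n + 1) * (real (n choose s) * Z ^ s)" and "s \<le> n"
proof -
  define f where "f k = real (n choose k) * Z ^ k" for k
  have fnn: "f k \<ge> 0" for k using Z by (simp add: f_def)
  have rec: "real (Suc k) * f (Suc k) = (real n - real k) * Z * f k" if "k \<le> n" for k
  proof -
    have "real (Suc k) * f (Suc k) = real (Suc k) * real (n choose Suc k) * (Z * Z ^ k)"
      by (simp add: f_def mult_ac)
    then show ?thesis unfolding Suc_choose_mult [OF that] by (simp add: f_def mult_ac)
  qed
  have s_iff: "real k \<le> (real n + 1) * (Z / (1 + Z)) \<longleftrightarrow> k \<le> s" for k
    using Z by (simp add: s le_nat_iff le_floor_iff)
  have x: "real (Suc k) \<le> (real n + 1) * (Z / (1 + Z)) \<longleftrightarrow> real (Suc k) \<le> (real n - real k) * Z" for k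
    using Z by (simp add: field_simps)
  have "(real n + 1) * (Z / (1 + Z)) < real n + 1" using Z by (simp add: field_simps)
  then show sn: "s \<le> n" using s_iff [of s] by simp
  have up: "f k \<le> f (Suc k)" if "k < s" for k
  proof -
    have "k \<le> n" using that sn by simp
    have "real (Suc k) * f k \<le> (real n - real k) * Z * f k"
      using s_iff [of "Suc k"] x [of k] that fnn by (intro mult_right_mono) auto
    then have "real (Suc k) * f k \<le> real (Suc k) * f (Suc k)"
      using rec [OF \<open>k \<le> n\<close>] by simp
    then show ?thesis by (simp del: of_nat_Suc)
  qed
  have down: "f (Suc k) \<le> f k" if "s \<le> k" for k
  proof (cases "k \<le> n")
    case True
    have "(real n - real k) * Z * f k \<le> real (Suc k) * f k"
      using s_iff [of "Suc k"] x [of k] that fnn by (intro mult_right_mono) auto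
    then have "real (Suc k) * f (Suc k) \<le> real (Suc k) * f k"
      using rec [OF True] by simp
    then show ?thesis by (simp del: of_nat_Suc)
  next
    case False
    then show ?thesis by (simp add: f_def binomial_eq_0)
  qed
  have 1: "f k \<le> f s" if "k \<le> s" for k
    using that by (induction rule: inc_induct) (auto intro: order_trans up)
  have 2: "f k \<le> f s" if "s \<le> k" for k
    using that by (induction rule: dec_induct) (auto intro: order_trans down)
  have "(1 + Z) ^ n = (\<Sum>k\<le>n. f k)"
    using binomial_ring [of Z 1 n] by (simp add: f_def add.commute)
  also have "\<dots> \<le> (\<Sum>k\<le>n. f s)"
    by (intro sum_mono) (metis 1 2 nle_le)
  finally show "(1 + Z) ^ n \<le> (real n + 1) * (real (n choose s) * Z ^ s)"
    by (simp add: f_def add.commute)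
qed

text \<open>For independent bits with bias \<open>x\<close>, each word of weight at most x n has
  probability at least \<open>2 powr (- (n * h x))\<close>, and the probabilities add up to at most
  1.\<close>

lemma ball_volume:
  assumes x: "0 < x" "x \<le> 1/2" and T: "real T \<le> x * real n"
  shows "(\<Sum>t\<le>T. real (n choose t)) \<le> 2 powr (real n * h x)"
proof -
  define q where "q = 1 / 2 powr (real n * h x)"
  have Tn: "T \<le> n"
  proof -
    have "x * real n \<le> 1 * real n" using x by (intro mult_right_mono) auto
    then show ?thesis using T by simp
  qed
  have q: "q = x powr (real n * x) * (1 - x) powr (real n * (1 - x))"
    unfolding q_def using x by (simp add: powr_def h_def log_def exp_add [symmetric] exp_minus [symmetric] field_simps)
  have "(\<Sum>t\<le>T. real (n choose t)) * q = (\<Sum>t\<le>T. real (n choose t) * q)"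
    by (simp add: sum_distrib_right)
  also have "\<dots> \<le> (\<Sum>t\<le>T. real (n choose t) * (x ^ t * (1 - x) ^ (n - t)))"
  proof (intro sum_mono mult_left_mono)
    fix t assume "t \<in> {..T}"
    then have t: "real t \<le> x * real n" "t \<le> n" using T Tn by auto
    define a where "a = x * real n - real t"
    have "q = x ^ t * (1 - x) ^ (n - t) * (x powr a * (1 - x) powr (- a))"
      using x t by (simp add: q a_def powr_diff powr_minus powr_realpow [symmetric] of_nat_diff
          algebra_simps powr_add [symmetric] divide_simps)
    also have "x powr a * (1 - x) powr (- a) = (x / (1 - x)) powr a"
      using x by (simp add: powr_divide powr_minus divide_simps)
    also have "(x / (1 - x)) powr a \<le> 1"
      using x t by (intro powr_le1) (auto simp: a_def)
    finally show "q \<le> x ^ t * (1 - x) ^ (n - t)"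
      using x by (simp add: mult_left_le)
  qed auto
  also have "\<dots> \<le> (\<Sum>t\<le>n. real (n choose t) * (x ^ t * (1 - x) ^ (n - t)))"
    using x Tn by (intro sum_mono2) auto
  also have "\<dots> = 1"
    using binomial_ring [of x "1 - x" n] by (simp add: mult.assoc)
  finally show ?thesis
    by (simp add: q_def divide_simps)
qed

text \<open>The growth rate \<open>r = sqrt (\<delta> / (1 - \<delta>))\<close> survives one step of
  the recurrence if \<open>r\<^sup>2 * (n - i) + i \<le> r * (n - 2 * t)\<close>. The left side
  increases with \<open>i\<close> and equals 2 delta n at i = delta n; the hypothesis on
  \<open>t\<close> says that the right side is at least that.\<close>

lemma krawtchouk_growth:
  assumes d: "0 < \<delta>" "\<delta> < 1/2" and n: "n > 0"
    and t: "2 * sqrt (\<delta> * (1 - \<delta>)) * real n \<le> real n - 2 * real t"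
    and i: "real i \<le> \<delta> * real n"
  shows "0 \<le> krawtchouk n t i \<and> sqrt (\<delta> / (1 - \<delta>)) * krawtchouk n t i \<le> krawtchouk n t (Suc i)"
  using i
proof (induction i)
  define r where "r = sqrt (\<delta> / (1 - \<delta>))"
  define g where "g = sqrt (\<delta> * (1 - \<delta>))"
  have r0: "r > 0" using d by (simp add: r_def)
  have gr: "g * r = \<delta>" using d by (simp add: g_def r_def flip: real_sqrt_mult)
  have rr: "r * r = \<delta> / (1 - \<delta>)" using d by (simp add: r_def)
  have "r * (r * (1 - \<delta>)) = r * g"
    using gr rr d by (simp add: mult.assoc [symmetric] mult.commute)
  then have g: "g = r * (1 - \<delta>)" using r0 by simp
  {
    case 0
    have "real n * krawtchouk n t 1 = (real n - 2 * real t) * krawtchouk n t 0"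
      using krawtchouk_recurrence [of 0 n t] by simp
    moreover have "r * real n \<le> real n - 2 * real t"
    proof -
      have "r * 1 \<le> r * (2 * (1 - \<delta>))" using r0 d by (intro mult_left_mono) auto
      then have "r * real n \<le> 2 * g * real n" unfolding g by (intro mult_right_mono) (auto simp: algebra_simps)
      then show ?thesis using t by (simp add: g_def)
    qed
    moreover have K0: "krawtchouk n t 0 \<ge> 0" by (simp add: krawtchouk_0)
    ultimately have "r * real n * krawtchouk n t 0 \<le> real n * krawtchouk n t 1"
      by (metis mult_right_mono)
    then have "real n * (r * krawtchouk n t 0) \<le> real n * krawtchouk n t 1" by (simp add: mult_ac)
    then have "r * krawtchouk n t 0 \<le> krawtchouk n t 1" using n by simp
    then show ?case using K0 by (simp add: r_def)
  next
    case (Suc i)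
    let ?j = "Suc i"
    have j: "real ?j \<le> \<delta> * real n" by (rule Suc.prems)
    have jn: "real ?j < real n"
    proof -
      have "\<delta> * real n < 1 * real n" using d n by (intro mult_strict_right_mono) auto
      then show ?thesis using j by simp
    qed
    have IH: "0 \<le> krawtchouk n t i" "r * krawtchouk n t i \<le> krawtchouk n t ?j" using Suc.IH j by (auto simp: r_def)
    then have Kj: "0 \<le> krawtchouk n t ?j" using r0 by (meson mult_nonneg_nonneg less_imp_le order_trans)
    have rec: "real ?j * krawtchouk n t i + (real n - real ?j) * krawtchouk n t (Suc ?j) = (real n - 2 * real t) * krawtchouk n t ?j"
      using krawtchouk_recurrence [of ?j n t] jn by simp
    have key: "r * r * (real n - real ?j) + real ?j \<le> r * (real n - 2 * real t)"
    proof -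
      have "0 \<le> (\<delta> * real n - real ?j) * (1 - 2 * \<delta>)" using j d by (intro mult_nonneg_nonneg) auto
      then have "r * r * (real n - real ?j) + real ?j \<le> 2 * \<delta> * real n"
        unfolding rr using d by (simp add: field_simps)
      also have "\<dots> = r * (2 * g * real n)" using gr by (simp add: algebra_simps)
      also have "\<dots> \<le> r * (real n - 2 * real t)"
        using t r0 by (intro mult_left_mono) (auto simp: g_def)
      finally show ?thesis .
    qed
    have "r * (r * (real n - real ?j) * krawtchouk n t ?j) = (r * r * (real n - real ?j) + real ?j) * krawtchouk n t ?j - real ?j * krawtchouk n t ?j"
      by (simp add: algebra_simps)
    also have "\<dots> \<le> r * (real n - 2 * real t) * krawtchouk n t ?j - real ?j * (r * krawtchouk n t i)"
      using key IH Kj by (intro diff_mono mult_right_mono mult_left_mono) auto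
    also have "\<dots> = r * ((real n - real ?j) * krawtchouk n t (Suc ?j))"
    proof -
      have *: "(real n - real ?j) * krawtchouk n t (Suc ?j) = (real n - 2 * real t) * krawtchouk n t ?j - real ?j * krawtchouk n t i"
        using rec by linarith
      show ?thesis unfolding * by (simp add: algebra_simps)
    qed
    finally have "(real n - real ?j) * (r * krawtchouk n t ?j) \<le> (real n - real ?j) * krawtchouk n t (Suc ?j)"
      using r0 by (simp add: mult_ac del: of_nat_Suc)
    then have "r * krawtchouk n t ?j \<le> krawtchouk n t (Suc ?j)" using jn by (simp del: of_nat_Suc)
    then show ?case using Kj by (simp add: r_def)
  }
qed

lemma power_growth:
  fixes f :: "nat \<Rightarrow> real"
  assumes "\<And>j. j < s \<Longrightarrow> r * f j \<le> f (Suc j)" "r \<ge> 0" "i \<le> s"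
  shows "r ^ (s - i) * f i \<le> f s"
  using assms(3)
proof (induction rule: inc_induct)
  case base
  then show ?case by simp
next
  case (step k)
  have "r ^ (s - k) * f k = r ^ (s - Suc k) * (r * f k)"
    using step(2) by (metis Suc_diff_Suc mult.assoc mult.commute power_Suc)
  also have "\<dots> \<le> r ^ (s - Suc k) * f (Suc k)"
    using assms step by (intro mult_left_mono) auto
  finally show ?case using step by linarith
qed

section \<open>Linear programming: every large code has many close pairs\<close>

lemma fourier_level_sq:
  assumes U: "finite U" and i: "i \<le> card U"
  shows "real (card U choose i) * (\<Sum>t\<le>card U. w t * krawtchouk (card U) t i)\<^sup>2
     \<le> 2 ^ card U * (\<Sum>S\<in>Pow U. (w (card S))\<^sup>2)"
proof -
  have "real (card U choose i) * (\<Sum>t\<le>card U. w t * krawtchouk (card U) t i)\<^sup>2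
     = (\<Sum>x | x \<subseteq> U \<and> card x = i. (fourier U (\<lambda>S. w (card S)) x)\<^sup>2)"
    using U by (simp add: fourier_radial card_level)
  also have "\<dots> \<le> (\<Sum>x\<in>Pow U. (fourier U (\<lambda>S. w (card S)) x)\<^sup>2)"
    using U by (intro sum_mono2) auto
  finally show ?thesis using parseval [OF U] by simp
qed

text \<open>Delsarte's inequality is applied to \<open>\<phi>\<close> and to the adjacency image of
  \<open>\<phi>\<close> minus (n - 2 a) \<open>\<phi>\<close>. The transform of the latter is 2 (a -
  |x|) times that of \<open>\<phi>\<close>, so pairs farther apart than \<open>a\<close> contribute
  nothing positive. The extra 1 in \<open>eig\<close> gives \<open>\<psi> S \<ge> \<phi> S\<close>,
  so the left side is at least the squared norm of \<open>\<phi>\<close>; \<open>big\<close> lets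
  the diagonal pairs be absorbed into half of it.\<close>

lemma close_pairs_bound:
  fixes c :: "'i \<Rightarrow> 'a set" and w :: "nat \<Rightarrow> real"
  assumes U: "finite U" "card U = n" "n > 0" and I: "finite I" and c: "\<And>i. i \<in> I \<Longrightarrow> c i \<subseteq> U"
    and d: "0 < \<delta>" "\<delta> < 1/2" and Z: "Z = \<delta> / (1 - \<delta>)"
    and w0: "\<And>t. 0 \<le> w t"
    and wT: "\<And>t. w t \<noteq> 0 \<Longrightarrow> t \<le> T"
    and T: "2 * sqrt (\<delta> * (1 - \<delta>)) * real n \<le> real n - 2 * real T"
    and a: "\<delta> * real n \<le> a" "a \<le> real n / 2"
    and eig: "\<And>t. t \<le> n \<Longrightarrow> (real n - 2 * a + 1) * w t \<le> real t * w (t - 1) + (real n - real t) * w (t + 1)"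
    and pos: "t1 \<le> n" "w t1 \<noteq> 0"
    and big: "2 * real n * (\<Sum>t\<le>T. real (n choose t)) \<le> real (card I)"
  shows "(real (card I))\<^sup>2 * ((1 + Z) / 2) ^ n
      \<le> 2 * real n * (real n + 1) * (1 / Z) powr (a - \<delta> * real n + 1)
        * (\<Sum>i\<in>I. \<Sum>j | j \<in> I \<and> j \<noteq> i \<and> real (sdist (c i) (c j)) \<le> a. Z ^ sdist (c i) (c j))"
proof -
  define \<phi> :: "'a set \<Rightarrow> real" where "\<phi> S = w (card S)" for S
  define lam where "lam = real n - 2 * a"
  define \<psi> where "\<psi> S = adjacency U \<phi> S - lam * \<phi> S" for S
  define K where "K i = (\<Sum>t\<le>n. w t * krawtchouk n t i)" for i
  define F where "F = (\<Sum>S\<in>Pow U. (\<phi> S)\<^sup>2)"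
  define V where "V = (\<Sum>t\<le>T. real (n choose t))"
  define \<Gamma> where "\<Gamma> = (1 / Z) powr (a - \<delta> * real n + 1)"
  define s where "s = nat \<lfloor>(real n + 1) * (Z / (1 + Z))\<rfloor>"
  have Zpos: "Z > 0" "Z < 1" using d Z by auto
  have Zd: "Z / (1 + Z) = \<delta>"
  proof -
    have "1 + Z = 1 / (1 - \<delta>)" using d Z by (simp add: field_simps)
    then show ?thesis using d Z by simp
  qed
  have mode: "(1 + Z) ^ n \<le> (real n + 1) * (real (n choose s) * Z ^ s)" "s \<le> n"
    using binomial_mode [OF Zpos(1) s_def] by auto
  have s1: "real s \<le> (real n + 1) * \<delta>" using d by (simp add: s_def Zd)
  have s2: "\<delta> * real n - 1 < real s"
  proof -
    have "(real n + 1) * \<delta> - 1 < real_of_int \<lfloor>(real n + 1) * \<delta>\<rfloor>" by linarith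
    also have "\<dots> = real s" using d by (simp add: s_def Zd)
    finally show ?thesis using d by (simp add: algebra_simps)
  qed
  have finS: "finite S" if "S \<subseteq> U" for S using that U finite_subset by auto
  have cardS: "card S \<le> n" if "S \<subseteq> U" for S using that U card_mono by metis
  have \<phi>0: "0 \<le> \<phi> S" for S by (simp add: \<phi>_def w0)
  have \<psi>\<phi>: "\<phi> S \<le> \<psi> S" if "S \<subseteq> U" for S
  proof -
    have "(lam + 1) * \<phi> S \<le> adjacency U \<phi> S"
      unfolding \<phi>_def using adjacency_radial [OF U(1) that, of w] eig [OF cardS [OF that]] U(2)
      by (simp add: lam_def)
    then show ?thesis by (simp add: \<psi>_def algebra_simps)
  qed
  have fourier\<phi>: "fourier U \<phi> x = K (card x)" if "x \<subseteq> U" for x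
    unfolding \<phi>_def K_def using fourier_radial [OF U(1) that, of w] U(2) by simp
  have fourier\<psi>: "fourier U \<psi> x = 2 * (a - real (card x)) * K (card x)" if "x \<subseteq> U" for x
  proof -
    have "fourier U \<psi> x = fourier U (adjacency U \<phi>) x - lam * fourier U \<phi> x"
      by (simp add: fourier_def \<psi>_def sum_subtractf sum_distrib_left algebra_simps)
    also have "\<dots> = (real n - 2 * real (card x) - lam) * fourier U \<phi> x"
      using fourier_adjacency [OF U(1) that, of \<phi>] U(2) by (simp add: algebra_simps)
    finally show ?thesis using fourier\<phi> [OF that] by (simp add: lam_def)
  qed
  have Fpos: "F > 0"
  proof -
    obtain S where S: "S \<subseteq> U" "card S = t1" using pos U by (metis obtain_subset_with_card_n)
    show ?thesis unfolding F_def
      using S pos U by (intro sum_pos2 [of _ S]) (auto simp: \<phi>_def)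
  qed
  have growth: "0 \<le> K i \<and> sqrt Z * K i \<le> K (Suc i)" if "real i \<le> \<delta> * real n" for i
  proof -
    have "0 \<le> w t * krawtchouk n t i \<and> sqrt Z * (w t * krawtchouk n t i) \<le> w t * krawtchouk n t (Suc i)" for t
    proof (cases "w t = 0")
      case False
      have "real t \<le> real T" using wT [OF False] by simp
      then have "2 * sqrt (\<delta> * (1 - \<delta>)) * real n \<le> real n - 2 * real t" using T by linarith
      then have "0 \<le> krawtchouk n t i \<and> sqrt Z * krawtchouk n t i \<le> krawtchouk n t (Suc i)"
        unfolding Z using krawtchouk_growth [OF d U(3) _ that] by blast
      then show ?thesis using w0 [of t]
        by (metis (no_types, opaque_lifting) mult.left_commute mult_left_mono mult_nonneg_nonneg)
    qed simp
    then show ?thesis unfolding K_def sum_distrib_left by (auto intro: sum_nonneg sum_mono)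
  qed
  have level: "real (n choose i) * (K i)\<^sup>2 \<le> 2 ^ n * F" if "i \<le> n" for i
    using fourier_level_sq [OF U(1), of i w] that U(2) by (simp add: K_def F_def \<phi>_def)
  have \<Gamma>1: "1 \<le> \<Gamma>" unfolding \<Gamma>_def using Zpos a by (intro ge_one_powr_ge_zero) auto
  \<comment> \<open>This produces the weight \<open>Z ^ i\<close> of a close pair. Growth at rate
    \<open>sqrt Z\<close> carries the value at \<open>i\<close> up to the mode \<open>s\<close>,
    where Parseval restricted to one level bounds it by means of \<open>n choose s\<close>. Between
    \<open>s\<close> and \<open>a\<close> the monotonicity of binomial coefficients below n / 2
    takes over, at the price of \<open>\<Gamma>\<close>.\<close>
  have Kbound: "(K i)\<^sup>2 * (1 + Z) ^ n \<le> (real n + 1) * \<Gamma> * (2 ^ n * F) * Z ^ i" if i: "real i \<le> a" for i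
  proof -
    have "Z ^ s * (real (n choose s) * (K i)\<^sup>2) \<le> \<Gamma> * (2 ^ n * F) * Z ^ i"
    proof (cases "i \<le> s")
      case True
      \<comment> \<open>The mode \<open>s\<close> may exceed delta n, but by less than 1, so each
        \<open>j\<close> below \<open>s\<close> is still in the range of
        \<open>growth\<close>.\<close>
      have "real j \<le> \<delta> * real n" if "j < s" for j
      proof -
        have "real j + 1 \<le> real s" using that by linarith
        then show ?thesis using s1 d by (simp add: algebra_simps)
      qed
      note gr = growth [OF this]
      have "sqrt Z ^ (s - i) * K i \<le> K s"
        using gr Zpos True by (intro power_growth) auto
      moreover have "0 \<le> sqrt Z ^ (s - i) * K i"
      proof (cases "i = s")
        case True
        show ?thesis
        proof (cases s)
          case 0
          then show ?thesis using True growth [of 0] d by simp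
        next
          case (Suc s')
          then show ?thesis using True gr [of s'] Zpos
            by (simp) (meson order_trans mult_nonneg_nonneg real_sqrt_ge_zero less_imp_le)
        qed
      next
        case False
        then show ?thesis using gr [of i] True Zpos by auto
      qed
      ultimately have "(sqrt Z ^ (s - i) * K i)\<^sup>2 \<le> (K s)\<^sup>2" by (intro power_mono) auto
      then have Ks: "Z ^ (s - i) * (K i)\<^sup>2 \<le> (K s)\<^sup>2"
      proof -
        have "(sqrt Z ^ (s - i))\<^sup>2 = ((sqrt Z)\<^sup>2) ^ (s - i)"
          by (simp only: power_mult [symmetric] mult.commute)
        then show ?thesis using \<open>(sqrt Z ^ (s - i) * K i)\<^sup>2 \<le> (K s)\<^sup>2\<close> Zpos
          by (simp add: power_mult_distrib)
      qed
      have "Z ^ s * (real (n choose s) * (K i)\<^sup>2) = Z ^ i * (real (n choose s) * (Z ^ (s - i) * (K i)\<^sup>2))"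
        using True by (simp add: power_add [symmetric] mult_ac)
      also have "\<dots> \<le> Z ^ i * (real (n choose s) * (K s)\<^sup>2)"
        using Ks Zpos by (intro mult_left_mono) auto
      also have "\<dots> \<le> Z ^ i * (2 ^ n * F)"
        using level [OF mode(2)] Zpos by (intro mult_left_mono) auto
      also have "\<dots> \<le> \<Gamma> * (2 ^ n * F) * Z ^ i"
        using \<Gamma>1 Zpos Fpos by (simp add: mult_ac)
      finally show ?thesis .
    next
      case False
      have i2: "2 * i \<le> n" using i a by linarith
      have "(n choose s) \<le> (n choose i)" using False i2 by (intro binomial_mono) auto
      then have "real (n choose s) * (K i)\<^sup>2 \<le> real (n choose i) * (K i)\<^sup>2"
        by (intro mult_right_mono) auto
      also have "\<dots> \<le> 2 ^ n * F" using level i2 by simp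
      finally have "Z ^ s * (real (n choose s) * (K i)\<^sup>2) \<le> Z ^ s * (2 ^ n * F)"
        using Zpos by (intro mult_left_mono) auto
      also have "\<dots> \<le> (\<Gamma> * Z ^ i) * (2 ^ n * F)"
      proof (rule mult_right_mono)
        have "Z ^ s = (1 / Z) powr (real i - real s) * Z ^ i"
          using Zpos by (simp add: powr_diff powr_realpow power_one_over field_simps)
        also have "\<dots> \<le> \<Gamma> * Z ^ i"
          unfolding \<Gamma>_def using Zpos i s2 by (intro mult_right_mono powr_mono) auto
        finally show "Z ^ s \<le> \<Gamma> * Z ^ i" .
      qed (use Fpos in simp)
      finally show ?thesis by (simp add: mult_ac)
    qed
    then have 1: "(real n + 1) * (Z ^ s * (real (n choose s) * (K i)\<^sup>2)) \<le> (real n + 1) * (\<Gamma> * (2 ^ n * F) * Z ^ i)"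
      by (rule mult_left_mono) simp
    have "(K i)\<^sup>2 * (1 + Z) ^ n \<le> (K i)\<^sup>2 * ((real n + 1) * (real (n choose s) * Z ^ s))"
      using mode by (intro mult_left_mono) auto
    also have "\<dots> = (real n + 1) * (Z ^ s * (real (n choose s) * (K i)\<^sup>2))" by simp
    also note 1
    finally show ?thesis by (simp only: mult_ac)
  qed
  \<comment> \<open>The diagonal terms: \<open>\<phi>\<close> is supported on a ball of radius
    \<open>T\<close>, so Cauchy-Schwarz compares its total mass with the volume of that
    ball.\<close>
  have K0: "(K 0)\<^sup>2 \<le> V * F"
  proof -
    have "K 0 = (\<Sum>S\<in>Pow U. \<phi> S)" using fourier\<phi> [of "{}"] by (simp add: fourier_def)
    also have "\<dots> = (\<Sum>S | S \<subseteq> U \<and> card S \<le> T. \<phi> S * 1)"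
      using U wT by (intro sum.mono_neutral_cong_right) (auto simp: \<phi>_def)
    finally have C: "(K 0)\<^sup>2 \<le> (\<Sum>S | S \<subseteq> U \<and> card S \<le> T. (\<phi> S)\<^sup>2) * (\<Sum>S | S \<subseteq> U \<and> card S \<le> T. 1\<^sup>2)"
      using Cauchy_Schwarz_ineq_sum [of \<phi> "\<lambda>_. 1" "{S. S \<subseteq> U \<and> card S \<le> T}"] by simp
    have A: "(\<Sum>S | S \<subseteq> U \<and> card S \<le> T. (\<phi> S)\<^sup>2) \<le> F"
      unfolding F_def using U by (intro sum_mono2) auto
    have B: "(\<Sum>S | S \<subseteq> U \<and> card S \<le> T. 1\<^sup>2) = V"
    proof -
      have "{S. S \<subseteq> U \<and> card S \<le> T} = (\<Union>t\<le>T. {S. S \<subseteq> U \<and> card S = t})" by auto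
      then have "card {S. S \<subseteq> U \<and> card S \<le> T} = (\<Sum>t\<le>T. card {S. S \<subseteq> U \<and> card S = t})"
        using U by (simp) (subst card_UN_disjoint, auto)
      then show ?thesis using U by (simp add: V_def card_level)
    qed
    have "0 \<le> V" by (simp add: V_def sum_nonneg)
    then have "(\<Sum>S | S \<subseteq> U \<and> card S \<le> T. (\<phi> S)\<^sup>2) * V \<le> F * V" using A by (intro mult_right_mono)
    then show ?thesis using C unfolding B by (simp only: mult.commute)
  qed
  define J where "J i = {j \<in> I. j \<noteq> i \<and> real (sdist (c i) (c j)) \<le> a}" for i
  have JI: "J i \<subseteq> I" "finite (J i)" for i using I by (auto simp: J_def)
  have "(real (card I))\<^sup>2 * F \<le> (real (card I))\<^sup>2 * (\<Sum>S\<in>Pow U. \<psi> S * \<phi> S)"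
    unfolding F_def power2_eq_square
    using \<psi>\<phi> \<phi>0 by (intro mult_left_mono sum_mono mult_right_mono) auto
  also have "\<dots> \<le> (\<Sum>i\<in>I. \<Sum>j\<in>I. fourier U \<psi> (sym_diff (c i) (c j)) * fourier U \<phi> (sym_diff (c i) (c j)))"
    using U I c order_trans [OF \<phi>0 \<psi>\<phi>] \<phi>0 by (intro delsarte_inequality) auto
  also have "\<dots> = (\<Sum>i\<in>I. \<Sum>j\<in>I. 2 * (a - real (sdist (c i) (c j))) * (K (sdist (c i) (c j)))\<^sup>2)"
  proof (intro sum.cong refl)
    fix i j assume "i \<in> I" "j \<in> I"
    then have x: "sym_diff (c i) (c j) \<subseteq> U" using c by blast
    show "fourier U \<psi> (sym_diff (c i) (c j)) * fourier U \<phi> (sym_diff (c i) (c j)) = 2 * (a - real (sdist (c i) (c j))) * (K (sdist (c i) (c j)))\<^sup>2"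
      unfolding fourier\<psi> [OF x] fourier\<phi> [OF x] sdist_def power2_eq_square by simp
  qed
  also have "\<dots> \<le> (\<Sum>i\<in>I. real n * (K 0)\<^sup>2 + (\<Sum>j\<in>J i. real n * (K (sdist (c i) (c j)))\<^sup>2))"
  proof (intro sum_mono)
    fix i assume i: "i \<in> I"
    define q where "q j = 2 * (a - real (sdist (c i) (c j))) * (K (sdist (c i) (c j)))\<^sup>2" for j
    have an: "2 * a \<le> real n" using a by simp
    have qle: "q j \<le> real n * (K (sdist (c i) (c j)))\<^sup>2" for j
      unfolding q_def using an by (intro mult_right_mono) auto
    have "(\<Sum>j\<in>I. q j) = q i + (\<Sum>j\<in>I - {i}. q j)" using I i by (simp add: sum.remove)
    also have "(\<Sum>j\<in>I - {i}. q j) \<le> (\<Sum>j\<in>J i. q j)"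
    proof -
      have "(\<Sum>j\<in>I - {i}. q j) = (\<Sum>j\<in>J i. q j) + (\<Sum>j\<in>I - {i} - J i. q j)"
        using I by (subst sum.subset_diff [of "J i"]) (auto simp: J_def)
      also have "(\<Sum>j\<in>I - {i} - J i. q j) \<le> 0"
        by (intro sum_nonpos) (auto simp: J_def q_def mult_nonpos_nonneg)
      finally show ?thesis by simp
    qed
    also have "(\<Sum>j\<in>J i. q j) \<le> (\<Sum>j\<in>J i. real n * (K (sdist (c i) (c j)))\<^sup>2)"
      by (intro sum_mono qle)
    also have "q i \<le> real n * (K 0)\<^sup>2" using qle [of i] by (simp add: sdist_def)
    finally show "(\<Sum>j\<in>I. 2 * (a - real (sdist (c i) (c j))) * (K (sdist (c i) (c j)))\<^sup>2)
      \<le> real n * (K 0)\<^sup>2 + (\<Sum>j\<in>J i. real n * (K (sdist (c i) (c j)))\<^sup>2)"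
      by (simp add: q_def)
  qed
  also have "\<dots> = real (card I) * (real n * (K 0)\<^sup>2) + real n * (\<Sum>i\<in>I. \<Sum>j\<in>J i. (K (sdist (c i) (c j)))\<^sup>2)"
    by (simp add: sum.distrib sum_distrib_left)
  also have "real (card I) * (real n * (K 0)\<^sup>2) \<le> real (card I) * (real (card I) / 2 * F)"
  proof (intro mult_left_mono)
    have "real n * (K 0)\<^sup>2 \<le> real n * (V * F)" using K0 by (intro mult_left_mono) auto
    also have "\<dots> = real n * V * F" by simp
    also have "\<dots> \<le> real (card I) / 2 * F" using big Fpos by (intro mult_right_mono) (auto simp: V_def)
    finally show "real n * (K 0)\<^sup>2 \<le> real (card I) / 2 * F" .
  qed auto
  finally have main: "(real (card I))\<^sup>2 * F \<le> 2 * real n * (\<Sum>i\<in>I. \<Sum>j\<in>J i. (K (sdist (c i) (c j)))\<^sup>2)"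
    by (simp add: power2_eq_square)
  have "(real (card I))\<^sup>2 * (1 + Z) ^ n * F \<le> 2 * real n * (\<Sum>i\<in>I. \<Sum>j\<in>J i. (K (sdist (c i) (c j)))\<^sup>2 * (1 + Z) ^ n)"
  proof -
    have "(real (card I))\<^sup>2 * F * (1 + Z) ^ n \<le> 2 * real n * (\<Sum>i\<in>I. \<Sum>j\<in>J i. (K (sdist (c i) (c j)))\<^sup>2) * (1 + Z) ^ n"
      using main Zpos by (intro mult_right_mono) auto
    then show ?thesis by (simp add: sum_distrib_right mult.assoc mult.commute [of F])
  qed
  also have "\<dots> \<le> 2 * real n * (\<Sum>i\<in>I. \<Sum>j\<in>J i. (real n + 1) * \<Gamma> * (2 ^ n * F) * Z ^ sdist (c i) (c j))"
    by (intro mult_left_mono sum_mono Kbound) (auto simp: J_def)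
  also have "\<dots> = (2 * real n * (real n + 1) * \<Gamma> * (\<Sum>i\<in>I. \<Sum>j\<in>J i. Z ^ sdist (c i) (c j))) * 2 ^ n * F"
    by (simp only: sum_distrib_left sum_distrib_right mult_ac)
  finally have "(real (card I))\<^sup>2 * (1 + Z) ^ n \<le> (2 * real n * (real n + 1) * \<Gamma> * (\<Sum>i\<in>I. \<Sum>j\<in>J i. Z ^ sdist (c i) (c j))) * 2 ^ n"
    using Fpos by simp
  then show ?thesis
    by (simp add: power_divide divide_simps \<Gamma>_def J_def)
qed

text \<open>For the profile \<open>z ^ t\<close> both neighbour terms are close to
  \<open>n * sqrt (x * (1 - x)) * z ^ t\<close> when \<open>t\<close> is near x n, so this profile
  nearly attains the eigenvalue \<open>2 * n * sqrt (x * (1 - x))\<close>. Multiplying by a tent of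
  half-width \<open>m\<close> localises it at the cost of the factor 1 - 1/m. The correction
  \<open>(m + 1) / z\<close> pays for the deviation of \<open>t\<close> from x n within the
  tent.\<close>

lemma tent_eigen:
  fixes x z :: real and m t0 :: nat
  assumes x: "0 < x" "x < 1/2" and z: "z = sqrt (x / (1 - x))" and m: "m \<ge> 1" 
    and t0: "t0 = nat \<lfloor>x * real n\<rfloor>" "m < t0" and t: "t \<le> n"
    and w: "\<And>t. w t = max 0 (real m - \<bar>real t - real t0\<bar>) * z ^ t"
    and lam: "lam \<le> (2 - 2 / real m) * (real n * sqrt (x * (1 - x)) - (real m + 1) / z)"
  shows "lam * w t \<le> real t * w (t - 1) + (real n - real t) * w (t + 1)"
proof -
  define v where "v t = max 0 (real m - \<bar>real t - real t0\<bar>)" for t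
  define g where "g = sqrt (x * (1 - x))"
  define G where "G = real n * g - (real m + 1) / z"
  have z0: "z > 0" "z \<le> 1" using x by (auto simp: z)
  have gz: "g * z = x" using x by (simp add: g_def z flip: real_sqrt_mult)
  have zz: "z * z = x / (1 - x)" using x by (simp add: z)
  have "z * (z * (1 - x)) = z * g" using gz zz x by (simp add: mult.assoc [symmetric] mult.commute)
  then have g: "g = z * (1 - x)" using z0 by simp
  have v0: "v t \<ge> 0" for t by (simp add: v_def)
  have ft0: "real t0 \<le> x * real n" "x * real n - 1 < real t0"
    using x by (auto simp: t0(1))
  show ?thesis
  proof (cases "v t = 0")
    case True
    then have "w t = 0" by (simp add: w v_def)
    moreover have "0 \<le> w k" for k using z0 by (simp add: w)
    ultimately show ?thesis using t by simp
  next
    case False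
    then have tt: "\<bar>real t - real t0\<bar> < real m" unfolding v_def by linarith
    then have t1: "t \<ge> 1" using t0(2) by linarith
    have 1: "G * z \<le> real t"
    proof -
      have "G * z = real n * x - (real m + 1)" using z0 unfolding gz [symmetric] by (simp add: G_def left_diff_distrib)
      also have "\<dots> \<le> real t" using tt ft0 by (simp add: mult.commute)
      finally show ?thesis .
    qed
    have 2: "G \<le> (real n - real t) * z"
    proof -
      have "(real n - real t) * z \<ge> (real n - x * real n - real m) * z"
        using tt ft0 z0 by (intro mult_right_mono) auto
      moreover have "(real n - x * real n - real m) * z = real n * g - real m * z"
        by (simp add: g algebra_simps)
      moreover have "real m * z \<le> (real m + 1) / z"
      proof -
        have "real m * z \<le> (real m + 1) * 1" using z0 by (intro mult_mono) auto
        also have "\<dots> \<le> (real m + 1) * (1 / z)" using z0 by (intro mult_left_mono) auto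
        finally show ?thesis by simp
      qed
      ultimately show ?thesis unfolding G_def by linarith
    qed
    \<comment> \<open>Away from its peak the tent is affine or convex; at the peak of height
      \<open>m\<close> the two neighbours together fall short by 2.\<close>
    have tent: "(2 - 2 / real m) * v t \<le> v (t - 1) + v (t + 1)"
    proof (cases "t = t0")
      case True
      have "(2 - 2 / real m) * v t = 2 * real m - 2" using True m by (simp add: v_def field_simps)
      moreover have "v (t - 1) \<ge> real m - 1" "v (t + 1) \<ge> real m - 1"
        using True t1 by (auto simp: v_def of_nat_diff)
      ultimately show ?thesis by linarith
    next
      case False
      have "(2 - 2 / real m) * v t \<le> 2 * v t" using v0 [of t] m by (intro mult_right_mono) auto
      also have "2 * v t \<le> v (t - 1) + v (t + 1)"
      proof (cases "t < t0")
        case True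
        then have "real t + 1 \<le> real t0" by linarith
        then show ?thesis using tt t1 by (simp add: v_def of_nat_diff)
      next
        case F: False
        then have "real t0 + 1 \<le> real t" using False by linarith
        then show ?thesis using tt t1 by (simp add: v_def of_nat_diff)
      qed
      finally show ?thesis .
    qed
    show ?thesis
    proof (cases "G \<ge> 0")
      case True
      have "lam * w t \<le> (2 - 2 / real m) * G * w t"
        using lam z0 by (intro mult_right_mono) (auto simp: w G_def g_def)
      also have "\<dots> = ((2 - 2 / real m) * v t) * (G * z ^ t)" by (simp add: w v_def)
      also have "\<dots> \<le> (v (t - 1) + v (t + 1)) * (G * z ^ t)"
        using tent True z0 by (intro mult_right_mono) auto
      also have "\<dots> = v (t - 1) * (G * z) * z ^ (t - 1) + v (t + 1) * G * z ^ t"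
        using t1 by (cases t) (auto simp: algebra_simps)
      also have "\<dots> \<le> v (t - 1) * real t * z ^ (t - 1) + v (t + 1) * ((real n - real t) * z) * z ^ t"
        using 1 2 v0 z0 by (intro add_mono mult_right_mono mult_left_mono) auto
      also have "\<dots> = real t * w (t - 1) + (real n - real t) * w (t + 1)"
        by (simp add: w v_def)
      finally show ?thesis .
    next
      case False
      have "(2 - 2 / real m) * G \<le> 0" using False m by (intro mult_nonneg_nonpos) (auto simp: divide_simps)
      then have "lam \<le> 0" using lam by (simp add: G_def g_def)
      then have "lam * w t \<le> 0" using z0 by (intro mult_nonpos_nonneg) (auto simp: w)
      also have "0 \<le> real t * w (t - 1) + (real n - real t) * w (t + 1)"
        using z0 t by (simp add: w)
      finally show ?thesis .
    qed
  qed
qed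

text \<open>At \<open>\<tau>\<close> one has
  \<open>2 * sqrt (\<tau> * (1 - \<tau>)) = 1 - 2 * \<delta>\<close>, the normalised eigenvalue
  belonging to the cut-off distance delta n. The slack \<open>\<kappa>\<close> admits a tent centred
  strictly below \<open>\<tau>\<close>. Its support then lies in a ball of radius
  \<open>\<tau>' * n\<close> with \<open>\<tau>' < \<tau>\<close>, so even codes exponentially
  smaller than \<open>2 powr (n * h \<tau>)\<close> are covered.\<close>

lemma many_close_pairs:
  fixes \<delta> \<kappa> :: real
  assumes d: "0 < \<delta>" "\<delta> < 1/2" and Z: "Z = \<delta> / (1 - \<delta>)" and k: "0 < \<kappa>" "\<delta> + \<kappa> < 1/2"
    and \<tau>: "\<tau> = 1/2 - sqrt (\<delta> * (1 - \<delta>))"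
  obtains \<tau>' where "0 < \<tau>'" "\<tau>' < \<tau>" and
   "\<forall>\<^sub>F n in sequentially. \<forall>(U::nat set) I (c :: 'i \<Rightarrow> nat set). finite U \<longrightarrow> card U = n \<longrightarrow> finite I \<longrightarrow>
      (\<forall>i\<in>I. c i \<subseteq> U) \<longrightarrow> 2 * real n * 2 powr (real n * h \<tau>') \<le> real (card I) \<longrightarrow>
      (real (card I))\<^sup>2 * ((1 + Z) / 2) ^ n
      \<le> 2 * real n * (real n + 1) * (1 / Z) powr (\<kappa> * real n + 1)
        * (\<Sum>i\<in>I. \<Sum>j | j \<in> I \<and> j \<noteq> i \<and> real (sdist (c i) (c j)) \<le> (\<delta> + \<kappa>) * real n. Z ^ sdist (c i) (c j))"
proof -
  have dd: "\<delta> * (1 - \<delta>) < 1/4"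
  proof -
    have "0 < (1/2 - \<delta>)\<^sup>2" using d by (intro zero_less_power) auto
    then show ?thesis by (simp add: power2_eq_square algebra_simps)
  qed
  then have "sqrt (\<delta> * (1 - \<delta>)) < sqrt (1/4)" by (intro real_sqrt_less_mono)
  then have \<tau>0: "0 < \<tau>" by (simp add: \<tau> real_sqrt_divide)
  have \<tau>1: "\<tau> < 1/2" using d by (simp add: \<tau>)
  have "\<tau> * (1 - \<tau>) = (1/2 - \<delta>)\<^sup>2"
  proof -
    have "\<tau> * (1 - \<tau>) = 1/4 - (sqrt (\<delta> * (1 - \<delta>)))\<^sup>2" by (simp add: \<tau> algebra_simps power2_eq_square)
    then show ?thesis using d by (simp add: power2_eq_square algebra_simps)
  qed
  then have s\<tau>: "sqrt (\<tau> * (1 - \<tau>)) = 1/2 - \<delta>" using d by simp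
  have "((\<lambda>x. 2 * sqrt (x * (1 - x))) \<longlongrightarrow> 2 * sqrt (\<tau> * (1 - \<tau>))) (at_left \<tau>)"
    by (intro tendsto_intros)
  moreover have "1 - 2 * (\<delta> + \<kappa>) < 2 * sqrt (\<tau> * (1 - \<tau>))" using s\<tau> k by simp
  ultimately have ev1: "\<forall>\<^sub>F x in at_left \<tau>. 1 - 2 * (\<delta> + \<kappa>) < 2 * sqrt (x * (1 - x))"
    by (rule order_tendstoD)
  have ev2: "\<forall>\<^sub>F x in at_left \<tau>. x \<in> {0<..<\<tau>}" using \<tau>0 by (rule eventually_at_left_real)
  have "\<exists>x. 1 - 2 * (\<delta> + \<kappa>) < 2 * sqrt (x * (1 - x)) \<and> x \<in> {0<..<\<tau>}"
    by (rule eventually_happens' [OF trivial_limit_at_left_real eventually_conj [OF ev1 ev2]])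
  then obtain x where x: "0 < x" "x < \<tau>" "1 - 2 * (\<delta> + \<kappa>) < 2 * sqrt (x * (1 - x))"
    by auto
  \<comment> \<open>Midway between the centre of the tent and \<open>\<tau>\<close>, which leaves
    room for the half-width \<open>m\<close> once \<open>n\<close> is large.\<close>
  define \<tau>' where "\<tau>' = (x + \<tau>) / 2"
  define g where "g = sqrt (x * (1 - x))"
  define z where "z = sqrt (x / (1 - x))"
  have z0: "z > 0" using x \<tau>1 by (simp add: z_def)
  have "((\<lambda>m. (2 - 2 / real m) * g) \<longlongrightarrow> (2 - 0) * g) sequentially"
    by (intro tendsto_intros lim_const_over_n)
  moreover have "1 - 2 * (\<delta> + \<kappa>) < (2 - 0) * g" using x by (simp add: g_def)
  ultimately have ev3: "\<forall>\<^sub>F m in sequentially. 1 - 2 * (\<delta> + \<kappa>) < (2 - 2 / real m) * g"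
    by (rule order_tendstoD)
  have ev4: "\<forall>\<^sub>F m :: nat in sequentially. m \<ge> 1" by (rule eventually_ge_at_top)
  have "\<exists>m. 1 - 2 * (\<delta> + \<kappa>) < (2 - 2 / real m) * g \<and> m \<ge> 1"
    by (rule eventually_happens' [OF sequentially_bot eventually_conj [OF ev3 ev4]])
  then obtain m :: nat where m: "m \<ge> 1" "1 - 2 * (\<delta> + \<kappa>) < (2 - 2 / real m) * g"
    by auto
  define a where "a = \<delta> + \<kappa>"
  have E: "\<forall>\<^sub>F n in sequentially. C \<le> y * real n" if "y > 0" for C y :: real
  proof -
    have "filterlim (\<lambda>n. y * real n) at_top sequentially"
      using that by (intro filterlim_tendsto_pos_mult_at_top [OF tendsto_const]) (auto intro: filterlim_real_sequentially)
    then show ?thesis by (simp add: filterlim_at_top)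
  qed
  have e1: "\<forall>\<^sub>F n in sequentially. 1 + (2 - 2 / real m) * ((real m + 1) / z) \<le> ((2 - 2 / real m) * g - (1 - 2 * a)) * real n"
    using m by (intro E) (simp add: a_def)
  have e2: "\<forall>\<^sub>F n in sequentially. real m + 2 \<le> x * real n" using x by (intro E)
  have e3: "\<forall>\<^sub>F n in sequentially. real m \<le> (\<tau>' - x) * real n" using x by (intro E) (simp add: \<tau>'_def)
  have e4: "\<forall>\<^sub>F n in sequentially. n > 0" by (rule eventually_gt_at_top)
  show ?thesis
  proof (rule that)
    show "0 < \<tau>'" "\<tau>' < \<tau>" using x \<tau>0 by (auto simp: \<tau>'_def)
    show "\<forall>\<^sub>F n in sequentially. \<forall>(U::nat set) I (c :: 'i \<Rightarrow> nat set). finite U \<longrightarrow> card U = n \<longrightarrow> finite I \<longrightarrow>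
      (\<forall>i\<in>I. c i \<subseteq> U) \<longrightarrow> 2 * real n * 2 powr (real n * h \<tau>') \<le> real (card I) \<longrightarrow>
      (real (card I))\<^sup>2 * ((1 + Z) / 2) ^ n
      \<le> 2 * real n * (real n + 1) * (1 / Z) powr (\<kappa> * real n + 1)
        * (\<Sum>i\<in>I. \<Sum>j | j \<in> I \<and> j \<noteq> i \<and> real (sdist (c i) (c j)) \<le> (\<delta> + \<kappa>) * real n. Z ^ sdist (c i) (c j))"
      using e1 e2 e3 e4
    proof eventually_elim
      case (elim n)
      show ?case
      proof (intro allI impI)
        fix U :: "nat set" and I :: "'i set" and c :: "'i \<Rightarrow> nat set"
        assume U: "finite U" "card U = n" and I: "finite I" and c: "\<forall>i\<in>I. c i \<subseteq> U"
          and big: "2 * real n * 2 powr (real n * h \<tau>') \<le> real (card I)"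
        define t0 where "t0 = nat \<lfloor>x * real n\<rfloor>"
        define w where "w t = max 0 (real m - \<bar>real t - real t0\<bar>) * z ^ t" for t
        define T where "T = t0 + m"
        have ft0: "real t0 \<le> x * real n" "x * real n - 1 < real t0"
          using x by (auto simp: t0_def)
        have mt0: "m < t0" using ft0 elim by linarith
        have T: "real T \<le> \<tau>' * real n" using ft0 elim by (simp add: T_def algebra_simps)
        have "\<tau>' * real n \<le> \<tau> * real n" using x by (intro mult_right_mono) (auto simp: \<tau>'_def)
        then have T2: "2 * sqrt (\<delta> * (1 - \<delta>)) * real n \<le> real n - 2 * real T"
          using T by (simp add: \<tau> algebra_simps)
        have t0n: "t0 \<le> n"
        proof -
          have "x * real n \<le> 1 * real n" using x \<tau>1 by (intro mult_right_mono) auto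
          then show ?thesis using ft0 by simp
        qed
        have vol: "(\<Sum>t\<le>T. real (n choose t)) \<le> 2 powr (real n * h \<tau>')"
          using T x \<tau>1 by (intro ball_volume) (auto simp: \<tau>'_def)
        have "(real (card I))\<^sup>2 * ((1 + Z) / 2) ^ n
          \<le> 2 * real n * (real n + 1) * (1 / Z) powr (a * real n - \<delta> * real n + 1)
        * (\<Sum>i\<in>I. \<Sum>j | j \<in> I \<and> j \<noteq> i \<and> real (sdist (c i) (c j)) \<le> a * real n. Z ^ sdist (c i) (c j))"
        proof (rule close_pairs_bound [OF U \<open>n > 0\<close> I _ d Z])
          show "c i \<subseteq> U" if "i \<in> I" for i using c that by auto
          show "0 \<le> w t" for t using z0 by (simp add: w_def)
          show "t \<le> T" if "w t \<noteq> 0" for t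
          proof -
            have "max 0 (real m - \<bar>real t - real t0\<bar>) \<noteq> 0" using that unfolding w_def by auto
            then show ?thesis unfolding T_def by linarith
          qed
          show "2 * sqrt (\<delta> * (1 - \<delta>)) * real n \<le> real n - 2 * real T" by (rule T2)
          show "\<delta> * real n \<le> a * real n" using k by (intro mult_right_mono) (auto simp: a_def)
          have "a * real n \<le> (1/2) * real n" using k by (intro mult_right_mono) (auto simp: a_def)
          then show "a * real n \<le> real n / 2" by simp
          show "t0 \<le> n" by (rule t0n)
          show "w t0 \<noteq> 0" using m z0 by (simp add: w_def)
          have "2 * real n * (\<Sum>t\<le>T. real (n choose t)) \<le> 2 * real n * 2 powr (real n * h \<tau>')"
            using vol by (intro mult_left_mono) auto
          then show "2 * real n * (\<Sum>t\<le>T. real (n choose t)) \<le> real (card I)" using big by simp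
          show "(real n - 2 * (a * real n) + 1) * w t \<le> real t * w (t - 1) + (real n - real t) * w (t + 1)"
            if "t \<le> n" for t
          proof (rule tent_eigen [OF x(1) _ z_def m(1) t0_def mt0 that w_def])
            show "x < 1/2" using x \<tau>1 by simp
            show "real n - 2 * (a * real n) + 1 \<le> (2 - 2 / real m) * (real n * sqrt (x * (1 - x)) - (real m + 1) / z)"
              using elim(1) unfolding g_def [symmetric] by (simp only: algebra_simps)
          qed
        qed
        then show "(real (card I))\<^sup>2 * ((1 + Z) / 2) ^ n
      \<le> 2 * real n * (real n + 1) * (1 / Z) powr (\<kappa> * real n + 1)
        * (\<Sum>i\<in>I. \<Sum>j | j \<in> I \<and> j \<noteq> i \<and> real (sdist (c i) (c j)) \<le> (\<delta> + \<kappa>) * real n. Z ^ sdist (c i) (c j))"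
          by (simp add: a_def algebra_simps)
      qed
    qed
  qed
qed

section \<open>Error events and overlaps\<close>

definition bsc_set :: "real \<Rightarrow> 'a set \<Rightarrow> 'a set \<Rightarrow> 'a set \<Rightarrow> real" where
  "bsc_set p U x y = p ^ sdist x y * (1 - p) ^ (card U - sdist x y)"

text \<open>
  Codes are indexed families rather than sets, because the suffixes of distinct codewords may coincide.
\<close>

definition rivals :: "real \<Rightarrow> 'a set \<Rightarrow> 'i set \<Rightarrow> ('i \<Rightarrow> 'a set) \<Rightarrow> 'a set \<Rightarrow> 'i set" where
  "rivals p U I c y = {i \<in> I. \<exists>j\<in>I. j \<noteq> i \<and> bsc_set p U (c i) y \<le> bsc_set p U (c j) y}"

text \<open>All codewords that share the maximum likelihood at \<open>y\<close> count as wrong. The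
  sum is not divided by the size of the code, which makes it additive when a code is split into
  lists.\<close>

definition tie_mass :: "real \<Rightarrow> 'a set \<Rightarrow> 'i set \<Rightarrow> ('i \<Rightarrow> 'a set) \<Rightarrow> real" where
  "tie_mass p U I c = (\<Sum>y\<in>Pow U. \<Sum>i\<in>rivals p U I c y. bsc_set p U (c i) y)"

lemma sdist_le_card:
  assumes "finite U" "x \<subseteq> U" "y \<subseteq> U"
  shows "sdist x y \<le> card U"
  unfolding sdist_def using assms by (intro card_mono) auto

lemma sdist_commute: "sdist x y = sdist y x"
  by (simp add: sdist_def Un_commute)

lemma bsc_set_nonneg: "0 \<le> p \<Longrightarrow> p \<le> 1 \<Longrightarrow> 0 \<le> bsc_set p U x y"
  by (simp add: bsc_set_def)

lemma bsc_set_mono: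
  assumes p: "0 \<le> p" "p \<le> 1/2" and d: "sdist x' y \<le> sdist x y" "sdist x y \<le> card U"
  shows "bsc_set p U x y \<le> bsc_set p U x' y"
proof -
  define a b where "a = sdist x' y" and "b = sdist x y - sdist x' y"
  define m where "m = card U - sdist x y"
  have e: "sdist x y = a + b" "card U - sdist x' y = b + m" "card U - sdist x y = m"
    using d by (auto simp: a_def b_def m_def)
  have "p ^ b \<le> (1 - p) ^ b" using p by (intro power_mono) auto
  then have "p ^ a * (p ^ b * (1 - p) ^ m) \<le> p ^ a * ((1 - p) ^ b * (1 - p) ^ m)"
    using p by (intro mult_left_mono mult_right_mono) auto
  then show ?thesis unfolding bsc_set_def e(2,3) unfolding e(1) a_def [symmetric] by (simp add: power_add mult_ac)
qed

lemma tie_mass_lower: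
  assumes U: "finite U" and I: "finite I" and p: "0 \<le> p" "p \<le> 1" and H: "H \<subseteq> I"
    and E: "\<And>i. i \<in> H \<Longrightarrow> E i \<subseteq> Pow U"
    and riv: "\<And>i y. i \<in> H \<Longrightarrow> y \<in> E i \<Longrightarrow> i \<in> rivals p U I c y"
  shows "(\<Sum>i\<in>H. \<Sum>y\<in>E i. bsc_set p U (c i) y) \<le> tie_mass p U I c"
proof -
  have finH: "finite H" using H I finite_subset by auto
  have finE: "finite (E i)" if "i \<in> H" for i using E [OF that] U finite_subset by auto
  have "(\<Sum>i\<in>H. \<Sum>y\<in>E i. bsc_set p U (c i) y) = (\<Sum>(i, y)\<in>Sigma H E. bsc_set p U (c i) y)"
    using finH finE by (intro sum.Sigma) auto
  also have "\<dots> = (\<Sum>(y, i)\<in>(\<lambda>(i, y). (y, i)) ` Sigma H E. bsc_set p U (c i) y)"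
    by (subst sum.reindex) (auto simp: inj_on_def case_prod_unfold)
  also have "\<dots> \<le> (\<Sum>(y, i)\<in>Sigma (Pow U) (rivals p U I c). bsc_set p U (c i) y)"
    using U I E riv p
    by (intro sum_mono2 finite_SigmaI) (auto simp: bsc_set_nonneg rivals_def)
  also have "\<dots> = tie_mass p U I c"
    unfolding tie_mass_def using U I by (intro sum.Sigma [symmetric]) (auto simp: rivals_def)
  finally show ?thesis .
qed

section \<open>Sizes and overlaps of pairwise error events\<close>

lemma power_card_eq_prod:
  assumes "finite U" "V \<subseteq> U"
  shows "(s::real) ^ card V = (\<Prod>u\<in>U. if u \<in> V then s else 1)"
proof -
  have "U \<inter> {u. u \<in> V} = V" using assms by auto
  then show ?thesis using assms by (simp add: prod.If_cases)
qed

lemma prod_Pow_split: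
  fixes g :: "'a \<Rightarrow> bool \<Rightarrow> real"
  assumes U: "finite U"
  shows "(\<Sum>y\<in>Pow U. \<Prod>u\<in>U. g u (u \<in> y)) = (\<Prod>u\<in>U. g u True + g u False)"
proof -
  have "(\<Sum>y\<in>Pow U. \<Prod>u\<in>U. g u (u \<in> y)) = (\<Sum>y\<in>Pow U. (\<Prod>u\<in>y. g u True) * (\<Prod>u\<in>U - y. g u False))"
  proof (intro sum.cong refl)
    fix y assume y: "y \<in> Pow U"
    have "(\<Prod>u\<in>U. g u (u \<in> y)) = (\<Prod>u\<in>U - y. g u (u \<in> y)) * (\<Prod>u\<in>y. g u (u \<in> y))"
      using y U by (intro prod.subset_diff) auto
    also have "(\<Prod>u\<in>U - y. g u (u \<in> y)) = (\<Prod>u\<in>U - y. g u False)" by (intro prod.cong) auto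
    also have "(\<Prod>u\<in>y. g u (u \<in> y)) = (\<Prod>u\<in>y. g u True)" by (intro prod.cong) auto
    finally show "(\<Prod>u\<in>U. g u (u \<in> y)) = (\<Prod>u\<in>y. g u True) * (\<Prod>u\<in>U - y. g u False)" by simp
  qed
  then show ?thesis using prod_add [OF U, of "\<lambda>u. g u True" "\<lambda>u. g u False"] by simp
qed

text \<open>The sum factorises over coordinates. Where the three words agree the factor is 1 + s^3;
  elsewhere two stand against one and the factor is s + s^2, whichever is the odd one. It serves as
  an exponential moment bound for the number of words close to three given ones.\<close>

lemma sum_pow_three_dist:
  fixes s :: real
  assumes U: "finite U" and x: "x \<subseteq> U" "x' \<subseteq> U" "x'' \<subseteq> U"
    and k: "k = card (sym_diff x x' \<union> sym_diff x x'')"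
  shows "(\<Sum>y\<in>Pow U. s ^ (sdist x y + sdist x' y + sdist x'' y)) = (1 + s ^ 3) ^ (card U - k) * (s + s ^ 2) ^ k"
proof -
  define g where "g u b = (if (u \<in> x) \<noteq> b then s else 1) * (if (u \<in> x') \<noteq> b then s else 1) * (if (u \<in> x'') \<noteq> b then s else 1)" for u b
  define V where "V = sym_diff x x' \<union> sym_diff x x''"
  have V: "V \<subseteq> U" "finite V" using x U finite_subset [of V U] by (auto simp: V_def)
  have "(\<Sum>y\<in>Pow U. s ^ (sdist x y + sdist x' y + sdist x'' y)) = (\<Sum>y\<in>Pow U. \<Prod>u\<in>U. g u (u \<in> y))"
  proof (intro sum.cong refl)
    fix y assume y: "y \<in> Pow U"
    have "s ^ sdist z y = (\<Prod>u\<in>U. if (u \<in> z) \<noteq> (u \<in> y) then s else 1)" if "z \<subseteq> U" for z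
      unfolding sdist_def using that y U by (subst power_card_eq_prod [OF U]) (auto intro!: prod.cong)
    then show "s ^ (sdist x y + sdist x' y + sdist x'' y) = (\<Prod>u\<in>U. g u (u \<in> y))"
      using x by (simp add: power_add g_def prod.distrib)
  qed
  also have "\<dots> = (\<Prod>u\<in>U. g u True + g u False)" by (rule prod_Pow_split [OF U])
  also have "\<dots> = (\<Prod>u\<in>U - V. g u True + g u False) * (\<Prod>u\<in>V. g u True + g u False)"
    using V U by (intro prod.subset_diff) auto
  finally have split: "(\<Sum>y\<in>Pow U. s ^ (sdist x y + sdist x' y + sdist x'' y))
     = (\<Prod>u\<in>U - V. g u True + g u False) * (\<Prod>u\<in>V. g u True + g u False)" .
  have g1: "g u True + g u False = 1 + s ^ 3" if "u \<in> U - V" for u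
  proof -
    have "(u \<in> x') = (u \<in> x)" "(u \<in> x'') = (u \<in> x)" using that unfolding V_def by blast+
    then show ?thesis unfolding g_def by (cases "u \<in> x") (simp_all add: power3_eq_cube)
  qed
  have g2: "g u True + g u False = s + s ^ 2" if "u \<in> V" for u
  proof -
    have "(u \<in> x') \<noteq> (u \<in> x) \<or> (u \<in> x'') \<noteq> (u \<in> x)" using that unfolding V_def by blast
    then show ?thesis
      unfolding g_def by (cases "u \<in> x"; cases "u \<in> x'"; cases "u \<in> x''") (simp_all add: power2_eq_square)
  qed
  have "(\<Prod>u\<in>U - V. g u True + g u False) = (1 + s ^ 3) ^ card (U - V)"
    using prod.cong [OF refl g1, of "U - V" "\<lambda>u. u"] by simp
  moreover have "(\<Prod>u\<in>V. g u True + g u False) = (s + s ^ 2) ^ card V"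
    using prod.cong [OF refl g2, of V "\<lambda>u. u"] by simp
  moreover have "card (U - V) = card U - k" "card V = k"
    using V by (simp_all add: k V_def [symmetric] card_Diff_subset)
  ultimately show ?thesis unfolding split by simp
qed

text \<open>A coordinate on which three words do not all agree is counted by exactly two of the
  three distances.\<close>

lemma card_sym_diff_Un:
  assumes "finite x" "finite x'" "finite x''"
  shows "2 * card (sym_diff x x' \<union> sym_diff x x'') = sdist x x' + sdist x x'' + sdist x' x''"
proof -
  define A B where "A = sym_diff x x'" and "B = sym_diff x x''"
  have f: "finite A" "finite B" using assms by (auto simp: A_def B_def)
  have "sym_diff x' x'' = (A - B) \<union> (B - A)" by (auto simp: A_def B_def)
  then have "sdist x' x'' = card (A - B) + card (B - A)"
    using f by (simp add: sdist_def) (subst card_Un_disjoint, auto)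
  moreover have "card A = card (A - B) + card (A \<inter> B)"
    using f by (metis Int_Diff_disjoint Un_Diff_Int card_Un_disjoint finite_Diff finite_Int inf_commute)
  moreover have "card B = card (B - A) + card (A \<inter> B)"
    using f by (metis Int_Diff_disjoint Un_Diff_Int card_Un_disjoint finite_Diff finite_Int inf_commute)
  moreover have "card (A \<union> B) + card (A \<inter> B) = card A + card B"
    using card_Un_Int [OF f] by simp
  ultimately show ?thesis by (simp add: sdist_def A_def [symmetric] B_def [symmetric])
qed

text \<open>Second moment method: if \<open>m y\<close> is the number of sets containing
  \<open>y\<close>, then Cauchy-Schwarz bounds the square of the sum of \<open>m\<close> by the sum
  of its squares times the size of the union. The off-diagonal part of the sum of squares is what
  \<open>Bd\<close> controls.\<close>

lemma card_UN_lower: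
  fixes E :: "'i \<Rightarrow> 'b set" and N Bd :: real
  assumes J: "finite J" and E: "\<And>j. j \<in> J \<Longrightarrow> finite (E j)" "\<And>j. j \<in> J \<Longrightarrow> real (card (E j)) = N"
    and Bd: "\<And>j. j \<in> J \<Longrightarrow> (\<Sum>l\<in>J - {j}. real (card (E j \<inter> E l))) \<le> Bd * N" and Bd0: "0 \<le> Bd"
  shows "real (card J) * N \<le> (1 + Bd) * real (card (\<Union>j\<in>J. E j))"
proof -
  define X where "X = (\<Union>j\<in>J. E j)"
  have X: "finite X" using J E by (auto simp: X_def)
  define m where "m y = (\<Sum>j\<in>J. if y \<in> E j then 1 else 0 :: real)" for y
  have sumE: "(\<Sum>y\<in>X. if y \<in> E j \<and> y \<in> E l then 1 else 0 :: real) = real (card (E j \<inter> E l))" if "j \<in> J" for j l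
  proof -
    have "E j \<inter> E l = {y \<in> X. y \<in> E j \<and> y \<in> E l}" using that by (auto simp: X_def)
    then show ?thesis using X by (simp add: sum.If_cases Int_def)
  qed
  have m1: "(\<Sum>y\<in>X. m y) = real (card J) * N"
  proof -
    have "(\<Sum>y\<in>X. m y) = (\<Sum>j\<in>J. \<Sum>y\<in>X. if y \<in> E j \<and> y \<in> E j then 1 else 0)"
      unfolding m_def by (subst sum.swap) simp
    also have "\<dots> = (\<Sum>j\<in>J. N)"
    proof (rule sum.cong [OF refl])
      fix j assume "j \<in> J"
      then show "(\<Sum>y\<in>X. if y \<in> E j \<and> y \<in> E j then 1 else 0) = N"
        unfolding sumE [OF \<open>j \<in> J\<close>] using E(2) by simp
    qed
    finally show ?thesis by simp
  qed
  have "(\<Sum>y\<in>X. (m y)\<^sup>2) = (\<Sum>y\<in>X. \<Sum>j\<in>J. \<Sum>l\<in>J. if y \<in> E j \<and> y \<in> E l then 1 else 0)"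
    unfolding m_def power2_eq_square sum_product
    by (rule sum.cong [OF refl], rule sum.cong [OF refl], rule sum.cong [OF refl]) simp
  also have "\<dots> = (\<Sum>j\<in>J. \<Sum>l\<in>J. \<Sum>y\<in>X. if y \<in> E j \<and> y \<in> E l then 1 else 0)"
    by (subst sum.swap, rule sum.cong [OF refl], subst sum.swap) simp
  also have "\<dots> = (\<Sum>j\<in>J. \<Sum>l\<in>J. real (card (E j \<inter> E l)))"
    by (rule sum.cong [OF refl], rule sum.cong [OF refl], rule sumE)
  also have "\<dots> = (\<Sum>j\<in>J. N + (\<Sum>l\<in>J - {j}. real (card (E j \<inter> E l))))"
    using J E by (intro sum.cong refl) (simp add: sum.remove)
  also have "\<dots> \<le> (\<Sum>j\<in>J. N + Bd * N)"
    using Bd by (intro sum_mono add_left_mono) auto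
  finally have m2: "(\<Sum>y\<in>X. (m y)\<^sup>2) \<le> real (card J) * N * (1 + Bd)" by (simp add: algebra_simps)
  have "(\<Sum>y\<in>X. m y * 1)\<^sup>2 \<le> (\<Sum>y\<in>X. (m y)\<^sup>2) * (\<Sum>y\<in>X. 1\<^sup>2)" by (rule Cauchy_Schwarz_ineq_sum)
  also have "\<dots> \<le> real (card J) * N * (1 + Bd) * real (card X)"
    using m2 by (simp add: mult_right_mono)
  finally have main: "(real (card J) * N) * (real (card J) * N) \<le> (real (card J) * N) * ((1 + Bd) * real (card X))"
    by (simp add: m1 power2_eq_square mult_ac)
  show ?thesis
  proof (cases "real (card J) * N > 0")
    case True
    then show ?thesis using main by (simp only: mult_le_cancel_left_pos X_def)
  next
    case False
    then show ?thesis using Bd0 by (smt (verit) mult_nonneg_nonneg of_nat_0_le_iff)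
  qed
qed

text \<open>The event that \<open>x\<close> is sent, \<open>a\<close> errors fall into the positions
  where \<open>x\<close> and \<open>x'\<close> differ, and \<open>b\<close> errors fall elsewhere.
  If \<open>a\<close> is at least half of the distance, then \<open>x'\<close> is at least as likely
  as \<open>x\<close>.\<close>

definition shell :: "'a set \<Rightarrow> 'a set \<Rightarrow> 'a set \<Rightarrow> nat \<Rightarrow> nat \<Rightarrow> 'a set set" where
  "shell U x x' a b = (\<lambda>(A, B). sym_diff x (A \<union> B)) `
     ({A. A \<subseteq> sym_diff x x' \<and> card A = a} \<times> {B. B \<subseteq> U - sym_diff x x' \<and> card B = b})"

lemma card_shell:
  assumes U: "finite U" and x: "x \<subseteq> U" "x' \<subseteq> U"
  shows "card (shell U x x' a b) = (sdist x x' choose a) * ((card U - sdist x x') choose b)"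
proof -
  define V where "V = sym_diff x x'"
  have V: "V \<subseteq> U" "finite V" "finite (U - V)" using x U finite_subset [of V U] by (auto simp: V_def)
  have inj: "inj_on (\<lambda>(A, B). sym_diff x (A \<union> B)) ({A. A \<subseteq> V \<and> card A = a} \<times> {B. B \<subseteq> U - V \<and> card B = b})"
  proof (rule inj_onI, clarify)
    fix A B A' B'
    assume h: "A \<subseteq> V" "A' \<subseteq> V" "B \<subseteq> U - V" "B' \<subseteq> U - V" "sym_diff x (A \<union> B) = sym_diff x (A' \<union> B')"
    have "A \<union> B = A' \<union> B'" by (metis h(5) sym_diff_cancel)
    then show "A = A' \<and> B = B'" using h by blast
  qed
  have "card (shell U x x' a b) = card ({A. A \<subseteq> V \<and> card A = a} \<times> {B. B \<subseteq> U - V \<and> card B = b})"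
    unfolding shell_def V_def [symmetric] by (rule card_image [OF inj])
  also have "\<dots> = (card V choose a) * (card (U - V) choose b)"
    using V by (simp add: card_cartesian_product card_level)
  finally show ?thesis using V by (simp add: sdist_def V_def [symmetric] card_Diff_subset)
qed

lemma shell_dist:
  assumes U: "finite U" and x: "x \<subseteq> U" "x' \<subseteq> U" and y: "y \<in> shell U x x' a b"
  shows "y \<subseteq> U" "sdist x y = a + b" "sdist x' y = (sdist x x' - a) + b"
proof -
  define V where "V = sym_diff x x'"
  obtain A B where AB: "A \<subseteq> V" "card A = a" "B \<subseteq> U - V" "card B = b" "y = sym_diff x (A \<union> B)"
    using y unfolding shell_def V_def by auto
  have V: "V \<subseteq> U" "finite V" using x U finite_subset [of V U] by (auto simp: V_def)
  have f: "finite A" "finite B" using AB V U finite_subset [of A V] finite_subset [of B U] by auto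
  show "y \<subseteq> U" using AB x V by auto
  have "sym_diff x y = A \<union> B" unfolding AB by (rule sym_diff_cancel)
  then show "sdist x y = a + b" unfolding sdist_def using AB f by (simp) (subst card_Un_disjoint, auto)
  have "sym_diff x' y = (V - A) \<union> B" unfolding AB(5) using AB(1,3) by (auto simp: V_def)
  moreover have "card ((V - A) \<union> B) = card (V - A) + card B"
    using AB V f by (intro card_Un_disjoint) auto
  ultimately show "sdist x' y = (sdist x x' - a) + b"
    unfolding sdist_def using AB f V by (simp add: V_def [symmetric] card_Diff_subset)
qed

lemma finite_shell:
  assumes U: "finite U" and x: "x \<subseteq> U" "x' \<subseteq> U"
  shows "finite (shell U x x' a b)"
  using shell_dist(1) [OF assms] U by (meson finite_Pow_iff finite_subset PowI subsetI)

text \<open>The probability of confusing two words at distance \<open>k\<close> is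
  \<open>Z ^ k\<close> up to polynomial factors: half of the differing positions are flipped, and
  \<open>q\<close> is the most likely number of errors among the others. Rounding half of
  \<open>k\<close> upwards costs the factor \<open>s\<close>, since 2 a <= k + 1.\<close>

lemma shell_prob:
  fixes s :: real
  assumes s: "0 < s" "s < 1" and p: "p = s\<^sup>2 / (1 + s\<^sup>2)" and Z: "Z = 2 * s / (1 + s\<^sup>2)"
    and k: "k \<le> n" and q: "q = nat \<lfloor>(real (n - k) + 1) * p\<rfloor>" and a: "a = (k + 1) div 2"
  shows "s * Z ^ k \<le> (real n + 1)\<^sup>2 * (p ^ (a + q) * (1 - p) ^ (n - (a + q)) * (real (k choose a) * real ((n - k) choose q)))"
    and "q \<le> n - k"
    and "real (a + q) \<le> p * real n + real k * (1/2 - p) + 1"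
proof -
  have s2: "1 + s\<^sup>2 > 0" by (simp add: add_pos_nonneg)
  have p1: "1 - p = 1 / (1 + s\<^sup>2)" using s2 by (simp add: p field_simps)
  have p0: "0 < p" "p < 1/2"
  proof -
    show "0 < p" using s s2 by (simp add: p)
    have "s\<^sup>2 < 1" using s by (simp add: power_less_one_iff)
    then show "p < 1/2" using s2 by (simp add: p field_simps)
  qed
  have frac: "s\<^sup>2 / (1 + s\<^sup>2) = p" by (simp add: p)
  have q': "q = nat \<lfloor>(real (n - k) + 1) * (s\<^sup>2 / (1 + s\<^sup>2))\<rfloor>" by (simp add: q frac)
  have m2: "(1 + s\<^sup>2) ^ (n - k) \<le> (real (n - k) + 1) * (real (n - k choose q) * (s\<^sup>2) ^ q)" and qn: "q \<le> n - k"
    using binomial_mode [OF _ q'] s by auto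
  have a': "a = nat \<lfloor>(real k + 1) * (1 / (1 + 1))\<rfloor>"
  proof -
    have "real (k + 1) / real 2 = (real k + 1) * (1 / (1 + 1))" by simp
    then show ?thesis unfolding a by (metis floor_divide_of_nat_eq nat_int)
  qed
  have m1: "2 ^ k \<le> (real k + 1) * real (k choose a)" and ak: "a \<le> k"
    using binomial_mode [OF _ a'] by auto
  show "q \<le> n - k" by (rule qn)
  have aq: "a + q \<le> n" using qn ak k by linarith
  have W: "p ^ (a + q) * (1 - p) ^ (n - (a + q)) = s ^ (2 * (a + q)) / (1 + s\<^sup>2) ^ n"
  proof -
    have "(1 + s\<^sup>2) ^ n = (1 + s\<^sup>2) ^ (a + q) * (1 + s\<^sup>2) ^ (n - (a + q))"
      using aq by (simp flip: power_add)
    then show ?thesis unfolding p1 using s2 by (simp only: p power_divide power_mult power_one) simp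
  qed
  have nk: "(1 + s\<^sup>2) ^ n = (1 + s\<^sup>2) ^ k * (1 + s\<^sup>2) ^ (n - k)"
    unfolding power_add [symmetric] using k by simp
  have "s * Z ^ k = s ^ (k + 1) * 2 ^ k / (1 + s\<^sup>2) ^ k"
    by (simp add: Z power_divide power_mult_distrib)
  also have "\<dots> \<le> s ^ (2 * a) * 2 ^ k / (1 + s\<^sup>2) ^ k"
    using s s2 a by (intro divide_right_mono mult_right_mono power_decreasing) auto
  also have "\<dots> = s ^ (2 * a) * (2 ^ k * (1 + s\<^sup>2) ^ (n - k)) / (1 + s\<^sup>2) ^ n"
    unfolding nk using s2 by simp
  also have "\<dots> \<le> s ^ (2 * a) * (((real k + 1) * real (k choose a)) * ((real (n - k) + 1) * (real (n - k choose q) * (s\<^sup>2) ^ q))) / (1 + s\<^sup>2) ^ n"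
    using s s2 m1 m2 by (intro divide_right_mono mult_left_mono mult_mono) auto
  also have "\<dots> = ((real k + 1) * (real (n - k) + 1)) * (s ^ (2 * (a + q)) / (1 + s\<^sup>2) ^ n * (real (k choose a) * real ((n - k) choose q)))"
  proof -
    have e: "s ^ (2 * (a + q)) = s ^ (2 * a) * (s\<^sup>2) ^ q" by (simp add: distrib_left power_add power_mult)
    show ?thesis unfolding e by simp
  qed
  also have "\<dots> \<le> (real n + 1)\<^sup>2 * (s ^ (2 * (a + q)) / (1 + s\<^sup>2) ^ n * (real (k choose a) * real ((n - k) choose q)))"
    unfolding power2_eq_square using s s2 k by (intro mult_right_mono mult_mono) auto
  finally show "s * Z ^ k \<le> (real n + 1)\<^sup>2 * (p ^ (a + q) * (1 - p) ^ (n - (a + q)) * (real (k choose a) * real ((n - k) choose q)))"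
    unfolding W .
  have "real q \<le> (real (n - k) + 1) * p" using p0 by (simp add: q)
  moreover have "real a \<le> (real k + 1) / 2" unfolding a by (simp add: real_of_nat_div)
  ultimately show "real (a + q) \<le> p * real n + real k * (1/2 - p) + 1"
    using k p0 by (simp add: of_nat_diff algebra_simps)
qed

text \<open>\<open>\<nu>\<^sup>2\<close> is the ratio of the two coordinate factors in
  \<open>sum_pow_three_dist\<close>. The inequality \<open>Z \<le> \<nu>\<close> amounts to (1 -
  s)^4 >= 0; it makes the powers of \<open>\<nu> / Z\<close> increase with the exponent.\<close>

lemma overlap_ratio_props:
  fixes s :: real
  assumes s: "0 < s" "s < 1" and Z: "Z = 2 * s / (1 + s\<^sup>2)" and \<nu>: "\<nu> = sqrt (s / (1 - s + s\<^sup>2))"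
  shows "0 < \<nu>" "\<nu> \<le> 1" "Z \<le> \<nu>" "0 < Z" "Z < 1" "s + s\<^sup>2 = (1 + s ^ 3) * \<nu>\<^sup>2"
proof -
  have w: "1 - s + s\<^sup>2 > 0" using s by (simp add: add_pos_nonneg)
  have s2: "1 + s\<^sup>2 > 0" by (simp add: add_pos_nonneg)
  show "0 < \<nu>" using s w by (simp add: \<nu>)
  have sq: "0 \<le> (1 - s)\<^sup>2" by simp
  then have "s / (1 - s + s\<^sup>2) \<le> 1" using w by (simp add: field_simps power2_eq_square)
  then show "\<nu> \<le> 1" by (simp add: \<nu>)
  show Z0: "0 < Z" using s s2 by (simp add: Z)
  have "0 < (1 - s)\<^sup>2" using s by simp
  then show "Z < 1" using s2 by (simp add: Z field_simps power2_eq_square)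
  have \<nu>2: "\<nu>\<^sup>2 = s / (1 - s + s\<^sup>2)" using s w by (simp add: \<nu>)
  have "Z\<^sup>2 \<le> \<nu>\<^sup>2"
  proof -
    have "4 * s * (1 - s + s\<^sup>2) \<le> (1 + s\<^sup>2)\<^sup>2"
    proof -
      have "0 \<le> ((1 - s)\<^sup>2)\<^sup>2" by simp
      then show ?thesis by (simp add: power2_eq_square algebra_simps)
    qed
    then have "s * (4 * s * (1 - s + s\<^sup>2)) \<le> s * (1 + s\<^sup>2)\<^sup>2" using s by (intro mult_left_mono) auto
    then have "4 * s\<^sup>2 * (1 - s + s\<^sup>2) \<le> s * (1 + s\<^sup>2)\<^sup>2" by (simp add: power2_eq_square mult_ac)
    then have "4 * s\<^sup>2 / (1 + s\<^sup>2)\<^sup>2 \<le> s / (1 - s + s\<^sup>2)"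
      using w s2 by (simp add: divide_le_eq le_divide_eq pos_divide_le_eq pos_le_divide_eq)
    then show ?thesis by (simp add: \<nu>2 Z power_divide power_mult_distrib)
  qed
  then show "Z \<le> \<nu>" by (rule power2_le_imp_le) (use \<open>0 < \<nu>\<close> in simp)
  have "(1 + s ^ 3) = (1 + s) * (1 - s + s\<^sup>2)" by (simp add: power2_eq_square power3_eq_cube algebra_simps)
  then have "(1 + s ^ 3) * \<nu>\<^sup>2 = (1 + s) * s" unfolding \<nu>2 using w by simp
  then show "s + s\<^sup>2 = (1 + s ^ 3) * \<nu>\<^sup>2" by (simp add: power2_eq_square distrib_right)
qed

text \<open>The union bound for the rivals \<open>J\<close> of one codeword is tight up to the
  overlap factor. Pairs of rivals at a distance below \<open>k\<close> are few by
  \<open>deg\<close>; those at distance at least \<open>k\<close> number at most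
  \<open>\<Theta> / Z ^ k\<close> for each rival and overlap less, as \<open>\<nu> \<le> 1\<close>.
  Both cases give at most \<open>\<Theta> * (\<nu> / Z) ^ k\<close> for each distance. Up to
  polynomial factors, \<open>Q\<close> bounds the mean number of further shells that contain a word
  of a given shell.\<close>

lemma stage_bound:
  fixes s :: real and c :: "'i \<Rightarrow> 'a set"
  assumes s: "0 < s" "s < 1" and p: "p = s\<^sup>2 / (1 + s\<^sup>2)" and Z: "Z = 2 * s / (1 + s\<^sup>2)"
    and \<nu>: "\<nu> = sqrt (s / (1 - s + s\<^sup>2))"
    and U: "finite U" "card U = n" and k: "k \<le> n"
    and q: "q = nat \<lfloor>(real (n - k) + 1) * p\<rfloor>" and a: "a = (k + 1) div 2"
    and x: "x \<subseteq> U" and J: "finite J" "\<And>j. j \<in> J \<Longrightarrow> c j \<subseteq> U" "\<And>j. j \<in> J \<Longrightarrow> sdist x (c j) = k"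
    and \<Theta>: "0 < \<Theta>" "\<Theta> / Z ^ k \<le> real (card J)" "real (card J) \<le> \<Theta> / Z ^ k + 1"
    and deg: "\<And>j k'. j \<in> J \<Longrightarrow> k' < k \<Longrightarrow> real (card {l \<in> J - {j}. sdist (c j) (c l) = k'}) \<le> \<Theta> / Z ^ k'"
    and Q: "\<Theta> * ((1 + s ^ 3) / (1 + s\<^sup>2)) ^ n * s powr (- (p * real n + real k * (1/2 - p))) * \<nu> ^ (3 * k) / Z ^ (2 * k) \<le> Q"
  shows "\<Theta> * s \<le> (real n + 1)\<^sup>2 * (1 + (real n + 1) ^ 3 * Q / s\<^sup>2)
     * (p ^ (a + q) * (1 - p) ^ (n - (a + q)) * real (card (\<Union>j\<in>J. shell U x (c j) a q)))"
proof -
  note nu = overlap_ratio_props [OF s Z \<nu>]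
  note sp = shell_prob [OF s p Z k q a]
  have s2: "1 + s\<^sup>2 > 0" by (simp add: add_pos_nonneg)
  have s3: "1 + s ^ 3 > 0" using s by (simp add: add_pos_nonneg)
  define r where "r = a + q"
  define E where "E j = shell U x (c j) a q" for j
  define W where "W = p ^ r * (1 - p) ^ (n - r)"
  define N where "N = real (k choose a) * real ((n - k) choose q)"
  define Y0 where "Y0 = (1 + s ^ 3) ^ n / s ^ (3 * r)"
  define Bd where "Bd = (real n + 1) * Y0 * \<nu> ^ (3 * k) * \<Theta> / Z ^ k / N"
  have fx: "finite x" using x U finite_subset by auto
  have fc: "finite (c j)" if "j \<in> J" for j using J(2) [OF that] U finite_subset by auto
  have ak: "a \<le> k" by (simp add: a)
  have Npos: "N > 0" using ak sp(2) by (simp add: N_def)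
  have p1: "1 - p = 1 / (1 + s\<^sup>2)" using s2 by (simp add: p field_simps)
  have rn: "r \<le> n" using ak sp(2) k by (simp add: r_def)
  have W': "W = s ^ (2 * r) / (1 + s\<^sup>2) ^ n"
  proof -
    have "(1 + s\<^sup>2) ^ n = (1 + s\<^sup>2) ^ r * (1 + s\<^sup>2) ^ (n - r)" using rn by (simp flip: power_add)
    then show ?thesis unfolding p1 W_def using s2 by (simp add: p power_divide power_mult)
  qed
  have Wpos: "W > 0" using s s2 by (simp add: W')
  have \<pi>: "s * Z ^ k \<le> (real n + 1)\<^sup>2 * (W * N)" using sp(1) by (simp add: W_def N_def r_def)
  have cardE: "real (card (E j)) = N" if "j \<in> J" for j
    unfolding E_def using card_shell [OF U(1) x J(2) [OF that]] J(3) [OF that] U(2) by (simp add: N_def)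
  have finE: "finite (E j)" if "j \<in> J" for j
    unfolding E_def using finite_shell [OF U(1) x J(2) [OF that]] .
  \<comment> \<open>A common word is at distance at most \<open>r\<close> from \<open>x\<close> and
    from both rivals, because \<open>k - a \<le> a\<close>. So it contributes at least
    \<open>s ^ (3 * r)\<close> to the sum evaluated in \<open>sum_pow_three_dist\<close>.\<close>
  have overlap: "real (card (E j \<inter> E l)) \<le> Y0 * \<nu> ^ (2 * k + sdist (c j) (c l))" if jl: "j \<in> J" "l \<in> J" for j l
  proof -
    define m where "m = card (sym_diff x (c j) \<union> sym_diff x (c l))"
    have m2: "2 * m = 2 * k + sdist (c j) (c l)"
      unfolding m_def using card_sym_diff_Un [OF fx fc fc, OF jl] J(3) jl by simp
    have mn: "m \<le> n" unfolding m_def U(2) [symmetric] using x J(2) jl U by (intro card_mono) auto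
    have "real (card (E j \<inter> E l)) * s ^ (3 * r) = (\<Sum>y\<in>E j \<inter> E l. s ^ (3 * r))" by simp
    also have "\<dots> \<le> (\<Sum>y\<in>E j \<inter> E l. s ^ (sdist x y + sdist (c j) y + sdist (c l) y))"
    proof (intro sum_mono power_decreasing)
      fix y assume y: "y \<in> E j \<inter> E l"
      have "sdist x y = r" "sdist (c j) y = k - a + q" "sdist (c l) y = k - a + q"
        using shell_dist [OF U(1) x J(2) [OF jl(1)], of y a q] shell_dist [OF U(1) x J(2) [OF jl(2)], of y a q]
          y J(3) jl by (auto simp: E_def r_def)
      moreover have "k - a \<le> a" by (simp add: a)
      ultimately show "sdist x y + sdist (c j) y + sdist (c l) y \<le> 3 * r" by (simp add: r_def)
    qed (use s in auto)
    also have "\<dots> \<le> (\<Sum>y\<in>Pow U. s ^ (sdist x y + sdist (c j) y + sdist (c l) y))"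
    proof (intro sum_mono2)
      show "E j \<inter> E l \<subseteq> Pow U" using shell_dist(1) [OF U(1) x J(2) [OF jl(1)]] by (auto simp: E_def)
    qed (use U s in auto)
    also have "\<dots> = (1 + s ^ 3) ^ (n - m) * (s + s\<^sup>2) ^ m"
      using sum_pow_three_dist [OF U(1) x J(2) J(2) m_def, OF jl] U(2) by simp
    also have "\<dots> = (1 + s ^ 3) ^ n * \<nu> ^ (2 * m)"
    proof -
      have "(1 + s ^ 3) ^ n = (1 + s ^ 3) ^ (n - m) * (1 + s ^ 3) ^ m" using mn by (simp flip: power_add)
      then show ?thesis unfolding nu(6) by (simp add: power_mult_distrib power_mult)
    qed
    finally show ?thesis unfolding m2 [symmetric] using s by (simp add: Y0_def field_simps)
  qed
  have Y0pos: "Y0 > 0" using s s3 by (simp add: Y0_def)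
  have ov: "(\<Sum>l\<in>J - {j}. real (card (E j \<inter> E l))) \<le> Bd * N" if j: "j \<in> J" for j
  proof -
    define cnt where "cnt k' = real (card {l \<in> J - {j}. sdist (c j) (c l) = k'})" for k'
    have cb: "cnt k' * \<nu> ^ k' \<le> \<Theta> * (\<nu> / Z) ^ k" for k'
    proof (cases "k' < k")
      case True
      have "cnt k' * \<nu> ^ k' \<le> \<Theta> / Z ^ k' * \<nu> ^ k'"
        unfolding cnt_def using deg [OF j True] nu by (intro mult_right_mono) auto
      also have "\<dots> = \<Theta> * (\<nu> / Z) ^ k'" by (simp add: power_divide)
      also have "\<dots> \<le> \<Theta> * (\<nu> / Z) ^ k"
        using True nu \<Theta> by (intro mult_left_mono power_increasing) auto
      finally show ?thesis .
    next
      case False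
      \<comment> \<open>\<open>J\<close> may have one element more than
        \<open>\<Theta> / Z ^ k\<close>; leaving out \<open>j\<close> itself compensates for
        it.\<close>
      have "card {l \<in> J - {j}. sdist (c j) (c l) = k'} \<le> card (J - {j})"
        using J by (intro card_mono) auto
      then have "cnt k' \<le> real (card (J - {j}))" by (simp add: cnt_def)
      also have "\<dots> = real (card J) - 1"
        using J j by (metis card_gt_0_iff card_Diff_singleton empty_iff of_nat_1 of_nat_diff Suc_leI One_nat_def)
      also have "\<dots> \<le> \<Theta> / Z ^ k" using \<Theta> by simp
      finally have "cnt k' * \<nu> ^ k' \<le> \<Theta> / Z ^ k * \<nu> ^ k"
        using nu \<Theta> False by (intro mult_mono power_decreasing) auto
      then show ?thesis by (simp add: power_divide)
    qed
    have "(\<Sum>l\<in>J - {j}. real (card (E j \<inter> E l))) \<le> (\<Sum>l\<in>J - {j}. Y0 * \<nu> ^ (2 * k + sdist (c j) (c l)))"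
      using overlap j by (intro sum_mono) auto
    also have "\<dots> = (\<Sum>k'\<in>{..n}. \<Sum>l\<in>{l \<in> J - {j}. sdist (c j) (c l) = k'}. Y0 * \<nu> ^ (2 * k + sdist (c j) (c l)))"
      using J j U sdist_le_card [OF U(1)] by (intro sum.group [symmetric]) auto
    also have "\<dots> = (\<Sum>k'\<in>{..n}. Y0 * \<nu> ^ (2 * k) * (cnt k' * \<nu> ^ k'))"
      by (intro sum.cong refl) (simp add: cnt_def power_add)
    also have "\<dots> \<le> (\<Sum>k'\<in>{..n}. Y0 * \<nu> ^ (2 * k) * (\<Theta> * (\<nu> / Z) ^ k))"
      using cb nu Y0pos by (intro sum_mono mult_left_mono) auto
    also have "\<dots> = Bd * N"
    proof -
      have "\<nu> ^ (3 * k) = \<nu> ^ (2 * k) * \<nu> ^ k" by (simp flip: power_add)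
      then show ?thesis using Npos by (simp add: Bd_def power_divide mult_ac)
    qed
    finally show ?thesis .
  qed
  have Bd0: "0 \<le> Bd" using Y0pos nu Npos \<Theta> by (simp add: Bd_def)
  have main: "real (card J) * N \<le> (1 + Bd) * real (card (\<Union>j\<in>J. E j))"
    by (rule card_UN_lower [OF J(1) finE cardE ov Bd0])
  \<comment> \<open>\<open>N\<close> is eliminated by the lower bound on the shell probability,
    which produces the second factor \<open>Z ^ k\<close> in the denominator. Of the powers of
    \<open>s\<close> in \<open>Y0 * W\<close> only \<open>1 / s ^ r\<close> is left, and there
    \<open>r\<close> is replaced by its upper bound.\<close>
  have BdQ: "Bd \<le> (real n + 1) ^ 3 * Q / s\<^sup>2"
  proof -
    define G where "G = \<Theta> * ((1 + s ^ 3) / (1 + s\<^sup>2)) ^ n * s powr (- (p * real n + real k * (1/2 - p))) * \<nu> ^ (3 * k) / Z ^ (2 * k)"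
    have "s * Z ^ k / ((real n + 1)\<^sup>2 * W) \<le> N"
      using \<pi> Wpos by (simp add: divide_le_eq mult_ac)
    then have "1 / N \<le> 1 / (s * Z ^ k / ((real n + 1)\<^sup>2 * W))"
      using s nu Wpos by (intro divide_left_mono mult_pos_pos) (auto simp: Npos)
    also have "\<dots> = (real n + 1)\<^sup>2 * W / (s * Z ^ k)" by simp
    finally have "Bd \<le> (real n + 1) * Y0 * \<nu> ^ (3 * k) * \<Theta> / Z ^ k * ((real n + 1)\<^sup>2 * W / (s * Z ^ k))"
      unfolding Bd_def using Y0pos nu \<Theta>
      by (subst divide_inverse, intro mult_left_mono) (auto simp: inverse_eq_divide)
    also have "\<dots> = (real n + 1) ^ 3 * (Y0 * W) * \<nu> ^ (3 * k) * \<Theta> / (s * (Z ^ k * Z ^ k))"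
      by (simp add: power2_eq_square power3_eq_cube mult_ac)
    also have "Z ^ k * Z ^ k = Z ^ (2 * k)" by (simp flip: power_add add: mult_2)
    also have "Y0 * W = ((1 + s ^ 3) / (1 + s\<^sup>2)) ^ n * (1 / s ^ r)"
    proof -
      have "s ^ (3 * r) = s ^ (2 * r) * s ^ r" by (simp flip: power_add)
      then show ?thesis using s s2 by (simp add: Y0_def W' power_divide)
    qed
    also have "(real n + 1) ^ 3 * (((1 + s ^ 3) / (1 + s\<^sup>2)) ^ n * (1 / s ^ r)) * \<nu> ^ (3 * k) * \<Theta> / (s * Z ^ (2 * k))
       \<le> (real n + 1) ^ 3 * (((1 + s ^ 3) / (1 + s\<^sup>2)) ^ n * (s powr (- (p * real n + real k * (1/2 - p))) / s)) * \<nu> ^ (3 * k) * \<Theta> / (s * Z ^ (2 * k))"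
    proof -
      have "1 / s ^ r = s powr (- real r)" using s by (simp add: powr_minus powr_realpow divide_simps)
      also have "\<dots> \<le> s powr (- (p * real n + real k * (1/2 - p)) - 1)"
        using s sp(3) by (intro powr_mono') (auto simp: r_def)
      also have "\<dots> = s powr (- (p * real n + real k * (1/2 - p))) / s"
        using s by (simp only: powr_diff powr_one)
      finally show ?thesis
        using s s2 s3 nu \<Theta> by (intro divide_right_mono mult_right_mono mult_left_mono) auto
    qed
    also have "\<dots> = (real n + 1) ^ 3 * G / s\<^sup>2" by (simp add: G_def power2_eq_square mult_ac)
    also have "\<dots> \<le> (real n + 1) ^ 3 * Q / s\<^sup>2"
      using Q s by (intro divide_right_mono mult_left_mono) (auto simp: G_def)
    finally show ?thesis .
  qed
  have "\<Theta> * s = \<Theta> / Z ^ k * (s * Z ^ k)" using nu by simp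
  also have "\<dots> \<le> real (card J) * ((real n + 1)\<^sup>2 * (W * N))"
    by (rule mult_mono [OF \<Theta>(2) \<pi>]) (use nu s in auto)
  also have "\<dots> = (real n + 1)\<^sup>2 * W * (real (card J) * N)" by simp
  also have "\<dots> \<le> (real n + 1)\<^sup>2 * W * ((1 + Bd) * real (card (\<Union>j\<in>J. E j)))"
    using main Wpos by (intro mult_left_mono) auto
  also have "\<dots> \<le> (real n + 1)\<^sup>2 * W * ((1 + (real n + 1) ^ 3 * Q / s\<^sup>2) * real (card (\<Union>j\<in>J. E j)))"
    using BdQ Wpos by (intro mult_left_mono mult_right_mono) auto
  finally show ?thesis by (simp add: W_def r_def E_def mult_ac)
qed

section \<open>Entropy, and the exponent of the tie mass by iterative removal\<close>

lemma h_has_derivative: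
  assumes "0 < x" "x < 1"
  shows "(h has_real_derivative log 2 ((1 - x) / x)) (at x)"
proof -
  have "((\<lambda>x. - x * log 2 x - (1 - x) * log 2 (1 - x)) has_real_derivative log 2 ((1 - x) / x)) (at x)"
    using assms by (auto intro!: derivative_eq_intros simp: log_divide)
  moreover have "h = (\<lambda>x. - x * log 2 x - (1 - x) * log 2 (1 - x))" by (simp add: fun_eq_iff h_def)
  ultimately show ?thesis by simp
qed

lemma h_strict_mono:
  assumes "0 < x" "x < y" "y \<le> 1/2"
  shows "h x < h y"
proof (rule DERIV_pos_imp_increasing_open [OF assms(2)])
  show "\<exists>d. (h has_real_derivative d) (at z) \<and> 0 < d" if "x < z" "z < y" for z
    using assms that by (intro exI [of _ "log 2 ((1 - z) / z)"] conjI h_has_derivative) (auto simp: field_simps)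
  show "continuous_on {x..y} h"
    by (rule continuous_at_imp_continuous_on)
      (use assms in \<open>auto intro!: DERIV_isCont [OF h_has_derivative]\<close>)
qed

lemma powr_eq_two_powr: "0 < x \<Longrightarrow> x powr y = 2 powr (y * log 2 x)"
  by (simp add: powr_def log_def)

lemma power_eq_two_powr: "0 < x \<Longrightarrow> x ^ k = 2 powr (real k * log 2 x)"
  by (simp add: powr_eq_two_powr [symmetric] powr_realpow)

lemma tie_mass_exponent:
  fixes s \<epsilon> :: real
  assumes s: "0 < s" "s < 1" and p: "p = s\<^sup>2 / (1 + s\<^sup>2)" and Z: "Z = 2 * s / (1 + s\<^sup>2)"
    and \<nu>: "\<nu> = sqrt (s / (1 - s + s\<^sup>2))"
    and \<delta>: "\<delta> = 2 * s / (1 + s)\<^sup>2" and \<tau>: "\<tau> = 1/2 - sqrt (\<delta> * (1 - \<delta>))"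
    and Er: "Er = 1 - log 2 (1 + Z) - h \<tau>"
    and V: "V = log 2 ((1 + s ^ 3) / (1 + s\<^sup>2)) - p * log 2 s"
    and b: "b = 3 * log 2 \<nu> - (1/2 - p) * log 2 s - 2 * log 2 Z"
    and V1: "V \<le> Er" and V3: "V + \<delta> * b \<le> Er" and \<epsilon>: "\<epsilon> > 0"
  obtains \<eta> where "\<eta> > 0" "\<forall>\<^sub>F n in sequentially. \<forall>(U::nat set) I (c :: 'i \<Rightarrow> nat set). finite U \<longrightarrow> card U = n \<longrightarrow> finite I \<longrightarrow>
      (\<forall>i\<in>I. c i \<subseteq> U) \<longrightarrow> 2 powr (real n * (h \<tau> - \<eta>)) \<le> real (card I) \<longrightarrow>
      real (card I) * 2 powr (- (real n * (Er + \<epsilon>))) \<le> tie_mass p U I c"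
proof -
  note nu = overlap_ratio_props [OF s Z \<nu>]
  have s2: "1 + s\<^sup>2 > 0" by (simp add: add_pos_nonneg)
  have s3: "1 + s ^ 3 > 0" using s by (simp add: add_pos_nonneg)
  have p1: "1 - p = 1 / (1 + s\<^sup>2)" using s2 by (simp add: p field_simps)
  have p0: "0 < p" "p < 1/2"
  proof -
    show "0 < p" using s s2 by (simp add: p)
    have "s\<^sup>2 < 1" using s by (simp add: power_less_one_iff)
    then show "p < 1/2" using s2 by (simp add: p field_simps)
  qed
  have d1: "1 - \<delta> = (1 + s\<^sup>2) / (1 + s)\<^sup>2"
  proof -
    have "(1 + s)\<^sup>2 = 1 + s\<^sup>2 + 2 * s" by (simp add: power2_eq_square algebra_simps)
    moreover have "(1 + s)\<^sup>2 > 0" using s by simp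
    ultimately show ?thesis unfolding \<delta> by (simp add: field_simps)
  qed
  have d0: "0 < \<delta>" using s by (simp add: \<delta>)
  have dh: "\<delta> < 1/2"
  proof -
    have "0 < (1 - s)\<^sup>2" using s by simp
    then have "4 * s < (1 + s)\<^sup>2" by (simp add: power2_eq_square algebra_simps)
    moreover have "(1 + s)\<^sup>2 > 0" using s by simp
    ultimately show ?thesis by (simp add: \<delta> pos_divide_less_eq)
  qed
  have Zd: "Z = \<delta> / (1 - \<delta>)" unfolding d1 unfolding \<delta> Z using s by simp
  have lZ: "log 2 (1 / Z) > 0" using nu by simp
  define B where "B = max b 0"
  \<comment> \<open>The first entry keeps \<open>\<delta> + \<kappa>\<close> below 1/2. The second
    makes the passage from delta n to (delta + kappa) n cost at most eps/8, both in the overlap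
    exponent and in the factor with base \<open>1 / Z\<close> of
    \<open>many_close_pairs\<close>.\<close>
  define \<kappa> where "\<kappa> = min ((1/2 - \<delta>) / 2) (\<epsilon> / (8 * (B + log 2 (1 / Z))))"
  have BL: "0 < B + log 2 (1 / Z)" using lZ by (simp add: B_def add_nonneg_pos)
  have \<kappa>0: "0 < \<kappa>" unfolding \<kappa>_def using dh \<epsilon> BL by simp
  have \<kappa>1: "\<delta> + \<kappa> < 1/2"
  proof -
    have "\<kappa> \<le> (1/2 - \<delta>) / 2" unfolding \<kappa>_def by (rule min.cobounded1)
    then show ?thesis using dh by simp
  qed
  have "\<kappa> * (B + log 2 (1 / Z)) \<le> \<epsilon> / (8 * (B + log 2 (1 / Z))) * (B + log 2 (1 / Z))"
    unfolding \<kappa>_def using BL by (intro mult_right_mono min.cobounded2) auto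
  also have "\<dots> = \<epsilon> / 8"
  proof -
    have "\<epsilon> / (8 * L) * L = \<epsilon> / 8" if "0 < L" for L :: real using that by simp
    from this [OF BL] show ?thesis .
  qed
  finally have \<kappa>8: "\<kappa> * B + \<kappa> * log 2 (1 / Z) \<le> \<epsilon> / 8" by (simp add: algebra_simps)
  have \<kappa>B: "\<kappa> * B \<le> \<epsilon> / 8" using \<kappa>8 \<kappa>0 lZ by (smt (verit) mult_pos_pos)
  have \<kappa>Z: "\<kappa> * log 2 (1 / Z) \<le> \<epsilon> / 8"
  proof -
    have "0 \<le> \<kappa> * B" using \<kappa>0 by (simp add: B_def)
    then show ?thesis using \<kappa>8 by linarith
  qed
  obtain \<tau>' where \<tau>': "0 < \<tau>'" "\<tau>' < \<tau>" and pairs: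
   "\<forall>\<^sub>F n in sequentially. \<forall>(U::nat set) I (c :: 'i \<Rightarrow> nat set). finite U \<longrightarrow> card U = n \<longrightarrow> finite I \<longrightarrow>
      (\<forall>i\<in>I. c i \<subseteq> U) \<longrightarrow> 2 * real n * 2 powr (real n * h \<tau>') \<le> real (card I) \<longrightarrow>
      (real (card I))\<^sup>2 * ((1 + Z) / 2) ^ n
      \<le> 2 * real n * (real n + 1) * (1 / Z) powr (\<kappa> * real n + 1)
        * (\<Sum>i\<in>I. \<Sum>j | j \<in> I \<and> j \<noteq> i \<and> real (sdist (c i) (c j)) \<le> (\<delta> + \<kappa>) * real n. Z ^ sdist (c i) (c j))"
    using many_close_pairs [OF d0 dh Zd \<kappa>0 \<kappa>1 \<tau>] by blast
  have \<tau>1: "\<tau> \<le> 1/2" using d0 dh by (simp add: \<tau>)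
  have hh: "h \<tau>' < h \<tau>" by (rule h_strict_mono [OF \<tau>' \<tau>1])
  \<comment> \<open>The first entry ensures that half of the codewords still exceed the threshold of
    \<open>many_close_pairs\<close>, including its factor 2 n; the second produces the contradiction
    at the end of the removal argument.\<close>
  define \<eta> where "\<eta> = min ((h \<tau> - h \<tau>') / 2) (\<epsilon> / 8)"
  have \<eta>0: "\<eta> > 0" using hh \<epsilon> by (simp add: \<eta>_def)
  have \<eta>8: "\<eta> \<le> \<epsilon> / 8" by (simp add: \<eta>_def)
  have "\<eta> \<le> (h \<tau> - h \<tau>') / 2" unfolding \<eta>_def by (rule min.cobounded1)
  then have \<eta>h: "h \<tau>' + \<eta> \<le> h \<tau> - \<eta>" by (simp add: field_simps)
  have e1: "\<forall>\<^sub>F n in sequentially. 4 * real n \<le> 2 powr (real n * \<eta>)" using \<eta>0 by real_asymp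
  have e2: "\<forall>\<^sub>F n in sequentially. 4 * real n * (real n + 1)\<^sup>2 / Z < 2 powr (real n * (\<epsilon> / 4))" using \<epsilon> nu by real_asymp
  have e3: "\<forall>\<^sub>F n in sequentially. 2 * (real n + 1) ^ 3 * (1 + (real n + 1) ^ 3 * 2 powr (real n * (\<epsilon> / 8)) / s\<^sup>2) / s \<le> 2 powr (real n * (\<epsilon> / 2))"
    using \<epsilon> s by real_asymp
  have e4: "\<forall>\<^sub>F n :: nat in sequentially. n > 0" by (rule eventually_gt_at_top)
  show ?thesis
  proof (rule that [OF \<eta>0], use pairs e1 e2 e3 e4 in eventually_elim, intro allI impI)
    fix n :: nat and U :: "nat set" and I and c :: "'i \<Rightarrow> nat set"
    assume pairs: "\<forall>(U::nat set) I (c :: 'i \<Rightarrow> nat set). finite U \<longrightarrow> card U = n \<longrightarrow> finite I \<longrightarrow>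
      (\<forall>i\<in>I. c i \<subseteq> U) \<longrightarrow> 2 * real n * 2 powr (real n * h \<tau>') \<le> real (card I) \<longrightarrow>
      (real (card I))\<^sup>2 * ((1 + Z) / 2) ^ n
      \<le> 2 * real n * (real n + 1) * (1 / Z) powr (\<kappa> * real n + 1)
        * (\<Sum>i\<in>I. \<Sum>j | j \<in> I \<and> j \<noteq> i \<and> real (sdist (c i) (c j)) \<le> (\<delta> + \<kappa>) * real n. Z ^ sdist (c i) (c j))"
      and n1: "4 * real n \<le> 2 powr (real n * \<eta>)"
      and n2: "4 * real n * (real n + 1)\<^sup>2 / Z < 2 powr (real n * (\<epsilon> / 4))"
      and n3: "2 * (real n + 1) ^ 3 * (1 + (real n + 1) ^ 3 * 2 powr (real n * (\<epsilon> / 8)) / s\<^sup>2) / s \<le> 2 powr (real n * (\<epsilon> / 2))"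
      and n0: "0 < n"
      and U: "finite U" "card U = n" and I: "finite I" and c: "\<forall>i\<in>I. c i \<subseteq> U"
      and big: "2 powr (real n * (h \<tau> - \<eta>)) \<le> real (card I)"
    \<comment> \<open>If every word had fewer than \<open>\<Theta> / Z ^ k\<close> neighbours at
      each distance \<open>k\<close>, the total weight of the close pairs would be too small for
      \<open>many_close_pairs\<close>; the margin eps/2 in the exponent absorbs all losses.\<close>
    define \<Theta> where "\<Theta> = 2 powr (- (real n * (Er + \<epsilon> / 2)))"
    have \<Theta>0: "\<Theta> > 0" by (simp add: \<Theta>_def)
    define a where "a = nat \<lfloor>(\<delta> + \<kappa>) * real n\<rfloor>"
    have a_iff: "real k \<le> (\<delta> + \<kappa>) * real n \<longleftrightarrow> k \<le> a" for k
      using d0 \<kappa>0 by (simp add: a_def le_nat_iff le_floor_iff)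
    have an: "a \<le> n"
    proof -
      have "(\<delta> + \<kappa>) * real n \<le> 1 * real n" using \<kappa>1 by (intro mult_right_mono) auto
      then show ?thesis using a_iff [of a] by simp
    qed
    \<comment> \<open>Stage \<open>k\<close> removes the indices with at least \<open>\<Theta> / Z ^ k\<close> neighbours at distance \<open>k\<close>; if every stage
      removes few indices, the rest contradicts \<open>many_close_pairs\<close>.\<close>
    define nb where "nb C i k = {j \<in> C. j \<noteq> i \<and> sdist (c i) (c j) = k}" for C i k
    define Hd where "Hd C k = {i \<in> C. \<Theta> / Z ^ k \<le> real (card (nb C i k))}" for C k
    define Cs where "Cs = rec_nat I (\<lambda>k C. C - Hd C k)"
    have Cs0: "Cs 0 = I" and CsS: "Cs (Suc k) = Cs k - Hd (Cs k) k" for k by (simp_all add: Cs_def)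
    have Cs_anti: "Cs l \<subseteq> Cs k" if "k \<le> l" for k l
      using that by (induction rule: dec_induct) (auto simp: CsS)
    have CsI: "Cs k \<subseteq> I" for k using Cs_anti [of 0 k] Cs0 by simp
    have finCs: "finite (Cs k)" for k using CsI I finite_subset by metis
    \<comment> \<open>The sets \<open>Cs k\<close> only shrink, so a word that survives stage
      \<open>k\<close> has few neighbours at distance \<open>k\<close> in every later subset as
      well.\<close>
    have low: "real (card (nb C i k)) < \<Theta> / Z ^ k" if "i \<in> Cs (Suc k)" "C \<subseteq> Cs k" for i k C
    proof -
      have "i \<in> Cs k" "i \<notin> Hd (Cs k) k" using that by (auto simp: CsS)
      then have "real (card (nb (Cs k) i k)) < \<Theta> / Z ^ k" by (simp add: Hd_def)
      moreover have "card (nb C i k) \<le> card (nb (Cs k) i k)"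
        using that finCs by (intro card_mono) (auto simp: nb_def)
      ultimately show ?thesis by linarith
    qed
    have "\<exists>k\<le>a. real (card I) / (2 * (real a + 1)) \<le> real (card (Hd (Cs k) k))"
    proof (rule ccontr)
      assume "\<not> ?thesis"
      then have small: "real (card (Hd (Cs k) k)) < real (card I) / (2 * (real a + 1))" if "k \<le> a" for k
        using that by (meson linorder_not_le)
      have "real (card I) - real k * (real (card I) / (2 * (real a + 1))) \<le> real (card (Cs k))" if "k \<le> Suc a" for k
        using that
      proof (induction k)
        case 0
        then show ?case by (simp add: Cs0)
      next
        case (Suc k)
        have "card (Cs (Suc k)) = card (Cs k) - card (Hd (Cs k) k)"
          unfolding CsS using finCs [of k] by (intro card_Diff_subset) (auto simp: Hd_def)
        then have "real (card (Cs k)) - real (card (Hd (Cs k) k)) \<le> real (card (Cs (Suc k)))" by simp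
        then show ?case using Suc.IH small [of k] Suc.prems by (simp add: algebra_simps add_divide_distrib)
      qed
      from this [of "Suc a"] have "real (card I) - real (Suc a) * (real (card I) / (2 * (real a + 1))) \<le> real (card (Cs (Suc a)))"
        by simp
      moreover have "real (Suc a) * (real (card I) / (2 * (real a + 1))) = real (card I) / 2"
        by (simp add: field_simps)
      ultimately have half: "real (card I) / 2 \<le> real (card (Cs (Suc a)))" by linarith
      define C' where "C' = Cs (Suc a)"
      have C': "finite C'" "\<forall>i\<in>C'. c i \<subseteq> U" using finCs [of "Suc a"] CsI [of "Suc a"] c unfolding C'_def by blast+
      have big': "2 powr (real n * (h \<tau> - \<eta>)) / 2 \<le> real (card C')" using half big by (simp add: C'_def)
      have "2 * real n * 2 powr (real n * h \<tau>') \<le> 2 powr (real n * \<eta>) * 2 powr (real n * h \<tau>') / 2"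
        using n1 by (simp add: mult_right_mono)
      also have "\<dots> = 2 powr (real n * (h \<tau>' + \<eta>)) / 2" by (simp add: powr_add distrib_left mult.commute)
      also have "\<dots> \<le> 2 powr (real n * (h \<tau> - \<eta>)) / 2"
        using \<eta>h by (intro divide_right_mono powr_mono mult_left_mono) auto
      finally have big2: "2 * real n * 2 powr (real n * h \<tau>') \<le> real (card C')" using big' by linarith
      have C'0: "real (card C') > 0" using big' by (smt (verit) powr_gt_zero half_gt_zero)
      have inner: "(\<Sum>j | j \<in> C' \<and> j \<noteq> i \<and> real (sdist (c i) (c j)) \<le> (\<delta> + \<kappa>) * real n. Z ^ sdist (c i) (c j)) \<le> (real n + 1) * \<Theta>"
        if i: "i \<in> C'" for i
      proof -
        have "(\<Sum>j | j \<in> C' \<and> j \<noteq> i \<and> real (sdist (c i) (c j)) \<le> (\<delta> + \<kappa>) * real n. Z ^ sdist (c i) (c j))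
          = (\<Sum>k\<in>{..a}. \<Sum>j\<in>{j \<in> {j. j \<in> C' \<and> j \<noteq> i \<and> real (sdist (c i) (c j)) \<le> (\<delta> + \<kappa>) * real n}. sdist (c i) (c j) = k}. Z ^ sdist (c i) (c j))"
          using C' by (intro sum.group [symmetric]) (auto simp: a_iff)
        also have "\<dots> = (\<Sum>k\<in>{..a}. real (card (nb C' i k)) * Z ^ k)"
        proof (intro sum.cong refl)
          fix k assume "k \<in> {..a}"
          then have "{j \<in> {j. j \<in> C' \<and> j \<noteq> i \<and> real (sdist (c i) (c j)) \<le> (\<delta> + \<kappa>) * real n}. sdist (c i) (c j) = k} = nb C' i k"
            by (auto simp: nb_def a_iff)
          then show "(\<Sum>j\<in>{j \<in> {j. j \<in> C' \<and> j \<noteq> i \<and> real (sdist (c i) (c j)) \<le> (\<delta> + \<kappa>) * real n}. sdist (c i) (c j) = k}. Z ^ sdist (c i) (c j))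
             = real (card (nb C' i k)) * Z ^ k" by (simp add: nb_def)
        qed
        also have "\<dots> \<le> (\<Sum>k\<in>{..a}. \<Theta>)"
        proof (intro sum_mono)
          fix k assume k: "k \<in> {..a}"
          have "i \<in> Cs (Suc k)" "C' \<subseteq> Cs k" using i k Cs_anti [of "Suc k" "Suc a"] Cs_anti [of k "Suc a"] by (auto simp: C'_def)
          from low [OF this] show "real (card (nb C' i k)) * Z ^ k \<le> \<Theta>" using nu by (simp add: field_simps)
        qed
        also have "\<dots> = (real a + 1) * \<Theta>" by simp
        also have "\<dots> \<le> (real n + 1) * \<Theta>" using an \<Theta>0 by (intro mult_right_mono) auto
        finally show ?thesis .
      qed
      have "(real (card C'))\<^sup>2 * ((1 + Z) / 2) ^ n
        \<le> 2 * real n * (real n + 1) * (1 / Z) powr (\<kappa> * real n + 1)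
        * (\<Sum>i\<in>C'. \<Sum>j | j \<in> C' \<and> j \<noteq> i \<and> real (sdist (c i) (c j)) \<le> (\<delta> + \<kappa>) * real n. Z ^ sdist (c i) (c j))"
        using pairs U C' big2 by blast
      also have "\<dots> \<le> 2 * real n * (real n + 1) * (1 / Z) powr (\<kappa> * real n + 1) * (\<Sum>i\<in>C'. (real n + 1) * \<Theta>)"
        using inner by (intro mult_left_mono sum_mono) auto
      also have "\<dots> = real (card C') * (2 * real n * (real n + 1)\<^sup>2 * (1 / Z) powr (\<kappa> * real n + 1) * \<Theta>)"
        by (simp add: power2_eq_square)
      finally have "real (card C') * (real (card C') * ((1 + Z) / 2) ^ n)
        \<le> real (card C') * (2 * real n * (real n + 1)\<^sup>2 * (1 / Z) powr (\<kappa> * real n + 1) * \<Theta>)"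
        by (simp only: power2_eq_square mult.assoc)
      then have C'up: "real (card C') * ((1 + Z) / 2) ^ n \<le> 2 * real n * (real n + 1)\<^sup>2 * (1 / Z) powr (\<kappa> * real n + 1) * \<Theta>"
        using C'0 by (simp only: mult_le_cancel_left_pos)
      \<comment> \<open>\<open>Er + h \<tau>\<close> is 1 - log 2 (1 + Z). Below, \<open>Er\<close>
        and \<open>h \<tau>\<close> cancel, and eps/8 < eta is all that remains to be
        refuted.\<close>
      have R0: "((1 + Z) / 2) ^ n = 2 powr (- (real n * (Er + h \<tau>)))"
      proof -
        have "((1 + Z) / 2) ^ n = ((1 + Z) / 2) powr real n" using nu by (simp add: powr_realpow)
        also have "\<dots> = 2 powr (real n * log 2 ((1 + Z) / 2))" using nu by (intro powr_eq_two_powr) auto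
        also have "log 2 ((1 + Z) / 2) = - (Er + h \<tau>)" using nu by (simp add: Er log_divide)
        finally show ?thesis by (simp only: mult_minus_right)
      qed
      have kz: "(1 / Z) powr (\<kappa> * real n + 1) \<le> 2 powr (real n * (\<epsilon> / 8)) / Z"
      proof -
        have "(1 / Z) powr (\<kappa> * real n + 1) = (1 / Z) powr (\<kappa> * real n) * (1 / Z)"
          using nu by (simp add: powr_add)
        also have "(1 / Z) powr (\<kappa> * real n) = 2 powr (\<kappa> * real n * log 2 (1 / Z))" using nu by (intro powr_eq_two_powr) auto
        also have "\<dots> \<le> 2 powr (real n * (\<epsilon> / 8))"
          using mult_left_mono [OF \<kappa>Z, of "real n"] by (intro powr_mono) (auto simp: mult_ac)
        finally show ?thesis using nu by (simp add: divide_right_mono)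
      qed
      have "2 powr (real n * (h \<tau> - \<eta>)) / 2 * 2 powr (- (real n * (Er + h \<tau>)))
         \<le> 2 * real n * (real n + 1)\<^sup>2 * (2 powr (real n * (\<epsilon> / 8)) / Z) * \<Theta>"
      proof -
        have "2 powr (real n * (h \<tau> - \<eta>)) / 2 * 2 powr (- (real n * (Er + h \<tau>))) \<le> real (card C') * ((1 + Z) / 2) ^ n"
          unfolding R0 using big' by (intro mult_right_mono) auto
        also note C'up
        also have "2 * real n * (real n + 1)\<^sup>2 * (1 / Z) powr (\<kappa> * real n + 1) * \<Theta> \<le> 2 * real n * (real n + 1)\<^sup>2 * (2 powr (real n * (\<epsilon> / 8)) / Z) * \<Theta>"
          using kz \<Theta>0 by (intro mult_right_mono mult_left_mono) auto
        finally show ?thesis .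
      qed
      then have "2 powr (real n * (h \<tau> - \<eta>)) * 2 powr (- (real n * (Er + h \<tau>)))
         \<le> (4 * real n * (real n + 1)\<^sup>2 / Z) * (2 powr (real n * (\<epsilon> / 8)) * \<Theta>)"
        by simp
      also have "\<dots> < 2 powr (real n * (\<epsilon> / 4)) * (2 powr (real n * (\<epsilon> / 8)) * \<Theta>)"
        using n2 \<Theta>0 by (intro mult_strict_right_mono) auto
      also have "\<dots> = 2 powr (real n * (\<epsilon> / 4) + real n * (\<epsilon> / 8) - real n * (Er + \<epsilon> / 2))"
        unfolding \<Theta>_def powr_add [symmetric] by (intro arg_cong [where f = "\<lambda>x. 2 powr x"]) simp
      finally have "2 powr (real n * (h \<tau> - \<eta>) - real n * (Er + h \<tau>)) < 2 powr (real n * (\<epsilon> / 4) + real n * (\<epsilon> / 8) - real n * (Er + \<epsilon> / 2))"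
        unfolding powr_add [symmetric] by simp
      then have "real n * (h \<tau> - \<eta>) - real n * (Er + h \<tau>) < real n * (\<epsilon> / 4) + real n * (\<epsilon> / 8) - real n * (Er + \<epsilon> / 2)"
        by simp
      then have "real n * (\<epsilon> / 8) < real n * \<eta>" by (simp add: algebra_simps)
      then show False using \<eta>8 n0 by simp
    qed
    then obtain k where k: "k \<le> a" and Hbig: "real (card I) / (2 * (real a + 1)) \<le> real (card (Hd (Cs k) k))" by blast
    define H where "H = Hd (Cs k) k"
    have HC: "H \<subseteq> Cs k" "H \<subseteq> I" "finite H" using CsI [of k] finCs [of k] by (auto simp: H_def Hd_def)
    have kn: "k \<le> n" using k an by simp
    \<comment> \<open>Only as many rivals are kept as the exponent requires; more of them would
      increase the overlaps.\<close>
    define M where "M = nat \<lceil>\<Theta> / Z ^ k\<rceil>"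
    have thp: "\<Theta> / Z ^ k > 0" using \<Theta>0 nu by simp
    have M: "\<Theta> / Z ^ k \<le> real M" "real M \<le> \<Theta> / Z ^ k + 1" using thp by (auto simp: M_def)
    have "\<exists>J. J \<subseteq> nb (Cs k) i k \<and> card J = M" if "i \<in> H" for i
    proof -
      have "\<Theta> / Z ^ k \<le> real (card (nb (Cs k) i k))" using that by (auto simp: H_def Hd_def)
      then have "M \<le> card (nb (Cs k) i k)" by (simp add: M_def nat_le_iff ceiling_le_iff)
      then show ?thesis by (meson obtain_subset_with_card_n)
    qed
    then obtain Jn where Jn: "\<And>i. i \<in> H \<Longrightarrow> Jn i \<subseteq> nb (Cs k) i k" "\<And>i. i \<in> H \<Longrightarrow> card (Jn i) = M" by metis
    have JnI: "Jn i \<subseteq> Cs k" "finite (Jn i)" if "i \<in> H" for i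
      using Jn(1) [OF that] finCs [of k] finite_subset [of "Jn i" "Cs k"] by (auto simp: nb_def)
    define q where "q = nat \<lfloor>(real (n - k) + 1) * p\<rfloor>"
    define aa where "aa = (k + 1) div 2"
    define W where "W = p ^ (aa + q) * (1 - p) ^ (n - (aa + q))"
    define Y where "Y i = (\<Union>j\<in>Jn i. shell U (c i) (c j) aa q)" for i
    define Q where "Q = 2 powr (real n * (\<epsilon> / 8))"
    have Qb: "\<Theta> * ((1 + s ^ 3) / (1 + s\<^sup>2)) ^ n * s powr (- (p * real n + real k * (1/2 - p))) * \<nu> ^ (3 * k) / Z ^ (2 * k) \<le> Q"
    proof -
      have "\<Theta> * ((1 + s ^ 3) / (1 + s\<^sup>2)) ^ n * s powr (- (p * real n + real k * (1/2 - p))) * \<nu> ^ (3 * k) / Z ^ (2 * k)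
        = 2 powr (- (real n * (Er + \<epsilon> / 2))) * 2 powr (real n * log 2 ((1 + s ^ 3) / (1 + s\<^sup>2)))
          * 2 powr (- (p * real n + real k * (1/2 - p)) * log 2 s) * 2 powr (real (3 * k) * log 2 \<nu>) / 2 powr (real (2 * k) * log 2 Z)"
        using power_eq_two_powr [of "(1 + s ^ 3) / (1 + s\<^sup>2)" n] power_eq_two_powr [OF nu(1), of "3 * k"]
          power_eq_two_powr [OF nu(4), of "2 * k"] powr_eq_two_powr [OF s(1)] s2 s3
        by (simp only: \<Theta>_def divide_pos_pos)
      also have "\<dots> = 2 powr (real n * (V - Er) - real n * (\<epsilon> / 2) + real k * b)"
        unfolding powr_add [symmetric] powr_diff [symmetric]
        by (intro arg_cong [where f = "\<lambda>x. 2 powr x"]) (simp add: V b algebra_simps)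
      also have "\<dots> \<le> 2 powr (real n * (\<epsilon> / 8))"
      proof (intro powr_mono)
        show "real n * (V - Er) - real n * (\<epsilon> / 2) + real k * b \<le> real n * (\<epsilon> / 8)"
        \<comment> \<open>An affine function of \<open>k\<close>: the sign of its slope decides
          which end of the range is critical.\<close>
        proof (cases "b \<le> 0")
          case True
          have "real k * b \<le> 0" "real n * (V - Er) \<le> 0" using True V1 by (auto simp: mult_nonneg_nonpos)
          moreover have "0 \<le> real n * (\<epsilon> / 2)" "0 \<le> real n * (\<epsilon> / 8)" using \<epsilon> by auto
          ultimately show ?thesis by linarith
        next
          case False
          have "real k * b \<le> (\<delta> + \<kappa>) * real n * b" using False k a_iff by (intro mult_right_mono) auto
          also have "\<dots> = real n * (\<delta> * b) + real n * (\<kappa> * B)" using False by (simp add: B_def algebra_simps)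
          finally have "real k * b \<le> real n * (\<delta> * b) + real n * (\<kappa> * B)" .
          moreover have "real n * (V - Er + \<delta> * b) \<le> 0" using V3 by (intro mult_nonneg_nonpos) auto
          moreover have "real n * (\<kappa> * B) \<le> real n * (\<epsilon> / 8)" using \<kappa>B by (intro mult_left_mono) auto
          moreover have "0 \<le> real n * (\<epsilon> / 2)" using \<epsilon> by auto
          ultimately show ?thesis by (simp add: algebra_simps)
        qed
      qed simp
      finally show ?thesis by (simp add: Q_def)
    qed
    have cc: "c i \<subseteq> U" if "i \<in> I" for i using c that by auto
    have stage: "\<Theta> * s \<le> (real n + 1)\<^sup>2 * (1 + (real n + 1) ^ 3 * Q / s\<^sup>2) * (W * real (card (Y i)))" if i: "i \<in> H" for i
      unfolding W_def Y_def
    proof (rule stage_bound [OF s p Z \<nu> U kn q_def aa_def _ JnI(2) [OF i]])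
      show "c i \<subseteq> U" using i HC cc by auto
      show "c j \<subseteq> U" if "j \<in> Jn i" for j using that JnI [OF i] CsI cc by blast
      show "sdist (c i) (c j) = k" if "j \<in> Jn i" for j using that Jn(1) [OF i] by (auto simp: nb_def)
      show "0 < \<Theta>" by (rule \<Theta>0)
      show "\<Theta> / Z ^ k \<le> real (card (Jn i))" "real (card (Jn i)) \<le> \<Theta> / Z ^ k + 1" using M Jn(2) [OF i] by auto
      show "real (card {l \<in> Jn i - {j}. sdist (c j) (c l) = k'}) \<le> \<Theta> / Z ^ k'" if j: "j \<in> Jn i" and k': "k' < k" for j k'
      proof -
        have "{l \<in> Jn i - {j}. sdist (c j) (c l) = k'} = nb (Jn i) j k'" by (auto simp: nb_def)
        \<comment> \<open>The rivals of \<open>i\<close> lie in \<open>Cs k\<close> and hence have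
          survived every stage below \<open>k\<close>. This is the reason for treating distances in
          increasing order.\<close>
        moreover have "j \<in> Cs (Suc k')" "Jn i \<subseteq> Cs k'"
          using j JnI(1) [OF i] Cs_anti [of "Suc k'" k] Cs_anti [of k' k] k' by auto
        ultimately show ?thesis using low [of j k' "Jn i"] by simp
      qed
    qed (rule Qb)
    define G where "G = (real n + 1)\<^sup>2 * (1 + (real n + 1) ^ 3 * Q / s\<^sup>2)"
    have Gpos: "G > 0" unfolding G_def using s by (intro mult_pos_pos add_pos_nonneg) (auto simp: Q_def)
    have Ymem: "y \<subseteq> U \<and> sdist (c i) y = aa + q \<and> i \<in> rivals p U I c y" if i: "i \<in> H" and y: "y \<in> Y i" for i y
    proof -
      obtain j where j: "j \<in> Jn i" "y \<in> shell U (c i) (c j) aa q" using y by (auto simp: Y_def)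
      have jI: "j \<in> I" "j \<noteq> i" "sdist (c i) (c j) = k" using j Jn(1) [OF i] CsI by (auto simp: nb_def)
      have iI: "i \<in> I" using i HC by auto
      note sd = shell_dist [OF U(1) cc [OF iI] cc [OF jI(1)] j(2)]
      have "k - aa \<le> aa" by (simp add: aa_def)
      then have "sdist (c j) y \<le> sdist (c i) y" using sd jI by simp
      then have "bsc_set p U (c i) y \<le> bsc_set p U (c j) y"
        using p0 sdist_le_card [OF U(1) cc [OF iI] sd(1)] by (intro bsc_set_mono) auto
      then show ?thesis using sd iI jI by (auto simp: rivals_def)
    qed
    have "real (card I) * 2 powr (- (real n * (Er + \<epsilon>))) \<le> real (card H) * (\<Theta> * s / G)"
    proof -
      have t: "2 powr (- (real n * (Er + \<epsilon>))) = \<Theta> / 2 powr (real n * (\<epsilon> / 2))"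
        by (simp add: \<Theta>_def powr_diff [symmetric] algebra_simps)
      have "real (card I) * 2 powr (- (real n * (Er + \<epsilon>))) = real (card I) * \<Theta> * (1 / 2 powr (real n * (\<epsilon> / 2)))"
        by (simp add: t)
      also have "\<dots> \<le> real (card I) * \<Theta> * (s / (2 * (real n + 1) * G))"
      proof -
        have g: "2 * (real n + 1) ^ 3 * (1 + (real n + 1) ^ 3 * 2 powr (real n * (\<epsilon> / 8)) / s\<^sup>2) / s = 2 * (real n + 1) * G / s"
          by (simp only: G_def Q_def power3_eq_cube power2_eq_square mult.assoc)
        have "2 * (real n + 1) * G / s \<le> 2 powr (real n * (\<epsilon> / 2))" using n3 unfolding g .
        then have "1 / 2 powr (real n * (\<epsilon> / 2)) \<le> 1 / (2 * (real n + 1) * G / s)"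
          using Gpos s by (intro divide_left_mono) auto
        then show ?thesis using \<Theta>0 by (intro mult_left_mono) auto
      qed
      also have "\<dots> = real (card I) / (2 * (real n + 1)) * (\<Theta> * s / G)" by simp
      also have "\<dots> \<le> real (card I) / (2 * (real a + 1)) * (\<Theta> * s / G)"
        using an \<Theta>0 s Gpos by (intro mult_right_mono divide_left_mono) auto
      also have "\<dots> \<le> real (card H) * (\<Theta> * s / G)"
        using Hbig \<Theta>0 s Gpos by (intro mult_right_mono) (auto simp: H_def)
      finally show ?thesis .
    qed
    also have "\<dots> = (\<Sum>i\<in>H. \<Theta> * s / G)" by simp
    also have "\<dots> \<le> (\<Sum>i\<in>H. \<Sum>y\<in>Y i. bsc_set p U (c i) y)"
    proof (intro sum_mono)
      fix i assume i: "i \<in> H"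
      have "(\<Sum>y\<in>Y i. bsc_set p U (c i) y) = (\<Sum>y\<in>Y i. W)"
        using Ymem [OF i] U by (intro sum.cong refl) (simp add: bsc_set_def W_def)
      also have "\<dots> = W * real (card (Y i))" by simp
      finally show "\<Theta> * s / G \<le> (\<Sum>y\<in>Y i. bsc_set p U (c i) y)"
        using stage [OF i, folded G_def] Gpos by (simp add: pos_divide_le_eq mult.commute)
    qed
    also have "\<dots> \<le> tie_mass p U I c"
      using Ymem p0 HC by (intro tie_mass_lower U I) auto
    finally show "real (card I) * 2 powr (- (real n * (Er + \<epsilon>))) \<le> tie_mass p U I c" .
  qed
qed

section \<open>Straight-line argument\<close>

lemma sdist_split:
  assumes U: "finite U1" "finite U2" "U1 \<inter> U2 = {}" and x: "x \<subseteq> U1 \<union> U2" and y: "y1 \<subseteq> U1" "y2 \<subseteq> U2"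
  shows "sdist x (y1 \<union> y2) = sdist (x \<inter> U1) y1 + sdist (x \<inter> U2) y2"
proof -
  have "sym_diff x (y1 \<union> y2) = sym_diff (x \<inter> U1) y1 \<union> sym_diff (x \<inter> U2) y2" using assms by blast
  moreover have "finite (sym_diff (x \<inter> U1) y1)" "finite (sym_diff (x \<inter> U2) y2)"
    using U y finite_subset by auto
  moreover have "sym_diff (x \<inter> U1) y1 \<inter> sym_diff (x \<inter> U2) y2 = {}" using U y by auto
  ultimately show ?thesis unfolding sdist_def by (simp add: card_Un_disjoint)
qed

lemma bsc_set_split:
  assumes U: "finite U1" "finite U2" "U1 \<inter> U2 = {}" and x: "x \<subseteq> U1 \<union> U2" and y: "y1 \<subseteq> U1" "y2 \<subseteq> U2"
  shows "bsc_set p (U1 \<union> U2) x (y1 \<union> y2) = bsc_set p U1 (x \<inter> U1) y1 * bsc_set p U2 (x \<inter> U2) y2"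
proof -
  have "sdist (x \<inter> U1) y1 \<le> card U1" "sdist (x \<inter> U2) y2 \<le> card U2"
    using U y by (auto intro: sdist_le_card)
  then have "card (U1 \<union> U2) - (sdist (x \<inter> U1) y1 + sdist (x \<inter> U2) y2)
     = (card U1 - sdist (x \<inter> U1) y1) + (card U2 - sdist (x \<inter> U2) y2)"
    using U by (simp add: card_Un_disjoint)
  then show ?thesis unfolding bsc_set_def sdist_split [OF assms] by (simp add: power_add mult_ac)
qed

text \<open>Codewords whose prefixes have the same distance \<open>r\<close> from the received
  prefix share the prefix likelihood \<open>W\<close>. Comparing two of them is therefore the same
  as comparing their suffixes.\<close>

lemma tie_mass_prefix:
  assumes U: "finite U1" "finite U2" "U1 \<inter> U2 = {}" and I: "finite I" and c: "\<And>i. i \<in> I \<Longrightarrow> c i \<subseteq> U1 \<union> U2"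
    and p: "0 < p" "p < 1/2" 
  shows "(\<Sum>y\<in>Pow U1. p ^ r * (1 - p) ^ (card U1 - r) * tie_mass p U2 {i \<in> I. sdist (c i \<inter> U1) y = r} (\<lambda>i. c i \<inter> U2))
     \<le> tie_mass p (U1 \<union> U2) I c"
proof -
  define W where "W = p ^ r * (1 - p) ^ (card U1 - r)"
  define Iy where "Iy y = {i \<in> I. sdist (c i \<inter> U1) y = r}" for y
  have Wpos: "W > 0" using p by (simp add: W_def)
  have bW: "bsc_set p U1 (c i \<inter> U1) y = W" if "i \<in> Iy y" for i y using that by (simp add: bsc_set_def W_def Iy_def)
  have nn: "0 \<le> bsc_set p V x y" for V x and y :: "'a set" using p by (intro bsc_set_nonneg) auto
  have "tie_mass p (U1 \<union> U2) I c = (\<Sum>y1\<in>Pow U1. \<Sum>y2\<in>Pow U2. \<Sum>i\<in>rivals p (U1 \<union> U2) I c (y1 \<union> y2). bsc_set p (U1 \<union> U2) (c i) (y1 \<union> y2))"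
    unfolding tie_mass_def sum.cartesian_product
    by (rule sum.reindex_bij_witness [of _ "\<lambda>(y1, y2). y1 \<union> y2" "\<lambda>y. (y \<inter> U1, y \<inter> U2)"])
      (use U in \<open>auto simp: Int_Un_distrib [symmetric] Int_absorb2\<close>)
  also have "\<dots> \<ge> (\<Sum>y1\<in>Pow U1. \<Sum>y2\<in>Pow U2. \<Sum>i\<in>rivals p U2 (Iy y1) (\<lambda>i. c i \<inter> U2) y2. W * bsc_set p U2 (c i \<inter> U2) y2)"
  proof (intro sum_mono)
    fix y1 y2 assume y: "y1 \<in> Pow U1" "y2 \<in> Pow U2"
    have b: "bsc_set p (U1 \<union> U2) (c i) (y1 \<union> y2) = bsc_set p U1 (c i \<inter> U1) y1 * bsc_set p U2 (c i \<inter> U2) y2" if "i \<in> I" for i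
      using y c that by (intro bsc_set_split U) auto
    have sub: "rivals p U2 (Iy y1) (\<lambda>i. c i \<inter> U2) y2 \<subseteq> rivals p (U1 \<union> U2) I c (y1 \<union> y2)"
    proof
      fix i assume "i \<in> rivals p U2 (Iy y1) (\<lambda>i. c i \<inter> U2) y2"
      then obtain j where i: "i \<in> Iy y1" and j: "j \<in> Iy y1" "j \<noteq> i" "bsc_set p U2 (c i \<inter> U2) y2 \<le> bsc_set p U2 (c j \<inter> U2) y2"
        by (auto simp: rivals_def)
      have "i \<in> I" "j \<in> I" using i j by (auto simp: Iy_def)
      then have "bsc_set p (U1 \<union> U2) (c i) (y1 \<union> y2) \<le> bsc_set p (U1 \<union> U2) (c j) (y1 \<union> y2)"
        using j Wpos by (simp add: b bW [OF i] bW [OF j(1)])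
      then show "i \<in> rivals p (U1 \<union> U2) I c (y1 \<union> y2)"
        using \<open>i \<in> I\<close> \<open>j \<in> I\<close> j(2) by (auto simp: rivals_def)
    qed
    have "(\<Sum>i\<in>rivals p U2 (Iy y1) (\<lambda>i. c i \<inter> U2) y2. W * bsc_set p U2 (c i \<inter> U2) y2)
      = (\<Sum>i\<in>rivals p U2 (Iy y1) (\<lambda>i. c i \<inter> U2) y2. bsc_set p (U1 \<union> U2) (c i) (y1 \<union> y2))"
    proof (intro sum.cong refl)
      fix i assume "i \<in> rivals p U2 (Iy y1) (\<lambda>i. c i \<inter> U2) y2"
      then have "i \<in> Iy y1" "i \<in> I" by (auto simp: rivals_def Iy_def)
      then show "W * bsc_set p U2 (c i \<inter> U2) y2 = bsc_set p (U1 \<union> U2) (c i) (y1 \<union> y2)"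
        by (simp add: b bW)
    qed
    also have "\<dots> \<le> (\<Sum>i\<in>rivals p (U1 \<union> U2) I c (y1 \<union> y2). bsc_set p (U1 \<union> U2) (c i) (y1 \<union> y2))"
      using I sub nn by (intro sum_mono2) (auto simp: rivals_def)
    finally show "(\<Sum>i\<in>rivals p U2 (Iy y1) (\<lambda>i. c i \<inter> U2) y2. W * bsc_set p U2 (c i \<inter> U2) y2)
      \<le> (\<Sum>i\<in>rivals p (U1 \<union> U2) I c (y1 \<union> y2). bsc_set p (U1 \<union> U2) (c i) (y1 \<union> y2))" .
  qed
  finally show ?thesis by (simp add: tie_mass_def sum_distrib_left W_def Iy_def)
qed

lemma card_sphere:
  assumes U: "finite U" and x: "x \<subseteq> U"
  shows "card {y. y \<subseteq> U \<and> sdist x y = r} = card U choose r"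
proof -
  have "bij_betw (sym_diff x) {y. y \<subseteq> U \<and> sdist x y = r} {y. y \<subseteq> U \<and> card y = r}"
    by (rule bij_betw_byWitness [where f' = "sym_diff x"]) (use x in \<open>auto simp: sym_diff_cancel sdist_def\<close>)
  from bij_betw_same_card [OF this] show ?thesis using card_level [OF U, of r] by simp
qed

text \<open>Double counting; it gives the mean size of the lists below.\<close>

lemma sum_card_sphere:
  assumes U: "finite U" and I: "finite I" and c: "\<And>i. i \<in> I \<Longrightarrow> c i \<subseteq> U"
  shows "(\<Sum>y\<in>Pow U. card {i \<in> I. sdist (c i) y = r}) = card I * (card U choose r)"
proof -
  have "(\<Sum>y\<in>Pow U. card {i \<in> I. sdist (c i) y = r}) = (\<Sum>y\<in>Pow U. \<Sum>i\<in>I. if sdist (c i) y = r then 1 else 0)"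
    using I by (simp add: sum.If_cases Int_def)
  also have "\<dots> = (\<Sum>i\<in>I. card {y \<in> Pow U. sdist (c i) y = r})"
    using U by (subst sum.swap) (simp add: sum.If_cases Int_def)
  also have "\<dots> = (\<Sum>i\<in>I. card U choose r)"
    using card_sphere [OF U c] by (intro sum.cong refl) (simp add: Pow_def)
  finally show ?thesis by simp
qed

lemma tie_mass_nonneg: "0 < p \<Longrightarrow> p < 1/2 \<Longrightarrow> 0 \<le> tie_mass p U I c"
  unfolding tie_mass_def by (intro sum_nonneg bsc_set_nonneg) auto

text \<open>The prefix has length about (1 - theta) n, and the fixed distance is about rho times
  this length. Passing to the list of one received prefix costs the rate \<open>Rc\<close> per
  prefix symbol, and the prefix contributes the exponent \<open>Dd\<close> per symbol. Applying
  \<open>core\<close> to the suffixes of large lists interpolates linearly between the points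
  (\<open>Rs\<close>, \<open>Er\<close>) and (\<open>Rc\<close>, \<open>Dd\<close>).\<close>

lemma tie_mass_straight_line:
  fixes s \<epsilon> \<theta> :: real
  assumes s: "0 < s" "s < 1" and p: "p = s\<^sup>2 / (1 + s\<^sup>2)" and \<rho>: "\<rho> = s / (1 + s)"
    and Rc: "Rc = 1 - (log 2 (1 + s) - \<rho> * log 2 s)" "0 \<le> Rc"
    and Dd: "Dd = log 2 ((1 + s\<^sup>2) / (1 + s)) - \<rho> * log 2 s" "0 \<le> Dd"
    and Er: "0 \<le> Er" and Rs: "0 \<le> Rs" and \<theta>: "0 < \<theta>" "\<theta> \<le> 1" and R: "\<theta> * Rs + (1 - \<theta>) * Rc \<le> R"
    and \<epsilon>: "0 < \<epsilon>" and \<eta>: "0 < \<eta>"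
    and core: "\<forall>\<^sub>F n in sequentially. \<forall>(U::nat set) I (c :: 'i \<Rightarrow> nat set). finite U \<longrightarrow> card U = n \<longrightarrow> finite I \<longrightarrow>
      (\<forall>i\<in>I. c i \<subseteq> U) \<longrightarrow> 2 powr (real n * (Rs - \<eta>)) \<le> real (card I) \<longrightarrow>
      real (card I) * 2 powr (- (real n * (Er + \<epsilon> / 2))) \<le> tie_mass p U I c"
  shows "\<forall>\<^sub>F n in sequentially. \<forall>I (c :: 'i \<Rightarrow> nat set). finite I \<longrightarrow>
      (\<forall>i\<in>I. c i \<subseteq> {..<n}) \<longrightarrow> 2 powr (real n * R) \<le> real (card I) \<longrightarrow>
      real (card I) * 2 powr (- (real n * (\<theta> * Er + (1 - \<theta>) * Dd + \<epsilon>))) \<le> tie_mass p {..<n} I c"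
proof -
  from core [unfolded eventually_sequentially]
  obtain N0 where N0: "\<forall>n\<ge>N0. \<forall>(U::nat set) I (c :: 'i \<Rightarrow> nat set). finite U \<longrightarrow> card U = n \<longrightarrow> finite I \<longrightarrow>
      (\<forall>i\<in>I. c i \<subseteq> U) \<longrightarrow> 2 powr (real n * (Rs - \<eta>)) \<le> real (card I) \<longrightarrow>
      real (card I) * 2 powr (- (real n * (Er + \<epsilon> / 2))) \<le> tie_mass p U I c" ..
  note core' = N0 [rule_format]
  have s2: "1 + s\<^sup>2 > 0" by (simp add: add_pos_nonneg)
  have p1: "1 - p = 1 / (1 + s\<^sup>2)" using s2 by (simp add: p field_simps)
  have p0: "0 < p" "p < 1/2"
  proof -
    show "0 < p" using s s2 by (simp add: p)
    have "s\<^sup>2 < 1" using s by (simp add: power_less_one_iff)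
    then show "p < 1/2" using s2 by (simp add: p field_simps)
  qed
  have \<rho>0: "0 < \<rho>" "\<rho> < 1" using s by (auto simp: \<rho>)
  have e1: "\<forall>\<^sub>F n in sequentially. real N0 \<le> \<theta> * real n" using \<theta> by real_asymp
  have e2: "\<forall>\<^sub>F n in sequentially. 2 * (real n + 1) * 2 powr Rs / s \<le> 2 powr (\<theta> * real n * \<eta>)"
    using \<theta> \<eta> s by real_asymp
  have e3: "\<forall>\<^sub>F n in sequentially. 2 * (real n + 1) * 2 powr (Er + \<epsilon> / 2) / s \<le> 2 powr (real n * (\<epsilon> / 2))"
    using \<epsilon> s by real_asymp
  show ?thesis using e1 e2 e3
  proof (eventually_elim, intro allI impI)
    fix n :: nat and I and c :: "'i \<Rightarrow> nat set"
    assume n1: "real N0 \<le> \<theta> * real n" and n2: "2 * (real n + 1) * 2 powr Rs / s \<le> 2 powr (\<theta> * real n * \<eta>)"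
      and n3: "2 * (real n + 1) * 2 powr (Er + \<epsilon> / 2) / s \<le> 2 powr (real n * (\<epsilon> / 2))"
      and I: "finite I" and c: "\<forall>i\<in>I. c i \<subseteq> {..<n}" and big: "2 powr (real n * R) \<le> real (card I)"
    define m1 where "m1 = nat \<lfloor>(1 - \<theta>) * real n\<rfloor>"
    define m2 where "m2 = n - m1"
    have fm1: "real m1 \<le> (1 - \<theta>) * real n" "(1 - \<theta>) * real n - 1 < real m1"
      using \<theta> by (auto simp: m1_def)
    have m1n: "m1 \<le> n"
    proof -
      have "(1 - \<theta>) * real n \<le> 1 * real n" using \<theta> by (intro mult_right_mono) auto
      then show ?thesis using fm1 by simp
    qed
    have fm2: "\<theta> * real n \<le> real m2" "real m2 \<le> \<theta> * real n + 1"
      using fm1 m1n by (auto simp: m2_def of_nat_diff algebra_simps)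
    define U1 where "U1 = {..<m1}"
    define U2 where "U2 = {m1..<n}"
    have U: "finite U1" "finite U2" "U1 \<inter> U2 = {}" "U1 \<union> U2 = {..<n}" "card U1 = m1" "card U2 = m2"
      using m1n by (auto simp: U1_def U2_def m2_def)
    define r where "r = nat \<lfloor>(real m1 + 1) * (s / (1 + s))\<rfloor>"
    have mode: "(1 + s) ^ m1 \<le> (real m1 + 1) * (real (m1 choose r) * s ^ r)" and rm: "r \<le> m1"
      using binomial_mode [OF s(1) r_def] by auto
    have r1: "real r \<le> real m1 * \<rho> + 1"
    proof -
      have "real r \<le> (real m1 + 1) * \<rho>" using s by (simp add: r_def \<rho>)
      then show ?thesis using \<rho>0 by (simp add: algebra_simps)
    qed
    have r2: "real m1 * \<rho> - 1 \<le> real r"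
    proof -
      have "(real m1 + 1) * \<rho> - 1 < real_of_int \<lfloor>(real m1 + 1) * \<rho>\<rfloor>" by linarith
      also have "\<dots> = real r" using s by (simp add: r_def \<rho>)
      finally show ?thesis using \<rho>0 by (simp add: algebra_simps)
    qed
    define Cb where "Cb = real (m1 choose r)"
    define W where "W = p ^ r * (1 - p) ^ (m1 - r)"
    have W': "W = s ^ (2 * r) / (1 + s\<^sup>2) ^ m1"
    proof -
      have "(1 + s\<^sup>2) ^ m1 = (1 + s\<^sup>2) ^ r * (1 + s\<^sup>2) ^ (m1 - r)" using rm by (simp flip: power_add)
      then show ?thesis unfolding p1 W_def using s2 by (simp add: p power_divide power_mult)
    qed
    have Wpos: "W > 0" using s s2 by (simp add: W')
    have Cb_lower: "(1 + s) ^ m1 / (s ^ r * (real m1 + 1)) \<le> Cb"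
      using mode s by (simp add: Cb_def pos_divide_le_eq mult_ac)
    have ls: "log 2 s < 0" using s by simp
    \<comment> \<open>\<open>Cb / 2 ^ m1\<close> is the share of received prefixes at distance
      \<open>r\<close> from a codeword, hence the mean list size relative to the code. The exponent
      is \<open>Rc\<close> because log 2 (1 + s) - rho log 2 s is the entropy of rho.\<close>
    have C1: "2 powr (- (real m1 * Rc)) * s / (real n + 1) \<le> Cb / 2 ^ m1"
    proof -
      have "2 powr (- (real m1 * Rc)) * s = 2 powr (- (real m1 * Rc)) * 2 powr (log 2 s)" using s by simp
      also have "\<dots> = 2 powr (real m1 * log 2 (1 + s) + (real m1 * \<rho> - 1) * (- log 2 s) - real m1)"
        unfolding powr_add [symmetric] Rc by (simp add: algebra_simps)
      also have "\<dots> \<le> 2 powr (real m1 * log 2 (1 + s) + real r * (- log 2 s) - real m1)"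
        using r2 ls by (intro powr_mono diff_right_mono add_left_mono mult_right_mono) auto
      also have "\<dots> = (1 + s) ^ m1 / s ^ r / 2 ^ m1"
        using s by (simp add: powr_diff powr_add powr_minus power_eq_two_powr [of "1 + s" m1] power_eq_two_powr [of s r] power_eq_two_powr [of 2 m1] divide_simps)
      finally have "2 powr (- (real m1 * Rc)) * s / (real n + 1) \<le> (1 + s) ^ m1 / s ^ r / 2 ^ m1 / (real m1 + 1)"
        using s m1n by (intro frac_le) auto
      also have "\<dots> = (1 + s) ^ m1 / (s ^ r * (real m1 + 1)) / 2 ^ m1" by (simp add: mult_ac)
      also have "\<dots> \<le> Cb / 2 ^ m1" using Cb_lower by (intro divide_right_mono) auto
      finally show ?thesis .
    qed
    \<comment> \<open>\<open>W * Cb\<close> is the probability that the channel makes exactly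
      \<open>r\<close> errors in the prefix; its exponent is the divergence of rho from p.\<close>
    have C2: "2 powr (- (real m1 * Dd)) * s / (real n + 1) \<le> W * Cb"
    proof -
      have "2 powr (- (real m1 * Dd)) * s = 2 powr (- (real m1 * Dd)) * 2 powr (log 2 s)" using s by simp
      also have "\<dots> = 2 powr (real m1 * log 2 (1 + s) + (real m1 * \<rho> + 1) * log 2 s - real m1 * log 2 (1 + s\<^sup>2))"
        unfolding powr_add [symmetric] Dd using s s2 by (simp add: algebra_simps log_divide)
      also have "\<dots> \<le> 2 powr (real m1 * log 2 (1 + s) + real r * log 2 s - real m1 * log 2 (1 + s\<^sup>2))"
        using r1 ls by (intro powr_mono diff_right_mono add_left_mono mult_right_mono_neg) auto
      also have "\<dots> = (1 + s) ^ m1 * s ^ r / (1 + s\<^sup>2) ^ m1"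
        using s s2 by (simp add: powr_diff powr_add power_eq_two_powr [of "1 + s" m1] power_eq_two_powr [of s r] power_eq_two_powr [of "1 + s\<^sup>2" m1])
      finally have "2 powr (- (real m1 * Dd)) * s / (real n + 1) \<le> (1 + s) ^ m1 * s ^ r / (1 + s\<^sup>2) ^ m1 / (real m1 + 1)"
        using s m1n s2 by (intro frac_le) auto
      also have "\<dots> = W * ((1 + s) ^ m1 / (s ^ r * (real m1 + 1)))"
      proof -
        have "s ^ (2 * r) = s ^ r * s ^ r" by (simp add: mult_2 power_add)
        then show ?thesis unfolding W' using s by simp
      qed
      also have "\<dots> \<le> W * Cb" using Cb_lower Wpos by (intro mult_left_mono) auto
      finally show ?thesis .
    qed
    define Iy where "Iy y = {i \<in> I. sdist (c i \<inter> U1) y = r}" for y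
    \<comment> \<open>Half of the mean list size. Lists shorter than this contain at most half of
      all incidences between codewords and received prefixes.\<close>
    define L0 where "L0 = real (card I) * (Cb / 2 ^ m1) / 2"
    have L0: "2 powr (real m2 * (Rs - \<eta>)) \<le> L0"
    proof -
      have "real m2 * Rs \<le> (\<theta> * real n + 1) * Rs" using fm2 Rs by (intro mult_right_mono) auto
      also have "\<dots> = \<theta> * real n * Rs + Rs" by (simp add: algebra_simps)
      finally have a: "real m2 * Rs \<le> \<theta> * real n * Rs + Rs" .
      have b: "real n * (\<theta> * Rs + (1 - \<theta>) * Rc) \<le> real n * R" using R by (intro mult_left_mono) auto
      have cc: "real m1 * Rc \<le> (1 - \<theta>) * real n * Rc" using fm1 Rc by (intro mult_right_mono) auto
      have d: "\<theta> * real n * \<eta> \<le> real m2 * \<eta>" using fm2 \<eta> by (intro mult_right_mono) auto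
      have "2 powr (real m2 * (Rs - \<eta>)) \<le> 2 powr (real n * R - real m1 * Rc + Rs - \<theta> * real n * \<eta>)"
        using a b cc d by (intro powr_mono) (auto simp: algebra_simps)
      also have "\<dots> = 2 powr (real n * R) * 2 powr (- (real m1 * Rc)) * (2 powr Rs / 2 powr (\<theta> * real n * \<eta>))"
        by (simp add: powr_diff powr_add powr_minus divide_simps)
      also have "\<dots> \<le> 2 powr (real n * R) * 2 powr (- (real m1 * Rc)) * (s / (2 * (real n + 1)))"
      proof (intro mult_left_mono)
        show "2 powr Rs / 2 powr (\<theta> * real n * \<eta>) \<le> s / (2 * (real n + 1))"
          using n2 s by (simp add: divide_simps mult_ac)
      qed auto
      also have "\<dots> = 2 powr (real n * R) * (2 powr (- (real m1 * Rc)) * s / (real n + 1)) / 2" by (simp add: mult_ac)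
      also have "\<dots> \<le> real (card I) * (Cb / 2 ^ m1) / 2"
        using big C1 s by (intro divide_right_mono mult_mono) auto
      finally show ?thesis by (simp add: L0_def)
    qed
    have cU: "c i \<subseteq> U1 \<union> U2" if "i \<in> I" for i using c that U by auto
    define K where "K = 2 powr (- (real m2 * (Er + \<epsilon> / 2)))"
    have sumI: "(\<Sum>y\<in>Pow U1. real (card (Iy y))) = real (card I) * Cb"
    proof -
      have "(\<Sum>y\<in>Pow U1. card (Iy y)) = card I * (card U1 choose r)"
        unfolding Iy_def using sum_card_sphere [OF U(1) I, of "\<lambda>i. c i \<inter> U1" r] by auto
      then have "real (\<Sum>y\<in>Pow U1. card (Iy y)) = real (card I * (card U1 choose r))" by (rule arg_cong)
      then show ?thesis by (simp add: Cb_def U)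
    qed
    \<comment> \<open>A bound linear in the list size that is valid for every list: for short lists
      the left side is negative. After summation only the mean list size is needed.\<close>
    have tm: "W * (K * (real (card (Iy y)) - L0)) \<le> W * tie_mass p U2 (Iy y) (\<lambda>i. c i \<inter> U2)" if "y \<in> Pow U1" for y
    proof (rule mult_left_mono)
      show "K * (real (card (Iy y)) - L0) \<le> tie_mass p U2 (Iy y) (\<lambda>i. c i \<inter> U2)"
      proof (cases "L0 \<le> real (card (Iy y))")
        case True
        have "real N0 \<le> real m2" using n1 fm2 by linarith
        then have "real (card (Iy y)) * K \<le> tie_mass p U2 (Iy y) (\<lambda>i. c i \<inter> U2)"
          unfolding K_def using L0 True U I by (intro core') (auto simp: Iy_def)
        moreover have "0 \<le> K * L0" by (simp add: K_def L0_def Cb_def)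
        ultimately show ?thesis by (simp add: algebra_simps)
      next
        case False
        then have "K * (real (card (Iy y)) - L0) \<le> 0" by (intro mult_nonneg_nonpos) (auto simp: K_def)
        also have "0 \<le> tie_mass p U2 (Iy y) (\<lambda>i. c i \<inter> U2)" using p0 by (rule tie_mass_nonneg)
        finally show ?thesis .
      qed
    qed (use Wpos in simp)
    have "real (card I) * 2 powr (- (real n * (\<theta> * Er + (1 - \<theta>) * Dd + \<epsilon>))) \<le> W * (K * (real (card I) * Cb / 2))"
    proof -
      have a: "real m1 * Dd \<le> (1 - \<theta>) * real n * Dd" using fm1 Dd by (intro mult_right_mono) auto
      have b: "real m2 * (Er + \<epsilon> / 2) \<le> (\<theta> * real n + 1) * (Er + \<epsilon> / 2)"
        using fm2 Er \<epsilon> by (intro mult_right_mono) auto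
      have b2: "\<theta> * real n * (\<epsilon> / 2) \<le> 1 * real n * (\<epsilon> / 2)" using \<theta> \<epsilon> by (intro mult_right_mono) auto
      have "2 powr (- (real n * (\<theta> * Er + (1 - \<theta>) * Dd + \<epsilon>))) \<le> 2 powr (- (real m1 * Dd) - real m2 * (Er + \<epsilon> / 2) + (Er + \<epsilon> / 2) - real n * (\<epsilon> / 2))"
        using a b b2 by (intro powr_mono) (auto simp: algebra_simps)
      also have "\<dots> = 2 powr (- (real m1 * Dd)) * K * (2 powr (Er + \<epsilon> / 2) / 2 powr (real n * (\<epsilon> / 2)))"
        unfolding K_def powr_add [symmetric] powr_diff [symmetric]
        by (intro arg_cong [where f = "\<lambda>x. 2 powr x"]) simp
      also have "\<dots> \<le> 2 powr (- (real m1 * Dd)) * K * (s / (2 * (real n + 1)))"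
      proof (intro mult_left_mono)
        show "2 powr (Er + \<epsilon> / 2) / 2 powr (real n * (\<epsilon> / 2)) \<le> s / (2 * (real n + 1))"
          using n3 s by (simp add: divide_simps mult_ac)
      qed (auto simp: K_def)
      also have "\<dots> = K * (2 powr (- (real m1 * Dd)) * s / (real n + 1)) / 2" by (simp add: mult_ac)
      also have "\<dots> \<le> K * (W * Cb) / 2" using C2 by (intro divide_right_mono mult_left_mono) (auto simp: K_def)
      finally have "real (card I) * 2 powr (- (real n * (\<theta> * Er + (1 - \<theta>) * Dd + \<epsilon>))) \<le> real (card I) * (K * (W * Cb) / 2)"
        by (rule mult_left_mono) simp
      then show ?thesis by (simp add: mult_ac)
    qed
    also have "\<dots> = (\<Sum>y\<in>Pow U1. W * (K * (real (card (Iy y)) - L0)))"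
    proof -
      have "(\<Sum>y\<in>Pow U1. real (card (Iy y)) - L0) = real (card I) * Cb / 2"
        using U by (simp add: sum_subtractf sumI card_Pow L0_def)
      then show ?thesis by (simp add: sum_distrib_left [symmetric])
    qed
    also have "\<dots> \<le> (\<Sum>y\<in>Pow U1. W * tie_mass p U2 (Iy y) (\<lambda>i. c i \<inter> U2))"
      by (intro sum_mono tm)
    also have "\<dots> \<le> tie_mass p (U1 \<union> U2) I c"
      unfolding W_def Iy_def using tie_mass_prefix [OF U(1-3) I cU p0, where r = r] U(5) by simp
    finally show "real (card I) * 2 powr (- (real n * (\<theta> * Er + (1 - \<theta>) * Dd + \<epsilon>))) \<le> tie_mass p {..<n} I c"
      by (simp add: U)
  qed
qed

section \<open>Greedy codes and the union bound\<close>

lemma bsc_set_eq: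
  fixes s :: real
  assumes p: "p = s\<^sup>2 / (1 + s\<^sup>2)" and U: "finite U" and x: "x \<subseteq> U" "y \<subseteq> U"
  shows "bsc_set p U x y = s ^ (2 * sdist x y) / (1 + s\<^sup>2) ^ card U"
proof -
  have s2: "1 + s\<^sup>2 > 0" by (simp add: add_pos_nonneg)
  have p1: "1 - p = 1 / (1 + s\<^sup>2)" using s2 by (simp add: p field_simps)
  have "(1 + s\<^sup>2) ^ card U = (1 + s\<^sup>2) ^ sdist x y * (1 + s\<^sup>2) ^ (card U - sdist x y)"
    using sdist_le_card [OF U x] by (simp flip: power_add)
  then show ?thesis unfolding bsc_set_def p1 using s2 by (simp add: p power_divide power_mult)
qed

lemma sum_pow_sdist:
  fixes z :: real
  assumes U: "finite U" and x: "x \<subseteq> U"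
  shows "(\<Sum>y\<in>Pow U. z ^ sdist x y) = (1 + z) ^ card U"
proof -
  have "(\<Sum>y\<in>Pow U. z ^ sdist x y) = (\<Sum>y\<in>Pow U. z ^ card y)"
    unfolding sdist_def by (rule sum_Pow_translate [OF x])
  also have "\<dots> = (\<Sum>y\<in>Pow U. \<Prod>u\<in>y. z)" by simp
  also have "\<dots> = (\<Prod>u\<in>U. 1 + z)" by (rule sum_Pow_prod [OF U])
  finally show ?thesis by simp
qed

lemma sum_bsc_set:
  assumes p: "p = s\<^sup>2 / (1 + s\<^sup>2)" and U: "finite U" and x: "x \<subseteq> U"
  shows "(\<Sum>y\<in>Pow U. bsc_set p U x y) = 1"
proof -
  have s2: "1 + s\<^sup>2 > 0" by (simp add: add_pos_nonneg)
  have "(\<Sum>y\<in>Pow U. bsc_set p U x y) = (\<Sum>y\<in>Pow U. (s\<^sup>2) ^ sdist x y / (1 + s\<^sup>2) ^ card U)"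
    using bsc_set_eq [OF p U x] by (intro sum.cong refl) (simp add: power_mult)
  also have "\<dots> = 1"
    using sum_pow_sdist [OF U x, of "s\<^sup>2"] s2 by (simp add: sum_divide_distrib [symmetric])
  finally show ?thesis .
qed

text \<open>Factorises over coordinates. Divided by (1 + s^2)^n it is the Bhattacharyya coefficient
  Z^d of two words at distance d.\<close>

lemma sum_pow_two_dist:
  fixes s :: real
  assumes U: "finite U" and x: "x \<subseteq> U" "x' \<subseteq> U"
  shows "(\<Sum>y\<in>Pow U. s ^ (sdist x y + sdist x' y)) = (1 + s\<^sup>2) ^ (card U - sdist x x') * (2 * s) ^ sdist x x'"
proof -
  define g where "g u b = (if (u \<in> x) \<noteq> b then s else 1) * (if (u \<in> x') \<noteq> b then s else 1)" for u b
  define V where "V = sym_diff x x'"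
  have V: "V \<subseteq> U" "finite V" using x U finite_subset [of V U] by (auto simp: V_def)
  have "(\<Sum>y\<in>Pow U. s ^ (sdist x y + sdist x' y)) = (\<Sum>y\<in>Pow U. \<Prod>u\<in>U. g u (u \<in> y))"
  proof (intro sum.cong refl)
    fix y assume y: "y \<in> Pow U"
    have "s ^ sdist z y = (\<Prod>u\<in>U. if (u \<in> z) \<noteq> (u \<in> y) then s else 1)" if "z \<subseteq> U" for z
      unfolding sdist_def using that y U by (subst power_card_eq_prod [OF U]) (auto intro!: prod.cong)
    then show "s ^ (sdist x y + sdist x' y) = (\<Prod>u\<in>U. g u (u \<in> y))"
      using x by (simp add: power_add g_def prod.distrib)
  qed
  also have "\<dots> = (\<Prod>u\<in>U. g u True + g u False)" by (rule prod_Pow_split [OF U])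
  also have "\<dots> = (\<Prod>u\<in>U - V. g u True + g u False) * (\<Prod>u\<in>V. g u True + g u False)"
    using V U by (intro prod.subset_diff) auto
  finally have split: "(\<Sum>y\<in>Pow U. s ^ (sdist x y + sdist x' y))
     = (\<Prod>u\<in>U - V. g u True + g u False) * (\<Prod>u\<in>V. g u True + g u False)" .
  have g1: "g u True + g u False = 1 + s\<^sup>2" if "u \<in> U - V" for u
  proof -
    have "(u \<in> x') = (u \<in> x)" using that unfolding V_def by blast
    then show ?thesis unfolding g_def by (cases "u \<in> x") (simp_all add: power2_eq_square)
  qed
  have g2: "g u True + g u False = 2 * s" if "u \<in> V" for u
  proof -
    have "(u \<in> x') \<noteq> (u \<in> x)" using that unfolding V_def by blast
    then show ?thesis unfolding g_def by (cases "u \<in> x"; cases "u \<in> x'") simp_all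
  qed
  have "(\<Prod>u\<in>U - V. g u True + g u False) = (1 + s\<^sup>2) ^ card (U - V)"
    using prod.cong [OF refl g1, of "U - V" "\<lambda>u. u"] by simp
  moreover have "(\<Prod>u\<in>V. g u True + g u False) = (2 * s) ^ card V"
    using prod.cong [OF refl g2, of V "\<lambda>u. u"] by simp
  moreover have "card (U - V) = card U - sdist x x'" "card V = sdist x x'"
    using V by (simp_all add: sdist_def V_def [symmetric] card_Diff_subset)
  ultimately show ?thesis unfolding split by simp
qed

lemma greedy_code:
  fixes Z :: real
  assumes U: "finite U" and Z: "0 \<le> Z" and M: "2 * M \<le> 2 ^ card U"
  shows "\<exists>C \<subseteq> Pow U. card C = M \<and>
    (\<Sum>x\<in>C. \<Sum>x'\<in>C - {x}. Z ^ sdist x x') \<le> 2 * ((1 + Z) / 2) ^ card U * (real M)\<^sup>2"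
  using M
proof (induction M)
  case 0
  show ?case by (intro exI [of _ "{}"]) auto
next
  case (Suc M)
  define A where "A = 2 * ((1 + Z) / 2) ^ card U"
  have A0: "A \<ge> 0" using Z by (simp add: A_def)
  obtain C where C: "C \<subseteq> Pow U" "card C = M" "(\<Sum>x\<in>C. \<Sum>x'\<in>C - {x}. Z ^ sdist x x') \<le> A * (real M)\<^sup>2"
    using Suc by (auto simp: A_def)
  have fC: "finite C" using C U finite_subset by auto
  define f where "f c = (\<Sum>x\<in>C. Z ^ sdist x c)" for c
  have f0: "0 \<le> f c" for c using Z by (simp add: f_def sum_nonneg)
  have "\<exists>c\<in>Pow U - C. f c \<le> real M * A"
  proof (rule ccontr)
    assume "\<not> ?thesis"
    then have gt: "real M * A < f c" if "c \<in> Pow U - C" for c using that by (meson linorder_not_le)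
    have cd: "card (Pow U - C) = 2 ^ card U - M" using C U fC by (simp add: card_Diff_subset card_Pow)
    have big: "2 ^ card U / 2 \<le> real (card (Pow U - C))" "card (Pow U - C) > 0"
    proof -
      have "real (2 * Suc M) \<le> real (2 ^ card U)" using Suc.prems by (simp only: of_nat_le_iff)
      then show "2 ^ card U / 2 \<le> real (card (Pow U - C))" using Suc.prems unfolding cd by (simp add: of_nat_diff)
      show "card (Pow U - C) > 0" using Suc.prems unfolding cd by simp
    qed
    have "real M * (1 + Z) ^ card U = (2 ^ card U / 2) * (real M * A)" by (simp add: A_def power_divide)
    also have "\<dots> \<le> real (card (Pow U - C)) * (real M * A)" using big A0 by (intro mult_right_mono) auto
    also have "\<dots> = (\<Sum>c\<in>Pow U - C. real M * A)" by simp
    also have "\<dots> < (\<Sum>c\<in>Pow U - C. f c)"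
      using gt big U by (intro sum_strict_mono) (auto simp: card_gt_0_iff)
    also have "\<dots> \<le> (\<Sum>c\<in>Pow U. f c)" using U f0 by (intro sum_mono2) auto
    also have "\<dots> = (\<Sum>x\<in>C. \<Sum>c\<in>Pow U. Z ^ sdist x c)" unfolding f_def by (rule sum.swap)
    also have "\<dots> = (\<Sum>x\<in>C. (1 + Z) ^ card U)" using C sum_pow_sdist [OF U] by (intro sum.cong refl) auto
    finally show False using C by simp
  qed
  then obtain c where c: "c \<in> Pow U" "c \<notin> C" "f c \<le> real M * A" by auto
  have "(\<Sum>x\<in>insert c C. \<Sum>x'\<in>insert c C - {x}. Z ^ sdist x x')
     = (\<Sum>x'\<in>C. Z ^ sdist c x') + (\<Sum>x\<in>C. Z ^ sdist x c + (\<Sum>x'\<in>C - {x}. Z ^ sdist x x'))"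
  proof -
    have 1: "insert c C - {c} = C" using c by auto
    have 2: "insert c C - {x} = insert c (C - {x})" if "x \<in> C" for x using that c by auto
    show ?thesis using fC c
      by (simp add: 1) (intro sum.cong refl, simp add: 2)
  qed
  also have "\<dots> = 2 * f c + (\<Sum>x\<in>C. \<Sum>x'\<in>C - {x}. Z ^ sdist x x')"
    by (simp add: f_def sum.distrib sdist_commute [of c])
  also have "\<dots> \<le> 2 * (real M * A) + A * (real M)\<^sup>2" using c C by simp
  also have "\<dots> \<le> A * (real (Suc M))\<^sup>2" using A0 by (simp add: power2_eq_square algebra_simps)
  finally show ?case using c C fC by (intro exI [of _ "insert c C"]) (auto simp: A_def)
qed

section \<open>Bit strings as sets of coordinates, and the decoding error\<close>

definition support :: "bool list \<Rightarrow> nat set" where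
  "support xs = {i. i < length xs \<and> xs ! i}"

lemma support_bij: "bij_betw support (words n) (Pow {..<n})"
proof (rule bij_betw_byWitness [where f' = "\<lambda>S. map (\<lambda>i. i \<in> S) [0..<n]"])
  show "\<forall>xs\<in>words n. map (\<lambda>i. i \<in> support xs) [0..<n] = xs"
    by (auto simp: words_def support_def intro!: nth_equalityI)
  show "\<forall>S\<in>Pow {..<n}. support (map (\<lambda>i. i \<in> S) [0..<n]) = S" by (auto simp: support_def)
  show "support ` words n \<subseteq> Pow {..<n}" by (auto simp: words_def support_def)
  show "(\<lambda>S. map (\<lambda>i. i \<in> S) [0..<n]) ` Pow {..<n} \<subseteq> words n" by (auto simp: words_def)
qed

lemma bsc_support:
  assumes "x \<in> words n" "y \<in> words n"
  shows "bsc p x y = bsc_set p {..<n} (support x) (support y)"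
proof -
  have l: "length x = n" "length y = n" using assms by (auto simp: words_def)
  have "{i. i < length x \<and> x ! i \<noteq> y ! i} = sym_diff (support x) (support y)" using l by (auto simp: support_def)
  then have "hdist x y = sdist (support x) (support y)" by (simp add: hdist_def sdist_def)
  then show ?thesis using l by (simp add: bsc_def bsc_set_def)
qed

lemma finite_words: "finite (words n)"
  using bij_betw_finite [OF support_bij [of n]] by simp

text \<open>The likelihoods of each codeword sum to 1 over all received words, so the error
  probability is what the maximum leaves over from the total.\<close>

lemma Pe_eq:
  assumes p: "p = s\<^sup>2 / (1 + s\<^sup>2)" and C: "C \<subseteq> words n" "C \<noteq> {}"
  shows "real (card C) * Pe C n p = (\<Sum>y\<in>Pow {..<n}. (\<Sum>x\<in>C. bsc_set p {..<n} (support x) y) - Max ((\<lambda>x. bsc_set p {..<n} (support x) y) ` C))"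
proof -
  have fC: "finite C" using C finite_words finite_subset by auto
  have cC: "real (card C) > 0" using fC C by (simp add: card_gt_0_iff)
  have sU: "support x \<subseteq> {..<n}" if "x \<in> C" for x using that C support_bij [of n] by (auto simp: bij_betw_def)
  have "(\<Sum>y\<in>words n. Max ((\<lambda>c. bsc p c y) ` C)) = (\<Sum>y\<in>words n. (\<lambda>y. Max ((\<lambda>x. bsc_set p {..<n} (support x) y) ` C)) (support y))"
  proof (intro sum.cong refl)
    fix y assume "y \<in> words n"
    then have "(\<lambda>c. bsc p c y) ` C = (\<lambda>x. bsc_set p {..<n} (support x) (support y)) ` C"
      using C by (intro image_cong refl bsc_support) auto
    then show "Max ((\<lambda>c. bsc p c y) ` C) = Max ((\<lambda>x. bsc_set p {..<n} (support x) (support y)) ` C)" by simp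
  qed
  also have "\<dots> = (\<Sum>y\<in>Pow {..<n}. Max ((\<lambda>x. bsc_set p {..<n} (support x) y) ` C))"
    by (rule sum.reindex_bij_betw [OF support_bij])
  finally have 1: "(\<Sum>y\<in>words n. Max ((\<lambda>c. bsc p c y) ` C)) = \<dots>" .
  have "(\<Sum>y\<in>Pow {..<n}. \<Sum>x\<in>C. bsc_set p {..<n} (support x) y) = (\<Sum>x\<in>C. 1)"
    by (subst sum.swap, intro sum.cong refl sum_bsc_set [OF p] sU) auto
  then have 2: "(\<Sum>y\<in>Pow {..<n}. \<Sum>x\<in>C. bsc_set p {..<n} (support x) y) = real (card C)" by simp
  show ?thesis unfolding Pe_def 1 sum_subtractf 2 using cC by (simp add: right_diff_distrib)
qed

text \<open>Let \<open>m\<close> attain the maximum. Every other tied index is counted on the right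
  already, and if \<open>m\<close> itself is tied, then its rival on the right has at least the same
  weight; hence the factor 1/2.\<close>

lemma sum_minus_Max_ge:
  fixes w :: "'i \<Rightarrow> real"
  assumes C: "finite C" "C \<noteq> {}" and w: "\<And>i. i \<in> C \<Longrightarrow> 0 \<le> w i"
  shows "(\<Sum>i | i \<in> C \<and> (\<exists>j\<in>C. j \<noteq> i \<and> w i \<le> w j). w i) / 2 \<le> sum w C - Max (w ` C)"
proof -
  have "Max (w ` C) \<in> w ` C" using C by (intro Max_in) auto
  then obtain m where m: "m \<in> C" "w m = Max (w ` C)" by (metis imageE)
  have rest: "sum w C - Max (w ` C) = sum w (C - {m})" using m(2) sum.remove [OF C(1) m(1), of w] by simp
  define S where "S = {i. i \<in> C \<and> (\<exists>j\<in>C. j \<noteq> i \<and> w i \<le> w j)}"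
  have S: "finite S" "S \<subseteq> C" using C by (auto simp: S_def)
  have r0: "0 \<le> sum w (C - {m})" using w by (intro sum_nonneg) auto
  have "sum w (S - {m}) \<le> sum w (C - {m})" using C S w by (intro sum_mono2) auto
  moreover have "w m \<le> sum w (C - {m})" if mS: "m \<in> S"
  proof -
    obtain j where j: "j \<in> C" "j \<noteq> m" "w m \<le> w j" using mS by (auto simp: S_def)
    have "w j \<le> sum w (C - {m})" using C j w by (intro member_le_sum) auto
    then show ?thesis using j by simp
  qed
  ultimately have "sum w S \<le> 2 * sum w (C - {m})"
  proof (cases "m \<in> S")
    case True
    have "sum w S = w m + sum w (S - {m})" by (rule sum.remove [OF S(1) True])
    moreover assume "sum w (S - {m}) \<le> sum w (C - {m})" "m \<in> S \<Longrightarrow> w m \<le> sum w (C - {m})"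
    ultimately show ?thesis using True by linarith
  next
    case False
    then have "S - {m} = S" by simp
    moreover assume "sum w (S - {m}) \<le> sum w (C - {m})"
    ultimately show ?thesis using r0 by simp
  qed
  then show ?thesis unfolding rest S_def by simp
qed

lemma Pe_ge_tie_mass:
  assumes p: "p = s\<^sup>2 / (1 + s\<^sup>2)" "0 < p" "p < 1/2" and C: "C \<subseteq> words n" "C \<noteq> {}"
  shows "tie_mass p {..<n} C support / 2 \<le> real (card C) * Pe C n p"
proof -
  have fC: "finite C" using C finite_words finite_subset by auto
  show ?thesis unfolding Pe_eq [OF p(1) C] tie_mass_def sum_divide_distrib rivals_def
    using p(2,3) by (intro sum_mono sum_minus_Max_ge [unfolded sum_divide_distrib] fC C bsc_set_nonneg) auto
qed

text \<open>For a fixed received word every codeword except a maximiser \<open>m\<close> contributes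
  an error. Since \<open>w x \<le> w m\<close>, the weight \<open>w x\<close> is at most the
  geometric mean of both weights, and the geometric means sum to \<open>Z\<close> to the power of
  the distance.\<close>

lemma Pe_le_union:
  fixes s :: real
  assumes s: "0 < s" "s < 1" and p: "p = s\<^sup>2 / (1 + s\<^sup>2)" and Z: "Z = 2 * s / (1 + s\<^sup>2)"
    and C: "C \<subseteq> words n" "C \<noteq> {}"
  shows "real (card C) * Pe C n p \<le> (\<Sum>x\<in>C. \<Sum>x'\<in>C - {x}. Z ^ sdist (support x) (support x'))"
proof -
  define U where "U = {..<n}"
  have U: "finite U" "card U = n" by (auto simp: U_def)
  have s2: "1 + s\<^sup>2 > 0" by (simp add: add_pos_nonneg)
  have fC: "finite C" using C finite_words finite_subset by auto
  have sU: "support x \<subseteq> U" if "x \<in> C" for x using that C support_bij [of n] by (auto simp: bij_betw_def U_def)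
  define t where "t x x' y = s ^ (sdist (support x) y + sdist (support x') y) / (1 + s\<^sup>2) ^ n" for x x' y
  have t0: "0 \<le> t x x' y" for x x' y using s s2 by (simp add: t_def)
  have y: "(\<Sum>x\<in>C. bsc_set p U (support x) y) - Max ((\<lambda>x. bsc_set p U (support x) y) ` C) \<le> (\<Sum>x\<in>C. \<Sum>x'\<in>C - {x}. t x x' y)"
    if y: "y \<in> Pow U" for y
  proof -
    define w where "w x = bsc_set p U (support x) y" for x
    have w: "w x = s ^ (2 * sdist (support x) y) / (1 + s\<^sup>2) ^ n" if "x \<in> C" for x
      unfolding w_def using bsc_set_eq [OF p U(1) sU [OF that], of y] y U(2) by simp
    have "Max (w ` C) \<in> w ` C" using C fC by (intro Max_in) auto
    then obtain m where m: "m \<in> C" "w m = Max (w ` C)" by (metis imageE)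
    have "sum w C - Max (w ` C) = sum w (C - {m})" using m(2) sum.remove [OF fC m(1), of w] by simp
    also have "\<dots> \<le> (\<Sum>x\<in>C - {m}. t x m y)"
    proof (intro sum_mono)
      fix x assume x: "x \<in> C - {m}"
      have "w x \<le> w m" using x m fC by (metis DiffD1 Max_ge finite_imageI imageI)
      then have "s ^ (2 * sdist (support x) y) \<le> s ^ (2 * sdist (support m) y)"
        using w [of x] w [of m] x m(1) s2 by (simp add: divide_le_cancel)
      then have "2 * sdist (support m) y \<le> 2 * sdist (support x) y" using s by (simp add: power_decreasing_iff)
      then have "s ^ (2 * sdist (support x) y) \<le> s ^ (sdist (support x) y + sdist (support m) y)"
        using s by (intro power_decreasing) auto
      then show "w x \<le> t x m y" unfolding t_def using w x s2 by (simp add: divide_right_mono)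
    qed
    also have "\<dots> \<le> (\<Sum>x\<in>C - {m}. \<Sum>x'\<in>C - {x}. t x x' y)"
      using m fC t0 by (intro sum_mono member_le_sum) auto
    also have "\<dots> \<le> (\<Sum>x\<in>C. \<Sum>x'\<in>C - {x}. t x x' y)"
      using fC t0 by (intro sum_mono2 sum_nonneg) auto
    finally show ?thesis by (simp add: w_def)
  qed
  have "real (card C) * Pe C n p \<le> (\<Sum>y\<in>Pow U. \<Sum>x\<in>C. \<Sum>x'\<in>C - {x}. t x x' y)"
    unfolding Pe_eq [OF p C] U_def [symmetric] by (intro sum_mono y)
  also have "\<dots> = (\<Sum>x\<in>C. \<Sum>x'\<in>C - {x}. \<Sum>y\<in>Pow U. t x x' y)"
    by (subst sum.swap, rule sum.cong [OF refl], subst sum.swap) simp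
  also have "\<dots> = (\<Sum>x\<in>C. \<Sum>x'\<in>C - {x}. Z ^ sdist (support x) (support x'))"
  proof (rule sum.cong [OF refl], rule sum.cong [OF refl])
    fix x x' assume x: "x \<in> C" "x' \<in> C - {x}"
    define k where "k = sdist (support x) (support x')"
    have kn: "k \<le> n" unfolding k_def U(2) [symmetric] using x sU by (intro sdist_le_card U) auto
    have "(\<Sum>y\<in>Pow U. t x x' y) = (1 + s\<^sup>2) ^ (n - k) * (2 * s) ^ k / (1 + s\<^sup>2) ^ n"
      unfolding t_def sum_divide_distrib [symmetric]
      using sum_pow_two_dist [OF U(1) sU sU, of x x' s] x U(2) by (simp add: k_def)
    also have "(1 + s\<^sup>2) ^ n = (1 + s\<^sup>2) ^ (n - k) * (1 + s\<^sup>2) ^ k" using kn by (simp flip: power_add)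
    finally show "(\<Sum>y\<in>Pow U. t x x' y) = Z ^ sdist (support x) (support x')"
      using s2 by (simp add: Z power_divide k_def)
  qed
  finally show ?thesis .
qed

lemma good_code:
  fixes s :: real
  assumes s: "0 < s" "s < 1" and p: "p = s\<^sup>2 / (1 + s\<^sup>2)" and Z: "Z = 2 * s / (1 + s\<^sup>2)"
    and M: "0 < M" "2 * M \<le> 2 ^ n"
  shows "\<exists>C \<subseteq> words n. card C = M \<and> Pe C n p \<le> 2 * real M * ((1 + Z) / 2) ^ n"
proof -
  have Z0: "0 \<le> Z" using s by (simp add: Z)
  obtain C' where C': "C' \<subseteq> Pow {..<n}" "card C' = M"
    "(\<Sum>x\<in>C'. \<Sum>x'\<in>C' - {x}. Z ^ sdist x x') \<le> 2 * ((1 + Z) / 2) ^ n * (real M)\<^sup>2"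
    using greedy_code [of "{..<n}" Z M] Z0 M by auto
  have inj: "inj_on support (words n)" using support_bij by (auto simp: bij_betw_def)
  define C where "C = {x \<in> words n. support x \<in> C'}"
  have "support ` words n = Pow {..<n}" using support_bij [of n] by (simp add: bij_betw_def)
  then have CC: "support ` C = C'"
  proof (intro equalityI subsetI)
    fix y assume img: "support ` words n = Pow {..<n}" and y: "y \<in> C'"
    then have "y \<in> support ` words n" using C'(1) by auto
    then obtain x where "x \<in> words n" "y = support x" by auto
    then show "y \<in> support ` C" using y by (auto simp: C_def)
  qed (auto simp: C_def)
  have injC: "inj_on support C" using inj by (rule inj_on_subset) (auto simp: C_def)
  have cC: "card C = M" using card_image [OF injC] CC C' by simp
  have ne: "C \<noteq> {}" using cC M by auto
  have "real M * Pe C n p \<le> (\<Sum>x\<in>C. \<Sum>x'\<in>C - {x}. Z ^ sdist (support x) (support x'))"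
    using Pe_le_union [OF s p Z _ ne, of n] cC by (auto simp: C_def)
  also have "\<dots> = (\<Sum>x\<in>C. (\<lambda>x. \<Sum>x'\<in>C' - {x}. Z ^ sdist x x') (support x))"
  proof (intro sum.cong refl)
    fix x assume x: "x \<in> C"
    have "bij_betw support (C - {x}) (C' - {support x})"
      using injC x CC by (auto simp: bij_betw_def inj_on_def)
    from sum.reindex_bij_betw [OF this, of "\<lambda>x'. Z ^ sdist (support x) x'"]
    show "(\<Sum>x'\<in>C - {x}. Z ^ sdist (support x) (support x')) = (\<Sum>x'\<in>C' - {support x}. Z ^ sdist (support x) x')" by simp
  qed
  also have "\<dots> = (\<Sum>x\<in>C'. \<Sum>x'\<in>C' - {x}. Z ^ sdist x x')"
    using CC injC by (intro sum.reindex_bij_betw) (auto simp: bij_betw_def)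
  also note C'(3)
  also have "2 * ((1 + Z) / 2) ^ n * (real M)\<^sup>2 = real M * (2 * real M * ((1 + Z) / 2) ^ n)"
    by (simp add: power2_eq_square)
  finally have "Pe C n p \<le> 2 * real M * ((1 + Z) / 2) ^ n" using M by simp
  then show ?thesis using cC by (intro exI [of _ C]) (auto simp: C_def)
qed

section \<open>The exponent inequalities\<close>

text \<open>Three terms of the power series of 2 artanh y.\<close>

lemma ln_ratio_ge:
  fixes y :: real
  assumes "0 < y" "y < 1"
  shows "2 * y + 2 * y ^ 3 / 3 + 2 * y ^ 5 / 5 \<le> ln ((1 + y) / (1 - y))"
proof -
  have "(1 + y) / (1 - y) > 1" using assms by (simp add: field_simps)
  moreover have "((1 + y) / (1 - y) - 1) / ((1 + y) / (1 - y) + 1) = y" using assms by (simp add: field_simps)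
  ultimately show ?thesis
    using ln_approx_bounds [of "(1 + y) / (1 - y)" 3] by (simp add: eval_nat_numeral)
qed

text \<open>For q = (1 - s^2) / (1 + s^2) the quotient (1 + q) / (1 - q) is 1 / s^2, and the first
  term of the artanh series suffices.\<close>

lemma neg_ln_ge:
  fixes s :: real
  assumes s: "0 < s" "s < 1"
  shows "(1 - s\<^sup>2) / (1 + s\<^sup>2) \<le> - ln s"
proof -
  have p: "1 + s\<^sup>2 > 0" by (simp add: add_pos_nonneg)
  define q where "q = (1 - s\<^sup>2) / (1 + s\<^sup>2)"
  have q: "0 < q" "q < 1" using s p by (auto simp: q_def power_less_one_iff)
  have "(1 + q) / (1 - q) = 1 / s\<^sup>2"
  proof -
    have ab: "1 + q = 2 / (1 + s\<^sup>2)" "1 - q = 2 * s\<^sup>2 / (1 + s\<^sup>2)" using p by (auto simp: q_def field_simps)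
    have gen: "(2 / w) / (2 * t / w) = 1 / t" if "w > 0" "t > 0" for w t :: real using that by simp
    show ?thesis unfolding ab by (rule gen) (use p s in auto)
  qed
  then have "2 * q \<le> ln (1 / s\<^sup>2)" using ln_ratio_ge [OF q] q by (smt (verit) zero_le_power divide_nonneg_nonneg)
  also have "ln (1 / s\<^sup>2) = - 2 * ln s" using s by (simp add: ln_div ln_realpow)
  finally have "q \<le> - ln s" by simp
  then show ?thesis by (simp only: q_def)
qed

text \<open>The overlap condition at distance 0. Let \<open>A\<close> be the quotient of the two
  rational arguments of \<open>ln\<close>; then A - 1 equals (rho - p) (1 - s^2) / (1 + s^2)
  exactly, so that ln A <= A - 1 and \<open>neg_ln_ge\<close> fit together without loss.\<close>

lemma exponent_zero_le:
  fixes s :: real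
  assumes s: "0 < s" "s < 1"
  shows "ln ((1 + s ^ 3) / (1 + s\<^sup>2)) - s\<^sup>2 / (1 + s\<^sup>2) * ln s \<le> ln ((1 + s\<^sup>2) / (1 + s)) - s / (1 + s) * ln s"
proof -
  have p: "1 + s\<^sup>2 > 0" "1 + s > 0" "1 + s ^ 3 > 0" using s by (auto simp: add_pos_nonneg)
  define q where "q = (1 - s\<^sup>2) / (1 + s\<^sup>2)"
  have ls: "q \<le> - ln s" unfolding q_def by (rule neg_ln_ge [OF s])
  define A where "A = (1 + s ^ 3) * (1 + s) / (1 + s\<^sup>2)\<^sup>2"
  have "A > 0" using p by (simp add: A_def)
  then have "ln A \<le> A - 1" by (rule ln_le_minus_one)
  also have "A - 1 = s * (1 - s)\<^sup>2 / (1 + s\<^sup>2)\<^sup>2"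
    using p unfolding A_def by (simp add: divide_simps) (simp add: power2_eq_square power3_eq_cube algebra_simps)
  also have "\<dots> = (s / (1 + s) - s\<^sup>2 / (1 + s\<^sup>2)) * q"
    using p unfolding q_def by (simp add: divide_simps) (simp add: power2_eq_square algebra_simps)
  also have "\<dots> \<le> (s / (1 + s) - s\<^sup>2 / (1 + s\<^sup>2)) * (- ln s)"
  proof (rule mult_left_mono [OF ls])
    have "s / (1 + s) - s\<^sup>2 / (1 + s\<^sup>2) = s * (1 - s) / ((1 + s) * (1 + s\<^sup>2))"
      using p by (simp add: divide_simps) (simp add: power2_eq_square algebra_simps)
    then show "0 \<le> s / (1 + s) - s\<^sup>2 / (1 + s\<^sup>2)" using s p by simp
  qed
  finally have "ln A \<le> (s / (1 + s) - s\<^sup>2 / (1 + s\<^sup>2)) * (- ln s)" .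
  moreover have "ln A = ln ((1 + s ^ 3) / (1 + s\<^sup>2)) - ln ((1 + s\<^sup>2) / (1 + s))"
    using p by (simp add: A_def ln_div ln_mult power2_eq_square)
  ultimately show ?thesis by (simp add: algebra_simps)
qed

text \<open>\<open>ln 2\<close> minus the entropy, in nats, of (1 - y) / 2. In the centred variable
  its derivative is artanh y.\<close>

definition eta :: "real \<Rightarrow> real" where
  "eta y = ((1 + y) * ln (1 + y) + (1 - y) * ln (1 - y)) / 2"

lemma eta_deriv:
  assumes "0 \<le> y" "y < 1"
  shows "(eta has_real_derivative ln ((1 + y) / (1 - y)) / 2) (at y)"
proof -
  have "((\<lambda>y. ((1 + y) * ln (1 + y) + (1 - y) * ln (1 - y)) / 2) has_real_derivative ln ((1 + y) / (1 - y)) / 2) (at y)"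
    using assms by (auto intro!: derivative_eq_intros simp: ln_div)
  moreover have "eta = (\<lambda>y. ((1 + y) * ln (1 + y) + (1 - y) * ln (1 - y)) / 2)" by (simp add: fun_eq_iff eta_def)
  ultimately show ?thesis by simp
qed

lemma eta_mono:
  assumes "0 \<le> x" "x \<le> y" "y < 1"
  shows "eta x \<le> eta y"
proof (rule DERIV_nonneg_imp_nondecreasing [OF assms(2)])
  fix z assume "x \<le> z" "z \<le> y"
  then show "\<exists>d. (eta has_real_derivative d) (at z) \<and> 0 \<le> d"
    using assms by (intro exI [of _ "ln ((1 + z) / (1 - z)) / 2"] conjI eta_deriv) (auto simp: field_simps)
qed

text \<open>Made for the term of \<open>gap''\<close> that stems from the entropy of tau, with q =
  sqrt (1 - x^2): the first term of the series cancels the singular part 1 / q^2.\<close>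

lemma ln_ratio_cubic_bound:
  fixes q :: real
  assumes "0 < q" "q < 1"
  shows "1 / 3 + q\<^sup>2 / 5 \<le> ln ((1 + q) / (1 - q)) / (2 * q ^ 3) - 1 / q\<^sup>2"
proof -
  have "(2 * q + 2 * q ^ 3 / 3 + 2 * q ^ 5 / 5) / (2 * q ^ 3) \<le> ln ((1 + q) / (1 - q)) / (2 * q ^ 3)"
    using assms ln_ratio_ge [OF assms] by (intro divide_right_mono) auto
  moreover have "(2 * q + 2 * q ^ 3 / 3 + 2 * q ^ 5 / 5) / (2 * q ^ 3) = 1 / q\<^sup>2 + 1 / 3 + q\<^sup>2 / 5"
    using assms by (simp add: field_simps eval_nat_numeral)
  ultimately show ?thesis by linarith
qed

text \<open>
  With \<open>x = (1 - 2 rho)^2 = 1 - 2 delta1\<close>, nonnegativity of \<open>gap x\<close> says that the error events at distance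
  \<open>delta1 n\<close> hardly overlap (in nats; the term \<open>eta (sqrt (1 - x^2)) - ln 2\<close> is \<open>- h tau\<close>). The function is
  concave and vanishes at \<open>0\<close>, so it suffices to check the right end point.
\<close>

definition gap :: "real \<Rightarrow> real" where
  "gap x = eta (sqrt x) + eta (sqrt (1 - x\<^sup>2)) - ln 2 + (1 + x) * ln (1 + x)
     + (1 - x) * ln (1 - x) / 4 - (1 + 3 * x) * ln (1 + 3 * x) / 4"

definition gap' :: "real \<Rightarrow> real" where
  "gap' x = ln ((1 + sqrt x) / (1 - sqrt x)) / (4 * sqrt x)
     - ln ((1 + sqrt (1 - x\<^sup>2)) / (1 - sqrt (1 - x\<^sup>2))) * x / (2 * sqrt (1 - x\<^sup>2))
     + ln (1 + x) - ln (1 - x) / 4 - 3 * ln (1 + 3 * x) / 4"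

definition gap'' :: "real \<Rightarrow> real" where
  "gap'' x = (1 / (1 - x) - ln ((1 + sqrt x) / (1 - sqrt x)) / (2 * sqrt x)) / (4 * x)
     - (ln ((1 + sqrt (1 - x\<^sup>2)) / (1 - sqrt (1 - x\<^sup>2))) / (2 * sqrt (1 - x\<^sup>2) ^ 3) - 1 / (1 - x\<^sup>2))
     + 1 / (1 + x) + 1 / (4 * (1 - x)) - 9 / (4 * (1 + 3 * x))"

lemma gap_deriv:
  assumes x: "0 < x" "x < 1"
  shows "(gap has_real_derivative gap' x) (at x)"
proof -
  have x2: "0 < 1 - x\<^sup>2" "x\<^sup>2 > 0" using x by (auto simp: power_less_one_iff)
  have q: "0 < sqrt (1 - x\<^sup>2)" "sqrt (1 - x\<^sup>2) < 1" using x2 by auto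
  have e: "0 < sqrt x" "sqrt x < 1" using x by auto
  have d1: "((\<lambda>x. eta (sqrt x)) has_real_derivative ln ((1 + sqrt x) / (1 - sqrt x)) / 2 * (inverse (sqrt x) / 2)) (at x)"
    by (rule DERIV_chain2 [OF eta_deriv DERIV_real_sqrt]) (use e x in auto)
  have d2: "((\<lambda>x. eta (sqrt (1 - x\<^sup>2))) has_real_derivative
     ln ((1 + sqrt (1 - x\<^sup>2)) / (1 - sqrt (1 - x\<^sup>2))) / 2 * (- x / sqrt (1 - x\<^sup>2))) (at x)"
  proof (rule DERIV_chain2 [OF eta_deriv])
    show "((\<lambda>x. sqrt (1 - x\<^sup>2)) has_real_derivative - x / sqrt (1 - x\<^sup>2)) (at x)"
      using x2 by (auto intro!: derivative_eq_intros simp: field_simps)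
  qed (use q in auto)
  have d3: "((\<lambda>x. (1 + x) * ln (1 + x) + (1 - x) * ln (1 - x) / 4 - (1 + 3 * x) * ln (1 + 3 * x) / 4)
     has_real_derivative (ln (1 + x) + 1) + (- ln (1 - x) - 1) / 4 - (3 * ln (1 + 3 * x) + 3) / 4) (at x)"
  proof -
    have gen: "((\<lambda>x. (1 + k * x) * ln (1 + k * x)) has_real_derivative k * ln (1 + k * x) + k) (at x)"
      if "1 + k * x > 0" for k :: real
      using that by (auto intro!: derivative_eq_intros)
    show ?thesis
      using x gen [of 1] gen [of "-1"] gen [of 3] by (intro DERIV_add DERIV_diff DERIV_cdivide) auto
  qed
  have "((\<lambda>x. eta (sqrt x) + eta (sqrt (1 - x\<^sup>2)) - ln 2
      + ((1 + x) * ln (1 + x) + (1 - x) * ln (1 - x) / 4 - (1 + 3 * x) * ln (1 + 3 * x) / 4)) has_real_derivative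
     (ln ((1 + sqrt x) / (1 - sqrt x)) / 2 * (inverse (sqrt x) / 2)
     + ln ((1 + sqrt (1 - x\<^sup>2)) / (1 - sqrt (1 - x\<^sup>2))) / 2 * (- x / sqrt (1 - x\<^sup>2))) - 0
     + ((ln (1 + x) + 1) + (- ln (1 - x) - 1) / 4 - (3 * ln (1 + 3 * x) + 3) / 4)) (at x)" (is "(?f has_real_derivative ?d) _")
    by (intro DERIV_add DERIV_diff d1 d2 d3 DERIV_const)
  moreover have "?d = gap' x"
    unfolding gap'_def by (simp add: field_simps)
  moreover have "?f = gap" by (simp add: fun_eq_iff gap_def)
  ultimately show ?thesis by simp
qed

lemma gap'_deriv:
  assumes x: "0 < x" "x < 1"
  shows "(gap' has_real_derivative gap'' x) (at x)"
proof -
  define q where "q = sqrt (1 - x\<^sup>2)"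
  define e where "e = sqrt x"
  have x2: "0 < 1 - x\<^sup>2" "x\<^sup>2 > 0" using x by (auto simp: power_less_one_iff)
  have q: "0 < q" "q < 1" "q\<^sup>2 = 1 - x\<^sup>2" using x2 by (auto simp: q_def)
  have e: "0 < e" "e < 1" "e\<^sup>2 = x" using x by (auto simp: e_def)
  have dl: "((\<lambda>y. ln ((1 + y) / (1 - y))) has_real_derivative 2 / (1 - y\<^sup>2)) (at y)" if "0 < y" "y < 1" for y :: real
  proof -
    have "((\<lambda>y. (1 + y) / (1 - y)) has_real_derivative 2 / (1 - y)\<^sup>2) (at y)"
      using that by (auto intro!: derivative_eq_intros simp: power2_eq_square)
    then have "((\<lambda>y. ln ((1 + y) / (1 - y))) has_real_derivative 1 / ((1 + y) / (1 - y)) * (2 / (1 - y)\<^sup>2)) (at y)"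
      using that by (intro DERIV_chain2 [OF DERIV_ln_divide]) auto
    moreover have "1 / ((1 + y) / (1 - y)) * (2 / (1 - y)\<^sup>2) = 2 / (1 - y\<^sup>2)"
    proof -
      have a: "1 - y\<^sup>2 = (1 - y) * (1 + y)" by (simp add: power2_eq_square algebra_simps)
      have gen: "1 / (u / v) * (2 / (v * v)) = 2 / (v * u)" if "u > 0" "v > 0" for u v :: real
        using that by simp
      show ?thesis unfolding a unfolding power2_eq_square by (rule gen) (use that in auto)
    qed
    ultimately show ?thesis by simp
  qed
  have d1: "((\<lambda>x. ln ((1 + sqrt x) / (1 - sqrt x))) has_real_derivative 2 / (1 - e\<^sup>2) * (1 / (2 * e))) (at x)"
    unfolding e_def
    by (rule DERIV_chain2 [OF dl]) (use e x in \<open>auto simp: e_def [symmetric] intro!: derivative_eq_intros simp: field_simps\<close>)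
  have d1': "((\<lambda>x. ln ((1 + sqrt x) / (1 - sqrt x)) / (4 * sqrt x)) has_real_derivative
      (2 / (1 - e\<^sup>2) * (1 / (2 * e)) * (4 * e) - ln ((1 + e) / (1 - e)) * (4 * (1 / (2 * e)))) / (4 * e * (4 * e))) (at x)"
    unfolding e_def
    by (rule DERIV_divide [OF d1 [unfolded e_def]]) (use x in \<open>auto intro!: derivative_eq_intros simp: field_simps\<close>)
  have dq: "((\<lambda>x. sqrt (1 - x\<^sup>2)) has_real_derivative - x / q) (at x)"
    using x2 unfolding q_def by (auto intro!: derivative_eq_intros simp: field_simps)
  have d2: "((\<lambda>x. ln ((1 + sqrt (1 - x\<^sup>2)) / (1 - sqrt (1 - x\<^sup>2)))) has_real_derivative 2 / (1 - q\<^sup>2) * (- x / q)) (at x)"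
    unfolding q_def
    by (rule DERIV_chain2 [OF dl dq [unfolded q_def]]) (use q in \<open>auto simp: q_def\<close>)
  have d2': "((\<lambda>x. ln ((1 + sqrt (1 - x\<^sup>2)) / (1 - sqrt (1 - x\<^sup>2))) * x / (2 * sqrt (1 - x\<^sup>2))) has_real_derivative
     ((2 / (1 - q\<^sup>2) * (- x / q) * x + 1 * ln ((1 + q) / (1 - q))) * (2 * q) - (ln ((1 + q) / (1 - q)) * x) * (2 * (- x / q))) / (2 * q * (2 * q))) (at x)"
    unfolding q_def
    by (rule DERIV_divide [OF DERIV_mult [OF d2 [unfolded q_def] DERIV_ident] DERIV_cmult [OF dq [unfolded q_def]]])
      (use q in \<open>auto simp: q_def\<close>)
  have d3: "((\<lambda>x. ln (1 + x) - ln (1 - x) / 4 - 3 * ln (1 + 3 * x) / 4) has_real_derivative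
     1 / (1 + x) + 1 / (4 * (1 - x)) - 9 / (4 * (1 + 3 * x))) (at x)"
  proof -
    have gen: "((\<lambda>x. ln (1 + k * x)) has_real_derivative k / (1 + k * x)) (at x)"
      if "1 + k * x > 0" for k :: real
      using that by (auto intro!: derivative_eq_intros)
    have "((\<lambda>x. ln (1 + x) - ln (1 - x) / 4 - 3 * ln (1 + 3 * x) / 4) has_real_derivative
       1 / (1 + x) - (- 1 / (1 - x)) / 4 - 3 * (3 / (1 + 3 * x)) / 4) (at x)"
      using x gen [of 1] gen [of "-1"] gen [of 3]
      by (intro DERIV_diff DERIV_cdivide DERIV_cmult) auto
    moreover have "1 / (1 + x) - (- 1 / (1 - x)) / 4 - 3 * (3 / (1 + 3 * x)) / 4
       = 1 / (1 + x) + 1 / (4 * (1 - x)) - 9 / (4 * (1 + 3 * x))"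
      by (simp add: mult.commute)
    ultimately show ?thesis by (simp only:)
  qed
  have "((\<lambda>x. ln ((1 + sqrt x) / (1 - sqrt x)) / (4 * sqrt x)
     - ln ((1 + sqrt (1 - x\<^sup>2)) / (1 - sqrt (1 - x\<^sup>2))) * x / (2 * sqrt (1 - x\<^sup>2))
     + (ln (1 + x) - ln (1 - x) / 4 - 3 * ln (1 + 3 * x) / 4)) has_real_derivative
     ((2 / (1 - e\<^sup>2) * (1 / (2 * e)) * (4 * e) - ln ((1 + e) / (1 - e)) * (4 * (1 / (2 * e)))) / (4 * e * (4 * e))
     - ((2 / (1 - q\<^sup>2) * (- x / q) * x + 1 * ln ((1 + q) / (1 - q))) * (2 * q) - (ln ((1 + q) / (1 - q)) * x) * (2 * (- x / q))) / (2 * q * (2 * q))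
     + (1 / (1 + x) + 1 / (4 * (1 - x)) - 9 / (4 * (1 + 3 * x))))) (at x)" (is "(?f has_real_derivative ?d) _")
    by (rule DERIV_add [OF DERIV_diff [OF d1' d2'] d3])
  moreover have "?f = gap'" by (simp add: fun_eq_iff gap'_def)
  moreover have "?d = gap'' x"
  proof -
    define Le where "Le = ln ((1 + e) / (1 - e))"
    define Lq where "Lq = ln ((1 + q) / (1 - q))"
    have 1: "(2 / (1 - e\<^sup>2) * (1 / (2 * e)) * (4 * e) - Le * (4 * (1 / (2 * e)))) / (4 * e * (4 * e))
       = (1 / (1 - x) - Le / (2 * e)) / (4 * x)"
    proof -
      have "2 / (1 - e\<^sup>2) * (1 / (2 * e)) * (4 * e) - Le * (4 * (1 / (2 * e))) = 4 * (1 / (1 - x) - Le / (2 * e))"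
        unfolding e(3) using e(1) by (simp add: right_diff_distrib)
      then have "(2 / (1 - e\<^sup>2) * (1 / (2 * e)) * (4 * e) - Le * (4 * (1 / (2 * e)))) / (4 * e * (4 * e))
        = 4 * (1 / (1 - x) - Le / (2 * e)) / (4 * (4 * e\<^sup>2))" by (simp only: power2_eq_square mult_ac)
      also have "\<dots> = (1 / (1 - x) - Le / (2 * e)) / (4 * x)"
        unfolding e(3) by (rule mult_divide_mult_cancel_left) simp
      finally show ?thesis .
    qed
    have 2: "((2 / (1 - q\<^sup>2) * (- x / q) * x + 1 * Lq) * (2 * q) - (Lq * x) * (2 * (- x / q))) / (2 * q * (2 * q))
       = Lq / (2 * q ^ 3) - 1 / (1 - x\<^sup>2)"
    proof -
      have "1 - q\<^sup>2 = x * x" using q(3) by (simp add: power2_eq_square)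
      then have a: "2 / (1 - q\<^sup>2) * (- x / q) * x = - 2 / q" using x by simp
      have b: "x * x = 1 - q * q" using q(3) by (simp add: power2_eq_square)
      have "((- 2 / q + 1 * Lq) * (2 * q) - (Lq * x) * (2 * (- x / q))) = - 4 + 2 * Lq * q + 2 * Lq * (x * x) / q"
        using q(1) by (simp add: field_simps)
      also have "\<dots> = - 4 + 2 * Lq / q" unfolding b using q(1) by (simp add: field_simps)
      finally have c: "((- 2 / q + 1 * Lq) * (2 * q) - (Lq * x) * (2 * (- x / q))) = - 4 + 2 * Lq / q" .
      have "(- 4 + 2 * Lq / q) / (2 * q * (2 * q)) = Lq / (2 * q ^ 3) - 1 / q\<^sup>2"
        using q(1) by (simp add: field_simps power2_eq_square power3_eq_cube)
      then show ?thesis unfolding a c using q(3) by simp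
    qed
    show ?thesis unfolding gap''_def Le_def [symmetric] Lq_def [symmetric] 1 2
      unfolding Le_def Lq_def e_def q_def by simp
  qed
  ultimately show ?thesis by simp
qed

text \<open>Both artanh terms enter with a negative sign, so truncating their series bounds
  \<open>gap''\<close> by a rational function. Its numerator is nonpositive up to 41/100, a round
  number just above 256/625.\<close>

lemma gap''_nonpos:
  assumes x: "0 < x" "x \<le> 41/100"
  shows "gap'' x \<le> 0"
proof -
  define q where "q = sqrt (1 - x\<^sup>2)"
  define e where "e = sqrt x"
  have x2: "0 < 1 - x\<^sup>2" "x\<^sup>2 > 0" using x by (auto simp: power_less_one_iff)
  have q: "0 < q" "q < 1" "q\<^sup>2 = 1 - x\<^sup>2" using x2 by (auto simp: q_def)
  have e: "0 < e" "e < 1" "e\<^sup>2 = x" using x by (auto simp: e_def)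
  have 1: "1 / 3 + (1 - x\<^sup>2) / 5 \<le> ln ((1 + q) / (1 - q)) / (2 * q ^ 3) - 1 / (1 - x\<^sup>2)"
    using ln_ratio_cubic_bound [OF q(1,2)] q(3) by simp
  have "1 + x / 3 + x\<^sup>2 / 5 \<le> ln ((1 + e) / (1 - e)) / (2 * e)"
  proof -
    have "(2 * e + 2 * e ^ 3 / 3 + 2 * e ^ 5 / 5) / (2 * e) \<le> ln ((1 + e) / (1 - e)) / (2 * e)"
      using e ln_ratio_ge [OF e(1,2)] by (intro divide_right_mono) auto
    moreover have "(2 * e + 2 * e ^ 3 / 3 + 2 * e ^ 5 / 5) / (2 * e) = 1 + x / 3 + x\<^sup>2 / 5"
      unfolding e(3) [symmetric] using e(1) by (simp add: field_simps eval_nat_numeral)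
    ultimately show ?thesis by simp
  qed
  then have "(1 / (1 - x) - ln ((1 + e) / (1 - e)) / (2 * e)) / (4 * x) \<le> (1 / (1 - x) - (1 + x / 3 + x\<^sup>2 / 5)) / (4 * x)"
    using x by (intro divide_right_mono) auto
  also have "\<dots> = 1 / 6 + x / (4 * (1 - x)) - x / 20"
    using x by (simp add: field_simps power2_eq_square)
  finally have 2: "(1 / (1 - x) - ln ((1 + e) / (1 - e)) / (2 * e)) / (4 * x) \<le> 1 / 6 + x / (4 * (1 - x)) - x / 20" .
  have "gap'' x \<le> 1 / 6 + x / (4 * (1 - x)) - x / 20 - (1 / 3 + (1 - x\<^sup>2) / 5) + 1 / (1 + x) + 1 / (4 * (1 - x)) - 9 / (4 * (1 + 3 * x))"
    unfolding gap''_def q_def [symmetric] e_def [symmetric] using 1 2 by linarith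
  also have "\<dots> = (- 82 + 126 * x + 85 * x ^ 2 + 150 * x ^ 3 - 3 * x ^ 4 - 36 * x ^ 5) / (60 * (1 - x) * (1 + x) * (1 + 3 * x))"
    using x by (simp add: divide_simps) (simp add: eval_nat_numeral algebra_simps)
  also have "\<dots> \<le> 0"
  proof (rule divide_nonpos_nonneg)
    have "x ^ 2 \<le> 1681/10000" "x ^ 3 \<le> 68921/1000000"
      using x power_mono [of x "41/100" 2] power_mono [of x "41/100" 3] by (auto simp: power_divide)
    moreover have "0 \<le> x ^ 4" "0 \<le> x ^ 5" using x by auto
    ultimately show "- 82 + 126 * x + 85 * x ^ 2 + 150 * x ^ 3 - 3 * x ^ 4 - 36 * x ^ 5 \<le> 0"
      using x(2) by linarith
  qed (use x in auto)
  finally show ?thesis .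
qed


lemma gap_concave: "concave_on {0<..41/100} gap"
proof (rule f''_le0_imp_concave [where f' = gap' and f'' = gap''])
  fix x :: real assume "x \<in> {0<..41/100}"
  then show "(gap has_real_derivative gap' x) (at x)" "(gap' has_real_derivative gap'' x) (at x)" "gap'' x \<le> 0"
    using gap_deriv [of x] gap'_deriv [of x] gap''_nonpos [of x] by auto
qed (simp add: convex_real_interval)

lemma gap_tendsto: "(gap \<longlongrightarrow> 0) (at_right 0)"
  unfolding gap_def [abs_def] eta_def by real_asymp

text \<open>The value is only about 1/1000, so the logarithms are needed to five or six digits. The
  arguments are split into factors and reciprocals of numbers in (1, 2], where the series converges
  fast; 114/125 is a rational lower bound for the square root.\<close>

lemma gap_end: "0 < gap (256/625)"
proof -
  have sq: "sqrt (256/625) = 16/25" by (rule real_sqrt_unique) (auto simp: power2_eq_square)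
  have "sqrt (1 - (256/625)\<^sup>2) \<ge> 114/125" by (rule real_le_rsqrt) (simp add: power2_eq_square)
  moreover have "sqrt (1 - (256/625)\<^sup>2) < 1" by simp
  ultimately have q: "eta (114/125) \<le> eta (sqrt (1 - (256/625)\<^sup>2))"
    by (intro eta_mono) auto
  have l1: "ln (41/25::real) \<ge> 494686/1000000" using ln_approx_bounds [of "41/25" 6] by (simp add: eval_nat_numeral)
  have l2: "ln (5/3::real) \<le> 510836/1000000" using ln_approx_bounds [of "5/3" 6] by (simp add: eval_nat_numeral)
  have l3: "ln (881/625::real) \<ge> 343296/1000000" using ln_approx_bounds [of "881/625" 5] by (simp add: eval_nat_numeral)
  have l4: "ln (2::real) \<le> 693149/1000000" using ln_approx_bounds [of 2 7] by (simp add: eval_nat_numeral)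
  have l5: "ln (1393/1250::real) \<le> 108325/1000000" using ln_approx_bounds [of "1393/1250" 4] by (simp add: eval_nat_numeral)
  have l4': "ln (2::real) \<ge> 693146/1000000" using ln_approx_bounds [of 2 7] by (simp add: eval_nat_numeral)
  have l6: "ln (250/239::real) \<le> 44998/1000000" using ln_approx_bounds [of "250/239" 2] by (simp add: eval_nat_numeral)
  have l7: "ln (125/88::real) \<le> 350987/1000000" using ln_approx_bounds [of "125/88" 5] by (simp add: eval_nat_numeral)
  have "ln (9/25::real) = ln (3/5 * (3/5))" by (rule arg_cong [of _ _ ln]) simp
  also have "\<dots> = ln (3/5) + ln (3/5)" by (rule ln_mult_pos) auto
  also have "ln (3/5::real) = ln (inverse (5/3))" by (rule arg_cong [of _ _ ln]) simp
  also have "\<dots> = - ln (5/3)" by (rule ln_inverse)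
  finally have m1: "ln (9/25::real) = - ln (5/3) + - ln (5/3)" .
  have "ln (369/625::real) = ln (41/25 * (9/25))" by (rule arg_cong [of _ _ ln]) simp
  also have "\<dots> = ln (41/25) + ln (9/25)" by (rule ln_mult_pos) auto
  finally have m2: "ln (369/625::real) = ln (41/25) + ln (9/25)" .
  have "ln (1393/625::real) = ln (2 * (1393/1250))" by (rule arg_cong [of _ _ ln]) simp
  also have "\<dots> = ln 2 + ln (1393/1250)" by (rule ln_mult_pos) auto
  finally have m3: "ln (1393/625::real) = ln 2 + ln (1393/1250)" .
  have "ln (11/125::real) = ln (inverse (2 * (2 * (2 * (125/88)))))" by (rule arg_cong [of _ _ ln]) simp
  also have "\<dots> = - ln (2 * (2 * (2 * (125/88))))" by (rule ln_inverse)
  also have "ln (2 * (2 * (2 * (125/88))) :: real) = ln 2 + ln (2 * (2 * (125/88)))" by (rule ln_mult_pos) auto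
  also have "ln (2 * (2 * (125/88)) :: real) = ln 2 + ln (2 * (125/88))" by (rule ln_mult_pos) auto
  also have "ln (2 * (125/88) :: real) = ln 2 + ln (125/88)" by (rule ln_mult_pos) auto
  finally have m4: "ln (11/125::real) = - (ln 2 + (ln 2 + (ln 2 + ln (125/88))))" .
  have "ln (239/125::real) = ln (2 * inverse (250/239))" by (rule arg_cong [of _ _ ln]) simp
  also have "\<dots> = ln 2 + ln (inverse (250/239))" by (rule ln_mult_pos) auto
  also have "ln (inverse (250/239) :: real) = - ln (250/239)" by (rule ln_inverse)
  finally have m5: "ln (239/125::real) = ln 2 + - ln (250/239)" .
  have g: "gap (256/625) \<ge> eta (16/25) + eta (114/125) - ln 2 + 881/625 * ln (881/625)
     + 369/625 * ln (369/625) / 4 - 1393/625 * ln (1393/625) / 4"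
    unfolding gap_def sq using q by simp
  have e1: "eta (16/25) = (41/25 * ln (41/25) + 9/25 * ln (9/25)) / 2" by (simp add: eta_def)
  have e2: "eta (114/125) = (239/125 * ln (239/125) + 11/125 * ln (11/125)) / 2" by (simp add: eta_def)
  show ?thesis
    using g l1 l2 l3 l4 l4' l5 l6 l7 unfolding e1 e2 m2 m1 m3 m4 m5
    by (simp add: field_simps)
qed

text \<open>Concavity is available only without the end point 0. If \<open>gap x\<close> were
  negative, the limit at 0 would supply a \<open>t\<close> in (0, x) with a larger value; then
  \<open>x\<close> lies between \<open>t\<close> and 256/625, where \<open>gap\<close> is larger at
  both ends.\<close>

lemma gap_nonneg:
  assumes x: "0 < x" "x \<le> 256/625"
  shows "0 \<le> gap x"
proof (rule ccontr)
  assume "\<not> ?thesis"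
  then have neg: "gap x < 0" by simp
  have "\<forall>\<^sub>F t in at_right 0. t \<in> {0<..<x}" using x by (intro eventually_at_right_real)
  moreover have "\<forall>\<^sub>F t in at_right 0. gap x < gap t" using order_tendstoD(1) [OF gap_tendsto neg] .
  ultimately have ev: "\<forall>\<^sub>F t in at_right 0. t \<in> {0<..<x} \<and> gap x < gap t" by (rule eventually_conj)
  have "\<exists>t. t \<in> {0<..<x} \<and> gap x < gap t"
    by (rule eventually_happens' [OF trivial_limit_at_right_real ev])
  then obtain t where t: "0 < t" "t < x" "gap x < gap t" by auto
  define w where "w = (256/625 - x) / (256/625 - t)"
  have w: "0 \<le> w" "w \<le> 1" using x t by (auto simp: w_def)
  have xw: "x = (1 - w) * (256/625) + w * t"
  proof -
    have "w * (256/625 - t) = 256/625 - x" using t x by (simp add: w_def)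
    then show ?thesis by (simp only: right_diff_distrib left_diff_distrib)
  qed
  have "(1 - w) * gap (256/625) + w * gap t \<le> gap ((1 - w) * (256/625) + w * t)"
    using concave_onD [OF gap_concave w, of "256/625" t] t x by simp
  then have le: "(1 - w) * gap (256/625) + w * gap t \<le> gap x" using xw by simp
  have "(1 - w) * gap x + w * gap x < (1 - w) * gap (256/625) + w * gap t"
  proof (cases "w = 0")
    case True
    then show ?thesis using gap_end neg by simp
  next
    case False
    have "(1 - w) * gap x \<le> (1 - w) * gap (256/625)" using w gap_end neg by (intro mult_left_mono) auto
    moreover have "w * gap x < w * gap t" using w False t by (intro mult_strict_left_mono) auto
    ultimately show ?thesis by linarith
  qed
  then show False using le by (simp add: algebra_simps)
qed

section \<open>The second linear programming bound for large distances\<close>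

lemma sinh_cosh_bound:
  fixes S :: real
  assumes S: "0 \<le> S"
  shows "S * cosh S \<le> sinh S + 59/200 * (sinh S * cosh S)"
proof -
  \<comment> \<open>The Taylor coefficients \<open>(59/200 * 4^k - 2 k) / (2 k + 1)!\<close> of the difference are negative only for \<open>k = 1\<close>.\<close>
  define cf where "cf n = (if even n then 0 else (1 + 59/400 * 2 ^ n - real n) * S ^ n / fact n)" for n :: nat
  have s1: "(\<lambda>n. if even n then 0 else S ^ n / fact n) sums sinh S"
    using sinh_converges [of S] by (simp add: scaleR_conv_of_real divide_inverse mult.commute cong: if_cong)
  have s2: "(\<lambda>n. if even n then 0 else (2 * S) ^ n / fact n) sums sinh (2 * S)"
    using sinh_converges [of "2 * S"] by (simp add: scaleR_conv_of_real divide_inverse mult.commute cong: if_cong)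
  have s3: "(\<lambda>n. if even n then 0 else real n * S ^ n / fact n) sums (S * cosh S)"
  proof -
    have "(\<lambda>n. if even n then S ^ n / fact n else 0) sums cosh S"
      using cosh_converges [of S] by (simp add: scaleR_conv_of_real divide_inverse mult.commute cong: if_cong)
    then have "(\<lambda>n. S * (if even n then S ^ n / fact n else 0)) sums (S * cosh S)" by (rule sums_mult)
    moreover have "(\<lambda>n. S * (if even n then S ^ n / fact n else 0))
        = (\<lambda>n. (\<lambda>n. if even n then 0 else real n * S ^ n / fact n) (Suc n))"
      by (auto simp: fun_eq_iff fact_Suc simp del: of_nat_Suc)
    ultimately show ?thesis using sums_Suc [of "\<lambda>n. if even n then 0 else real n * S ^ n / fact n"] by simp
  qed
  have "(\<lambda>n. (if even n then 0 else S ^ n / fact n) + 59/400 * (if even n then 0 else (2 * S) ^ n / fact n)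
      - (if even n then 0 else real n * S ^ n / fact n)) sums (sinh S + 59/400 * sinh (2 * S) - S * cosh S)"
    by (intro sums_diff sums_add sums_mult s1 s2 s3)
  moreover have "(\<lambda>n. (if even n then 0 else S ^ n / fact n) + 59/400 * (if even n then 0 else (2 * S) ^ n / fact n)
      - (if even n then 0 else real n * S ^ n / fact n)) = cf"
    by (auto simp: fun_eq_iff cf_def power_mult_distrib field_simps)
  ultimately have sums: "cf sums (sinh S + 59/400 * sinh (2 * S) - S * cosh S)" by simp
  have big: "real n \<le> 59/400 * 2 ^ n" if "n \<ge> 10" for n :: nat
    using that by (induction rule: dec_induct) auto
  have "(\<Sum>n<10. cf n) \<le> suminf cf"
  proof (rule sum_le_suminf)
    show "summable cf" using sums by (rule sums_summable)
    fix n :: nat assume "n \<in> - {..<10}"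
    then show "0 \<le> cf n" using big [of n] S by (auto simp: cf_def)
  qed simp
  also have "suminf cf = sinh S + 59/400 * sinh (2 * S) - S * cosh S" using sums by (rule sums_unique [symmetric])
  finally have le: "(\<Sum>n<10. cf n) \<le> sinh S + 59/400 * sinh (2 * S) - S * cosh S" .
  define x where "x = S\<^sup>2"
  have x0: "x \<ge> 0" by (simp add: x_def)
  have fin: "(\<Sum>n<10. cf n) = S * (59/200 - 41/300 * x + 3/500 * x\<^sup>2 + 23/9000 * x ^ 3 + 211/1134000 * x ^ 4)"
  proof -
    have "{..<10::nat} = {0, 1, 2, 3, 4, 5, 6, 7, 8, 9}" by auto
    then have "(\<Sum>n<10. cf n) = cf 0 + cf 1 + cf 2 + cf 3 + cf 4 + cf 5 + cf 6 + cf 7 + cf 8 + cf 9" by simp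
    also have "\<dots> = cf 1 + cf 3 + cf 5 + cf 7 + cf 9" by (simp add: cf_def)
    finally have 1: "(\<Sum>n<10. cf n) = cf 1 + cf 3 + cf 5 + cf 7 + cf 9" .
    have c: "cf 1 = 59/200 * S" "cf 3 = - 41/300 * S ^ 3" "cf 5 = 3/500 * S ^ 5" "cf 7 = 23/9000 * S ^ 7"
      "cf 9 = 211/1134000 * S ^ 9"
      by (simp_all add: cf_def fact_numeral)
    have p: "S ^ 3 = S * x" "S ^ 5 = S * x\<^sup>2" "S ^ 7 = S * x ^ 3" "S ^ 9 = S * x ^ 4"
      unfolding x_def power_mult [symmetric] power_Suc [symmetric] by simp_all
    show ?thesis unfolding 1 c p by (simp add: algebra_simps)
  qed
  \<comment> \<open>Each power of \<open>x\<close> is bounded below by its tangent at 16/5, which is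
    close to the minimiser of the quartic. The linear function that results has positive
    coefficients.\<close>
  have "0 \<le> 59/200 - 41/300 * x + 3/500 * x\<^sup>2 + 23/9000 * x ^ 3 + 211/1134000 * x ^ 4"
  proof -
    have "x\<^sup>2 - (32/5 * x - 256/25) = (x - 16/5)\<^sup>2" by (simp add: power2_eq_square algebra_simps)
    then have a: "0 \<le> x\<^sup>2 - (32/5 * x - 256/25)" by simp
    have "x ^ 3 - (768/25 * x - 8192/125) = (x - 16/5)\<^sup>2 * (x + 32/5)"
      by (simp add: power2_eq_square power3_eq_cube field_simps)
    then have b: "0 \<le> x ^ 3 - (768/25 * x - 8192/125)" using x0 by simp
    have "x ^ 4 - (16384/125 * x - 196608/625) = (x\<^sup>2 - 256/25)\<^sup>2 + 512/25 * (x - 16/5)\<^sup>2"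
      by (simp add: power2_eq_square power4_eq_xxxx field_simps)
    then have c: "0 \<le> x ^ 4 - (16384/125 * x - 196608/625)" by simp
    show ?thesis using a b c x0 by linarith
  qed
  then have "0 \<le> (\<Sum>n<10. cf n)" unfolding fin using S by (intro mult_nonneg_nonneg)
  moreover have "sinh (2 * S) = 2 * (sinh S * cosh S)" using sinh_double [of S] by (simp add: mult.assoc)
  ultimately show ?thesis using le by linarith
qed

text \<open>The substitution T = tanh S turns this into \<open>sinh_cosh_bound\<close>, the square
  root being 1 / cosh S. The constant 59/200 is chosen as a lower bound for delta1 when s >=
  9/41.\<close>

lemma artanh_bound:
  fixes T :: real
  assumes T: "0 < T" "T < 1"
  shows "sqrt (1 - T\<^sup>2) * (ln ((1 + T) / (1 - T)) / (2 * T) - 1) \<le> 59/200"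
proof -
  define a b where "a = sqrt (1 + T)" and "b = sqrt (1 - T)"
  define S where "S = ln ((1 + T) / (1 - T)) / 2"
  have ab: "a > 0" "b > 0" "a * a = 1 + T" "b * b = 1 - T" using T by (auto simp: a_def b_def)
  have "a * b = sqrt ((1 + T) * (1 - T))" by (simp add: a_def b_def real_sqrt_mult)
  also have "(1 + T) * (1 - T) = 1 - T\<^sup>2" by (simp add: power2_eq_square algebra_simps)
  finally have r: "sqrt (1 - T\<^sup>2) = a * b" by simp
  have S0: "S \<ge> 0" using T by (simp add: S_def)
  have "S = ln (a / b)"
  proof -
    have "(1 + T) / (1 - T) = (a / b) * (a / b)" using ab by simp
    moreover have "ln ((a / b) * (a / b)) = ln (a / b) + ln (a / b)" using ab by (intro ln_mult_pos) auto
    ultimately show ?thesis by (simp add: S_def)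
  qed
  then have e: "exp S = a / b" "exp (- S) = b / a" using ab by (auto simp: exp_minus)
  have ch: "cosh S = 1 / (a * b)"
  proof -
    have "cosh S = (a / b + b / a) / 2" by (simp add: cosh_def e)
    also have "\<dots> = (a * a + b * b) / (2 * (a * b))" using ab(1,2) by (simp add: field_simps)
    finally show ?thesis by (simp add: ab)
  qed
  have sh: "sinh S = T / (a * b)"
  proof -
    have "sinh S = (a / b - b / a) / 2" by (simp add: sinh_def e)
    also have "\<dots> = (a * a - b * b) / (2 * (a * b))" using ab(1,2) by (simp add: field_simps)
    finally show ?thesis by (simp add: ab)
  qed
  define m where "m = a * b"
  have m: "m > 0" using ab by (simp add: m_def)
  have "S * (1 / m) \<le> T / m + 59/200 * (T / m * (1 / m))"
    using sinh_cosh_bound [OF S0] unfolding ch sh m_def .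
  then have "S * (1 / m) * (m * m / T) \<le> (T / m + 59/200 * (T / m * (1 / m))) * (m * m / T)"
    using m T by (intro mult_right_mono) auto
  moreover have "S * (1 / m) * (m * m / T) = m * S / T" using m by simp
  moreover have "(T / m + 59/200 * (T / m * (1 / m))) * (m * m / T) = m + 59/200"
    using m T by (simp add: distrib_right add_divide_distrib)
  ultimately have "m * S / T \<le> m + 59/200" by (simp only:)
  moreover have "m * (S / T - 1) = m * S / T - m" by (simp add: right_diff_distrib)
  ultimately have "m * (S / T - 1) \<le> 59/200" by linarith
  moreover have "S / T = ln ((1 + T) / (1 - T)) / (2 * T)" by (simp add: S_def)
  ultimately show ?thesis unfolding r m_def by simp
qed

section \<open>Continuity of the entropy, and the minimum in \<open>Rbar\<close>\<close>

lemma h_0: "h 0 = 0"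
  by (simp add: h_def)

lemma h_half: "h (1/2) = 1"
proof -
  have l: "log 2 (1/2 :: real) = - 1" unfolding log_def by (simp add: ln_div)
  have e: "1 - 1/2 = (1/2 :: real)" by simp
  have "h (1/2) = - (1/2) * log 2 (1/2) - (1 - 1/2) * log 2 (1 - 1/2)" by (rule h_def)
  also have "\<dots> = - (1/2) * log 2 (1/2) - (1/2) * log 2 (1/2)" by (simp only: e)
  also have "\<dots> = 1" unfolding l by simp
  finally show ?thesis .
qed

lemma h_tendsto_0: "(h \<longlongrightarrow> h 0) (at_right 0)"
proof -
  have l: "((\<lambda>x. x * ln x) \<longlongrightarrow> 0) (at_right (0::real))" "((\<lambda>x. (1 - x) * ln (1 - x)) \<longlongrightarrow> 0) (at_right (0::real))"
    by real_asymp+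
  have "((\<lambda>x. - (x * ln x + (1 - x) * ln (1 - x)) / ln 2) \<longlongrightarrow> - (0 + 0) / ln 2) (at_right (0::real))"
    by (rule tendsto_divide [OF tendsto_minus [OF tendsto_add [OF l]] tendsto_const]) simp
  moreover have "h = (\<lambda>x. - (x * ln x + (1 - x) * ln (1 - x)) / ln 2)"
    by (simp add: fun_eq_iff h_def log_def diff_divide_distrib)
  ultimately show ?thesis unfolding h_0 by simp
qed

lemma continuous_on_h: "continuous_on {0..1/2} h"
  unfolding continuous_on_eq_continuous_within
proof
  fix x :: real assume x: "x \<in> {0..1/2}"
  show "continuous (at x within {0..1/2}) h"
  proof (cases "x = 0")
    case True
    then show ?thesis using h_tendsto_0 by (simp add: continuous_within at_within_Icc_at_right)
  next
    case False
    then have "0 < x" "x < 1" using x by auto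
    from DERIV_isCont [OF h_has_derivative [OF this]] show ?thesis
      by (rule continuous_at_imp_continuous_at_within)
  qed
qed

text \<open>
  The derivative in \<open>\<alpha>\<close> of the function minimised in \<open>Rbar\<close> is nonpositive if the expression bounded
  in \<open>artanh_bound\<close>, for \<open>T = 1 - 2 * tau \<alpha> (\<delta> / 2)\<close>, is at most \<open>\<delta>\<close>.
\<close>

lemma Rbar_lower:
  assumes d: "59/200 \<le> \<delta>" "\<delta> < 1/2"
  shows "h (1/2 - sqrt (\<delta> * (1 - \<delta>))) \<le> Rbar \<delta>"
proof -
  define \<xi> where "\<xi> = \<delta> / 2"
  define a0 where "a0 = (1 - sqrt (1 - 2 * \<delta>)) / 2"
  define u where "u \<alpha> = \<alpha> * (1 - \<alpha>) - \<xi> * (1 - \<xi>)" for \<alpha>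
  define v where "v \<alpha> = sqrt (u \<alpha>) - \<xi>" for \<alpha>
  define T where "T \<alpha> = sqrt (1 - 4 * (v \<alpha>)\<^sup>2)" for \<alpha>
  have \<xi>0: "0 < \<xi>" "\<xi> < 1/4" using d by (auto simp: \<xi>_def)
  have tau: "tau \<alpha> \<xi> = (1 - T \<alpha>) / 2" for \<alpha> by (simp add: tau_def T_def v_def u_def)
  have a0: "0 < a0" "a0 < 1/2"
    using d by (auto simp: a0_def)
  have uge: "\<xi>\<^sup>2 \<le> u \<alpha> \<and> (a0 < \<alpha> \<longrightarrow> \<xi>\<^sup>2 < u \<alpha>)" if "a0 \<le> \<alpha>" "\<alpha> \<le> 1/2" for \<alpha>
  proof -
    have "0 \<le> 1 - 2 * \<alpha>" "1 - 2 * \<alpha> \<le> sqrt (1 - 2 * \<delta>)" using that by (auto simp: a0_def)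
    then have "(1 - 2 * \<alpha>)\<^sup>2 \<le> (sqrt (1 - 2 * \<delta>))\<^sup>2" by (intro power_mono) auto
    then have 1: "\<delta> / 2 \<le> \<alpha> * (1 - \<alpha>)" using d by (simp add: power2_eq_square algebra_simps)
    have 2: "\<delta> / 2 < \<alpha> * (1 - \<alpha>)" if "a0 < \<alpha>"
    proof -
      have "1 - 2 * \<alpha> < sqrt (1 - 2 * \<delta>)" using that by (auto simp: a0_def)
      then have "(1 - 2 * \<alpha>)\<^sup>2 < (sqrt (1 - 2 * \<delta>))\<^sup>2" using \<open>0 \<le> 1 - 2 * \<alpha>\<close> by (intro power_strict_mono) auto
      then show ?thesis using d by (simp add: power2_eq_square algebra_simps)
    qed
    show ?thesis using 1 2 by (auto simp: u_def \<xi>_def power2_eq_square algebra_simps)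
  qed
  have ule: "u \<alpha> \<le> (1/2 - \<xi>)\<^sup>2" for \<alpha>
  proof -
    have "0 \<le> (1/2 - \<alpha>)\<^sup>2" by simp
    then show ?thesis by (simp add: u_def power2_eq_square algebra_simps)
  qed
  have vr: "0 \<le> v \<alpha> \<and> v \<alpha> \<le> 1/2 - 2 * \<xi> \<and> (a0 < \<alpha> \<longrightarrow> 0 < v \<alpha>)" if "a0 \<le> \<alpha>" "\<alpha> \<le> 1/2" for \<alpha>
  proof -
    have "\<xi> \<le> sqrt (u \<alpha>)" using uge [OF that] by (intro real_le_rsqrt) auto
    moreover have "sqrt (u \<alpha>) \<le> 1/2 - \<xi>" using ule \<xi>0 by (intro real_le_lsqrt) auto
    moreover have "\<xi> < sqrt (u \<alpha>)" if "a0 < \<alpha>" using that uge [OF \<open>a0 \<le> \<alpha>\<close> \<open>\<alpha> \<le> 1/2\<close>] by (intro real_less_rsqrt) auto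
    ultimately show ?thesis by (auto simp: v_def)
  qed
  have v4: "4 * (v \<alpha>)\<^sup>2 < 1" if "a0 \<le> \<alpha>" "\<alpha> \<le> 1/2" for \<alpha>
  proof -
    have "\<bar>v \<alpha>\<bar> < 1/2" using vr [OF that] \<xi>0 by auto
    then have "(v \<alpha>)\<^sup>2 < (1/2)\<^sup>2" by (metis abs_square_less_1 abs_ge_zero power2_abs power_strict_mono pos2)
    then show ?thesis by (simp add: power2_eq_square)
  qed
  have Tr: "0 < T \<alpha> \<and> T \<alpha> \<le> 1 \<and> (a0 < \<alpha> \<longrightarrow> T \<alpha> < 1)" if "a0 \<le> \<alpha>" "\<alpha> \<le> 1/2" for \<alpha>
    using v4 [OF that] vr [OF that] by (auto simp: T_def)
  define \<Phi> where "\<Phi> \<alpha> = h (tau \<alpha> \<xi>) - h \<alpha>" for \<alpha>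
  have "\<Phi> (1/2) \<le> \<Phi> \<alpha>" if a: "a0 \<le> \<alpha>" "\<alpha> \<le> 1/2" for \<alpha>
  proof (cases "\<alpha> = 1/2")
    case False
    \<comment> \<open>At the left end \<open>a0\<close> the function \<open>v\<close> vanishes and
      \<open>tau\<close> becomes 0, where \<open>h\<close> is continuous but not differentiable. So
      derivatives are taken in the open interval only.\<close>
    show ?thesis
    proof (rule DERIV_nonpos_imp_decreasing_open [of \<alpha> "1/2" \<Phi>])
      show "\<alpha> \<le> 1/2" using a by simp
      show "continuous_on {\<alpha>..1/2} \<Phi>"
        unfolding \<Phi>_def
      proof (intro continuous_on_diff)
        show "continuous_on {\<alpha>..1/2} h"
          by (rule continuous_on_subset [OF continuous_on_h]) (use a a0 in auto)
        show "continuous_on {\<alpha>..1/2} (\<lambda>\<alpha>. h (tau \<alpha> \<xi>))"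
        proof (rule continuous_on_compose2 [OF continuous_on_h])
          show "continuous_on {\<alpha>..1/2} (\<lambda>\<alpha>. tau \<alpha> \<xi>)" unfolding tau_def by (intro continuous_intros) auto
          show "(\<lambda>\<alpha>. tau \<alpha> \<xi>) ` {\<alpha>..1/2} \<subseteq> {0..1/2}"
          proof
            fix y assume "y \<in> (\<lambda>\<alpha>. tau \<alpha> \<xi>) ` {\<alpha>..1/2}"
            then obtain z where "z \<in> {\<alpha>..1/2}" "y = tau z \<xi>" by auto
            then show "y \<in> {0..1/2}" using Tr [of z] a by (auto simp: tau)
          qed
        qed
      qed
      fix z assume z: "\<alpha> < z" "z < 1/2"
      have zz: "a0 < z" "a0 \<le> z" "z \<le> 1/2" using a z by auto
      have uz: "u z > 0" using uge [OF zz(2,3)] zz(1) \<xi>0 by (smt (verit) zero_less_power)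
      have vz: "0 < v z" using vr [OF zz(2,3)] zz(1) by auto
      have Tz: "0 < T z" "T z < 1" using Tr [OF zz(2,3)] zz(1) by auto
      have T2: "1 - 4 * (v z)\<^sup>2 > 0" using v4 [OF zz(2,3)] by simp
      have TT: "(T z)\<^sup>2 = 1 - 4 * (v z)\<^sup>2" using T2 by (simp add: T_def)
      have du: "(u has_real_derivative (1 - 2 * z)) (at z)"
        unfolding u_def [abs_def] by (auto intro!: derivative_eq_intros)
      have dv: "(v has_real_derivative (inverse (sqrt (u z)) / 2 * (1 - 2 * z))) (at z)"
      proof -
        have "((\<lambda>z. sqrt (u z) - \<xi>) has_real_derivative (inverse (sqrt (u z)) / 2 * (1 - 2 * z) - 0)) (at z)"
          by (intro DERIV_diff DERIV_chain2 [OF DERIV_real_sqrt [OF uz] du] DERIV_const)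
        then show ?thesis by (simp add: v_def [abs_def])
      qed
      define v' where "v' = inverse (sqrt (u z)) / 2 * (1 - 2 * z)"
      have dw: "((\<lambda>z. 1 - 4 * (v z)\<^sup>2) has_real_derivative (- 8 * v z * v')) (at z)"
        by (auto intro!: derivative_eq_intros dv simp: v'_def)
      have dT: "(T has_real_derivative (inverse (T z) / 2 * (- 8 * v z * v'))) (at z)"
        using DERIV_chain2 [OF DERIV_real_sqrt [OF T2] dw] by (simp add: T_def [abs_def])
      have dtau: "((\<lambda>z. tau z \<xi>) has_real_derivative (2 * v z * v' / T z)) (at z)"
        unfolding tau using Tz by (auto intro!: derivative_eq_intros dT simp: field_simps)
      have tz: "0 < tau z \<xi>" "tau z \<xi> < 1" using Tz by (auto simp: tau)
      have frac: "(1 - tau z \<xi>) / tau z \<xi> = (1 + T z) / (1 - T z)"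
        using Tz by (simp add: tau field_simps)
      have "((\<lambda>z. h (tau z \<xi>)) has_real_derivative log 2 ((1 + T z) / (1 - T z)) * (2 * v z * v' / T z)) (at z)"
        using DERIV_chain2 [OF h_has_derivative [OF tz] dtau] by (simp add: frac)
      moreover have "(h has_real_derivative log 2 ((1 - z) / z)) (at z)"
        using zz a0 by (intro h_has_derivative) auto
      ultimately have d\<Phi>: "(\<Phi> has_real_derivative log 2 ((1 + T z) / (1 - T z)) * (2 * v z * v' / T z) - log 2 ((1 - z) / z)) (at z)"
        unfolding \<Phi>_def [abs_def] by (rule DERIV_diff)
      have "log 2 ((1 + T z) / (1 - T z)) * (2 * v z * v' / T z) \<le> log 2 ((1 - z) / z)"
      proof -
        define A where "A = 1 - 2 * z"
        have A: "0 < A" "A < 1" using z a a0 by (auto simp: A_def)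
        have "(1 + A) / (1 - A) = (1 - z) / z" using zz a0 by (simp add: A_def field_simps)
        \<comment> \<open>The first term of the artanh series; it isolates the factor
          \<open>2 * A\<close>, which also appears in \<open>v'\<close>.\<close>
        then have lA: "2 * A \<le> ln ((1 - z) / z)" using ln_ratio_ge [OF A] A
          by (smt (verit) divide_nonneg_nonneg zero_le_power)
        define L where "L = ln ((1 + T z) / (1 - T z))"
        have "sqrt (1 - (T z)\<^sup>2) = 2 * v z"
        proof -
          have e: "1 - (T z)\<^sup>2 = (2 * v z)\<^sup>2" using TT by (simp add: power2_eq_square)
          show ?thesis unfolding e real_sqrt_abs using vz by simp
        qed
        then have "2 * v z * (L / (2 * T z) - 1) \<le> 59/200" using artanh_bound [OF Tz] by (simp add: L_def)
        moreover have "2 * v z * (L / (2 * T z) - 1) = 2 * (v z * (L / (2 * T z))) - 2 * v z"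
          by (simp only: right_diff_distrib mult.assoc mult_1_right)
        \<comment> \<open>Here the lower bound 59/200 on \<open>\<delta>\<close> enters:
          \<open>v z + \<delta> / 2\<close> is just \<open>sqrt (u z)\<close>, the denominator in
          \<open>v'\<close>.\<close>
        ultimately have "v z * (L / (2 * T z)) \<le> v z + \<delta> / 2" using d by linarith
        also have "\<dots> = sqrt (u z)" by (simp add: v_def \<xi>_def)
        finally have k: "v z * (L / (2 * T z)) \<le> sqrt (u z)" .
        have "L * (2 * v z * v' / T z) = 2 * A * (v z * (L / (2 * T z))) / sqrt (u z)"
        proof -
          have gen: "l * (2 * w * (inverse r / 2 * B) / t) = 2 * B * (w * (l / (2 * t))) / r"
            if "r > 0" "t > 0" for l w r B t :: real
            using that by (simp add: field_simps)
          show ?thesis unfolding v'_def A_def by (rule gen) (use uz Tz in auto)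
        qed
        also have "\<dots> \<le> 2 * A * sqrt (u z) / sqrt (u z)"
          using k A uz by (intro divide_right_mono mult_left_mono) auto
        also have "\<dots> = 2 * A" using uz by simp
        also note lA
        finally have "L * (2 * v z * v' / T z) / ln 2 \<le> ln ((1 - z) / z) / ln 2" by (intro divide_right_mono) auto
        then show ?thesis by (simp add: log_def L_def mult.commute)
      qed
      then show "\<exists>y. (\<Phi> has_real_derivative y) (at z) \<and> y \<le> 0"
        by (intro exI [of _ "log 2 ((1 + T z) / (1 - T z)) * (2 * v z * v' / T z) - log 2 ((1 - z) / z)"] conjI d\<Phi>) simp
    qed
  next
    case True
    show ?thesis unfolding True by simp
  qed
  moreover have "\<Phi> (1/2) = h (1/2 - sqrt (\<delta> * (1 - \<delta>))) - 1"
  proof -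
    have "u (1/2) = (1/2 - \<xi>)\<^sup>2" by (simp add: u_def power2_eq_square algebra_simps)
    then have "v (1/2) = 1/2 - 2 * \<xi>" using \<xi>0 by (simp add: v_def)
    then have v: "v (1/2) = 1/2 - \<delta>" by (simp add: \<xi>_def)
    have "1 - 4 * (v (1/2))\<^sup>2 = 4 * (\<delta> * (1 - \<delta>))" unfolding v by (simp add: power2_eq_square algebra_simps)
    then have "T (1/2) = 2 * sqrt (\<delta> * (1 - \<delta>))" by (simp add: T_def real_sqrt_mult)
    then show ?thesis by (simp add: \<Phi>_def tau diff_divide_distrib h_half)
  qed
  ultimately have "h (1/2 - sqrt (\<delta> * (1 - \<delta>))) - 1 \<le> (INF \<alpha>\<in>{a0..1/2}. h (tau \<alpha> (\<delta> / 2)) - h \<alpha>)"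
    using a0 by (intro cINF_greatest) (auto simp: \<Phi>_def \<xi>_def)
  then show ?thesis by (simp add: Rbar_def a0_def)
qed

section \<open>Reliability function\<close>

lemma log2_eq: "log 2 x = ln x / ln 2"
  by (simp add: log_def)

text \<open>In the variables e = (1 - s) / (1 + s) = 1 - 2 rho and x = e^2 all logarithms reduce to
  those of 2, 1 - e, 1 + e, 1 + x and 1 + 3 x, besides the entropy of tau. In nats the right side
  minus the left side is then exactly \<open>gap x\<close>, and 9/41 <= s becomes x <=
  256/625.\<close>

lemma exponent_delta1_le:
  fixes s :: real
  assumes s: "9/41 \<le> s" "s < 1" and p: "p = s\<^sup>2 / (1 + s\<^sup>2)" and Z: "Z = 2 * s / (1 + s\<^sup>2)"
    and \<nu>: "\<nu> = sqrt (s / (1 - s + s\<^sup>2))"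
    and \<delta>: "\<delta> = 2 * s / (1 + s)\<^sup>2" and \<tau>: "\<tau> = 1/2 - sqrt (\<delta> * (1 - \<delta>))"
  shows "log 2 ((1 + s ^ 3) / (1 + s\<^sup>2)) - p * log 2 s + \<delta> * (3 * log 2 \<nu> - (1/2 - p) * log 2 s - 2 * log 2 Z)
     \<le> 1 - log 2 (1 + Z) - h \<tau>"
proof -
  define e where "e = (1 - s) / (1 + s)"
  define x where "x = e\<^sup>2"
  have e: "0 < e" "e \<le> 16/25" using s by (auto simp: e_def field_simps)
  have e1: "e < 1" using e by simp
  have s_e: "s = (1 - e) / (1 + e)" using s by (simp add: e_def field_simps)
  have x: "0 < x" "x \<le> 256/625"
  proof -
    show "0 < x" using e by (simp add: x_def)
    have "e\<^sup>2 \<le> (16/25)\<^sup>2" using e by (intro power_mono) auto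
    then show "x \<le> 256/625" by (simp add: x_def power2_eq_square)
  qed
  have gap: "0 \<le> gap x" by (rule gap_nonneg [OF x])
  define L1 L2 l3 lx where "L1 = ln (1 - e)" and "L2 = ln (1 + e)" and "l3 = ln (1 + 3 * x)" and "lx = ln (1 + x)"
  have p_e: "1 + e > 0" "1 - e > 0" using e e1 by auto
  have f1: "1 + s = 2 / (1 + e)" unfolding s_e using p_e by (simp add: field_simps)
  have f2: "1 + s\<^sup>2 = 2 * (1 + x) / (1 + e)\<^sup>2" unfolding s_e x_def power_divide using p_e
    by (simp add: add_divide_eq_iff) (simp add: power2_eq_square algebra_simps)
  have f3: "1 - s + s\<^sup>2 = (1 + 3 * x) / (1 + e)\<^sup>2"
  proof -
    have "s = (1 - e) * (1 + e) / (1 + e)\<^sup>2" unfolding s_e using p_e by (simp add: power2_eq_square)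
    then have "1 - s + s\<^sup>2 = (2 * (1 + x) - (1 - e) * (1 + e)) / (1 + e)\<^sup>2"
      using f2 by (simp add: diff_divide_distrib)
    also have "2 * (1 + x) - (1 - e) * (1 + e) = 1 + 3 * x" by (simp add: x_def power2_eq_square algebra_simps)
    finally show ?thesis .
  qed
  have f4: "1 + s ^ 3 = (1 + s) * (1 - s + s\<^sup>2)" by (simp add: power2_eq_square power3_eq_cube algebra_simps)
  have xm: "1 - x = (1 - e) * (1 + e)" by (simp add: x_def power2_eq_square algebra_simps)
  have pos: "1 + x > 0" "1 + 3 * x > 0" "1 - x > 0" "s > 0" "1 + s\<^sup>2 > 0" "1 - s + s\<^sup>2 > 0" "1 + s > 0"
    using x s by (auto simp: add_pos_nonneg)
  have lm: "ln (1 - x) = L1 + L2" unfolding xm L1_def L2_def using p_e by (intro ln_mult_pos)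
  have ls: "ln s = L1 - L2" unfolding s_e L1_def L2_def using p_e by (intro ln_divide_pos)
  have l1s: "ln (1 + s) = ln 2 - L2" unfolding f1 L2_def using p_e by (intro ln_divide_pos) auto
  have le2: "ln ((1 + e)\<^sup>2) = 2 * L2" unfolding L2_def using p_e by (simp add: ln_realpow)
  have l2s: "ln (1 + s\<^sup>2) = ln 2 + lx - 2 * L2"
  proof -
    have "ln (1 + s\<^sup>2) = ln (2 * (1 + x)) - ln ((1 + e)\<^sup>2)" unfolding f2 using p_e pos by (intro ln_divide_pos) auto
    also have "ln (2 * (1 + x)) = ln 2 + lx" unfolding lx_def using pos by (intro ln_mult_pos) auto
    finally show ?thesis using le2 by simp
  qed
  have lms: "ln (1 - s + s\<^sup>2) = l3 - 2 * L2"
  proof -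
    have "ln (1 - s + s\<^sup>2) = ln (1 + 3 * x) - ln ((1 + e)\<^sup>2)" unfolding f3 using p_e pos by (intro ln_divide_pos) auto
    then show ?thesis using le2 by (simp add: l3_def)
  qed
  have l3s: "ln (1 + s ^ 3) = ln (1 + s) + ln (1 - s + s\<^sup>2)" unfolding f4 using pos by (intro ln_mult_pos) auto
  have s3: "1 + s ^ 3 > 0" unfolding f4 using pos by (intro mult_pos_pos)
  have A1: "ln ((1 + s ^ 3) / (1 + s\<^sup>2)) = l3 - L2 - lx"
  proof -
    have "ln ((1 + s ^ 3) / (1 + s\<^sup>2)) = ln (1 + s ^ 3) - ln (1 + s\<^sup>2)" using s3 pos by (intro ln_divide_pos) auto
    then show ?thesis using l3s l1s lms l2s by simp
  qed
  have A2: "ln \<nu> = (L1 + L2 - l3) / 2"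
  proof -
    have "ln \<nu> = ln (s / (1 - s + s\<^sup>2)) / 2" unfolding \<nu> using pos by (simp add: ln_sqrt)
    also have "ln (s / (1 - s + s\<^sup>2)) = ln s - ln (1 - s + s\<^sup>2)" using pos by (intro ln_divide_pos) auto
    finally show ?thesis using ls lms by simp
  qed
  have A3: "ln Z = L1 + L2 - lx"
  proof -
    have "ln Z = ln (2 * s) - ln (1 + s\<^sup>2)" unfolding Z using pos by (intro ln_divide_pos) auto
    also have "ln (2 * s) = ln 2 + ln s" using pos by (intro ln_mult_pos) auto
    finally show ?thesis using ls l2s by simp
  qed
  have Z1: "1 + Z = (1 + s) * (1 + s) / (1 + s\<^sup>2)" unfolding Z using pos by (simp add: field_simps power2_eq_square)
  have A4: "ln (1 + Z) = ln 2 - lx"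
  proof -
    have "ln (1 + Z) = ln ((1 + s) * (1 + s)) - ln (1 + s\<^sup>2)" unfolding Z1 using pos by (intro ln_divide_pos) auto
    also have "ln ((1 + s) * (1 + s)) = ln (1 + s) + ln (1 + s)" using pos by (intro ln_mult_pos) auto
    finally show ?thesis using l1s l2s by simp
  qed
  have \<delta>_x: "\<delta> = (1 - x) / 2"
  proof -
    have "(1 + s)\<^sup>2 = 4 / (1 + e)\<^sup>2" unfolding f1 by (simp add: power_divide)
    then have "\<delta> = 2 * s * (1 + e)\<^sup>2 / 4" by (simp add: \<delta>)
    also have "\<dots> = (1 - e) * (1 + e) / 2" unfolding s_e using p_e by (simp add: power2_eq_square)
    finally show ?thesis by (simp add: xm)
  qed
  have p_x: "p = (1 - e)\<^sup>2 / (2 * (1 + x))"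
  proof -
    have "s\<^sup>2 = (1 - e)\<^sup>2 / (1 + e)\<^sup>2" unfolding s_e by (simp add: power_divide)
    then show ?thesis unfolding p f2 using p_e pos by simp
  qed
  \<comment> \<open>The relative number of channel errors in a shell at distance delta n; it equals
    rho.\<close>
  have p_\<delta>: "p + \<delta> * (1/2 - p) = (1 - e) / 2"
  proof -
    have "p * (2 * (1 + x)) = (1 - e)\<^sup>2" using pos by (simp add: p_x)
    moreover have "4 * (p + \<delta> * (1/2 - p)) = (1 - x) + p * (2 * (1 + x))" unfolding \<delta>_x by (simp add: field_simps)
    ultimately have "4 * (p + \<delta> * (1/2 - p)) = (1 - x) + (1 - e)\<^sup>2" by simp
    also have "\<dots> = 2 * (1 - e)" by (simp add: x_def power2_eq_square algebra_simps)
    finally show ?thesis by simp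
  qed
  define q where "q = sqrt (1 - x\<^sup>2)"
  have \<tau>_q: "\<tau> = (1 - q) / 2"
  proof -
    have e: "\<delta> * (1 - \<delta>) = (1 - x\<^sup>2) / 4" by (simp add: \<delta>_x power2_eq_square field_simps)
    have "sqrt (\<delta> * (1 - \<delta>)) = q / 2" unfolding e real_sqrt_divide q_def by simp
    then show ?thesis by (simp add: \<tau> diff_divide_distrib)
  qed
  have x2: "x\<^sup>2 < 1" "0 < x\<^sup>2" using x by (auto simp: power_less_one_iff)
  have q: "0 < q" "q < 1" using x2 by (auto simp: q_def)
  have H: "h \<tau> * ln 2 = ln 2 - eta q"
  proof -
    have a: "1 - \<tau> = (1 + q) / 2" by (simp add: \<tau>_q field_simps)
    have l: "ln ((1 - q) / 2) = ln (1 - q) - ln 2" "ln ((1 + q) / 2) = ln (1 + q) - ln 2"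
      using q by (auto intro!: ln_divide_pos)
    have "h \<tau> = (- \<tau> * ln \<tau> - (1 - \<tau>) * ln (1 - \<tau>)) / ln 2"
      unfolding h_def log2_eq by (simp only: times_divide_eq_right diff_divide_distrib)
    then have "h \<tau> * ln 2 = - \<tau> * ln \<tau> - (1 - \<tau>) * ln (1 - \<tau>)" by simp
    also have "\<dots> = - ((1 - q) / 2) * (ln (1 - q) - ln 2) - ((1 + q) / 2) * (ln (1 + q) - ln 2)"
      unfolding a unfolding \<tau>_q l ..
    also have "\<dots> = ln 2 - eta q" by (simp add: eta_def field_simps)
    finally show ?thesis .
  qed
  have sx: "sqrt x = e" using e by (simp add: x_def)
  have gap_eq: "gap x = ((1 + e) * L2 + (1 - e) * L1) / 2 + eta q - ln 2 + (1 + x) * lx + (1 - x) * (L1 + L2) / 4 - (1 + 3 * x) * l3 / 4"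
    unfolding gap_def sx q_def [symmetric] lm by (simp add: eta_def [of e] L1_def L2_def lx_def l3_def)
  have "(l3 - L2 - lx) - p * (L1 - L2) + \<delta> * (3 * ((L1 + L2 - l3) / 2) - (1/2 - p) * (L1 - L2) - 2 * (L1 + L2 - lx))
     = (l3 - L2 - lx) - (p + \<delta> * (1/2 - p)) * (L1 - L2) + \<delta> * (3 * ((L1 + L2 - l3) / 2) - 2 * (L1 + L2 - lx))"
    by (simp add: algebra_simps)
  also have "\<dots> = (l3 - L2 - lx) - ((1 - e) / 2) * (L1 - L2) + ((1 - x) / 2) * (3 * ((L1 + L2 - l3) / 2) - 2 * (L1 + L2 - lx))"
    unfolding p_\<delta> unfolding \<delta>_x ..
  also have "\<dots> = ln 2 - (ln 2 - lx) - (ln 2 - eta q) - gap x"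
    unfolding gap_eq by (simp add: field_simps)
  also have "\<dots> \<le> ln 2 - (ln 2 - lx) - (ln 2 - eta q)" using gap by simp
  finally have main: "ln ((1 + s ^ 3) / (1 + s\<^sup>2)) - p * ln s + \<delta> * (3 * ln \<nu> - (1/2 - p) * ln s - 2 * ln Z)
     \<le> ln 2 - ln (1 + Z) - h \<tau> * ln 2"
    unfolding A1 A2 A3 A4 H ls .
  have "(ln ((1 + s ^ 3) / (1 + s\<^sup>2)) - p * ln s + \<delta> * (3 * ln \<nu> - (1/2 - p) * ln s - 2 * ln Z)) / ln 2
     \<le> (ln 2 - ln (1 + Z) - h \<tau> * ln 2) / ln 2"
    by (rule divide_right_mono [OF main]) simp
  moreover have "(ln 2 - ln (1 + Z) - h \<tau> * ln 2) / ln 2 = 1 - log 2 (1 + Z) - h \<tau>"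
    by (simp add: log2_eq diff_divide_distrib)
  moreover have "(ln ((1 + s ^ 3) / (1 + s\<^sup>2)) - p * ln s + \<delta> * (3 * ln \<nu> - (1/2 - p) * ln s - 2 * ln Z)) / ln 2
     = log 2 ((1 + s ^ 3) / (1 + s\<^sup>2)) - p * log 2 s + \<delta> * (3 * log 2 \<nu> - (1/2 - p) * log 2 s - 2 * log 2 Z)"
    unfolding log2_eq
    by (simp only: times_divide_eq_right diff_divide_distrib [symmetric] add_divide_distrib [symmetric])
  ultimately show ?thesis by simp
qed

lemma h_nonneg:
  assumes "0 \<le> x" "x \<le> 1"
  shows "0 \<le> h x"
proof -
  have "x * log 2 x \<le> 0"
    using assms by (cases "x = 0") (auto intro!: mult_nonneg_nonpos)
  moreover have "(1 - x) * log 2 (1 - x) \<le> 0"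
    using assms by (cases "x = 1") (auto intro!: mult_nonneg_nonpos)
  ultimately show ?thesis by (simp add: h_def)
qed

text \<open>Turns the square roots of \<open>p\<close> into rational functions of
  \<open>s\<close>.\<close>

lemma bsc_parameters:
  fixes p :: real
  assumes p: "0 < p" "p < 1/2" and s: "s = sqrt (p / (1 - p))"
  shows "0 < s" "s < 1" "p = s\<^sup>2 / (1 + s\<^sup>2)" "rho p = s / (1 + s)" "delta1 p = 2 * s / (1 + s)\<^sup>2"
    "Rcrit p = 1 - (log 2 (1 + s) - rho p * log 2 s)"
    "D (rho p) p = log 2 ((1 + s\<^sup>2) / (1 + s)) - rho p * log 2 s"
proof -
  have f: "0 < p / (1 - p)" "p / (1 - p) < 1" using p by auto
  show s0: "0 < s" and s1: "s < 1" using f by (auto simp: s)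
  have s2: "s\<^sup>2 = p / (1 - p)" using f by (simp add: s)
  have pos: "1 + s > 0" "1 + s\<^sup>2 > 0" using s0 by (auto simp: add_pos_nonneg)
  have q: "1 + s\<^sup>2 = 1 / (1 - p)" unfolding s2 using p by (simp add: field_simps)
  show ps: "p = s\<^sup>2 / (1 + s\<^sup>2)" unfolding q unfolding s2 using p by simp
  have p1: "1 - p = 1 / (1 + s\<^sup>2)" unfolding q using p by simp
  have sp: "sqrt p = s * sqrt (1 - p)" unfolding s using p by (simp flip: real_sqrt_mult)
  have sq: "sqrt (1 - p) > 0" using p by simp
  show rho: "rho p = s / (1 + s)"
  proof -
    have "sqrt p + sqrt (1 - p) = (1 + s) * sqrt (1 - p)" unfolding sp by (simp add: algebra_simps)
    then show ?thesis unfolding rho_def using sq by (simp add: sp)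
  qed
  have rho1: "1 - rho p = 1 / (1 + s)" unfolding rho using pos by (simp add: field_simps)
  show "delta1 p = 2 * s / (1 + s)\<^sup>2"
    unfolding delta1_def rho1 unfolding rho by (simp add: power2_eq_square)
  have l1: "log 2 (rho p) = log 2 s - log 2 (1 + s)" unfolding rho using s0 pos by (intro log_divide_pos) auto
  have l2: "log 2 (1 / (1 + s)) = - log 2 (1 + s)" using pos by (simp add: log_divide)
  have "h (rho p) = - rho p * (log 2 s - log 2 (1 + s)) - (1 - rho p) * - log 2 (1 + s)"
    unfolding h_def l1 unfolding rho1 l2 ..
  also have "\<dots> = log 2 (1 + s) - rho p * log 2 s" by (simp add: algebra_simps)
  finally show "Rcrit p = 1 - (log 2 (1 + s) - rho p * log 2 s)" by (simp add: Rcrit_def)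
  define g where "g = log 2 ((1 + s\<^sup>2) / (1 + s))"
  have rp: "rho p / p = ((1 + s\<^sup>2) / (1 + s)) / s"
    unfolding rho using s0 pos by (subst ps) (simp add: power2_eq_square)
  have l3: "log 2 (rho p / p) = g - log 2 s" unfolding rp g_def using s0 pos by (intro log_divide_pos) auto
  have "(1 - rho p) / (1 - p) = (1 + s\<^sup>2) / (1 + s)" unfolding rho1 p1 by simp
  then have "D (rho p) p = rho p * (g - log 2 s) + (1 - rho p) * g" unfolding D_def l3 g_def by simp
  then show "D (rho p) p = log 2 ((1 + s\<^sup>2) / (1 + s)) - rho p * log 2 s" by (simp add: g_def [symmetric] algebra_simps)
qed

text \<open>\<open>Rbar_lower\<close> turns the lower bound on \<open>R\<close> into
  \<open>h \<tau> \<le> R\<close>, so \<open>R\<close> is a mixture of the rates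
  \<open>h \<tau>\<close> and \<open>Rcrit p\<close>. The exponents \<open>Er\<close> and
  \<open>Dd\<close> at these rates lie on one line of slope -1, and \<open>E0\<close> is that line;
  thus the straight-line bound gives the exact exponent. The positivity of \<open>R\<close> is an
  input of \<open>achievability\<close>.\<close>

lemma converse_bound:
  fixes p R :: real
  assumes p: "0.046 \<le> p" "p < 1/2" and R: "R1 p \<le> R" "R \<le> Rcrit p" and \<epsilon>: "0 < \<epsilon>"
  shows "\<forall>\<^sub>F n in sequentially. \<forall>C \<in> codes n R. 2 powr (- (real n * (E0 R p + \<epsilon>))) \<le> 2 * Pe C n p"
    and "0 < R"
proof -
  define s where "s = sqrt (p / (1 - p))"
  have p0: "0 < p" using p by simp
  note par = bsc_parameters [OF p0 p(2) s_def]
  define Z where "Z = 2 * s / (1 + s\<^sup>2)"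
  define \<nu> where "\<nu> = sqrt (s / (1 - s + s\<^sup>2))"
  define \<delta> where "\<delta> = 2 * s / (1 + s)\<^sup>2"
  define \<tau> where "\<tau> = 1/2 - sqrt (\<delta> * (1 - \<delta>))"
  define Er where "Er = 1 - log 2 (1 + Z) - h \<tau>"
  define V where "V = log 2 ((1 + s ^ 3) / (1 + s\<^sup>2)) - p * log 2 s"
  define b where "b = 3 * log 2 \<nu> - (1/2 - p) * log 2 s - 2 * log 2 Z"
  define Dd where "Dd = D (rho p) p"
  have s0: "0 < s" "s < 1" by (rule par)+
  have pos: "1 + s > 0" "1 + s\<^sup>2 > 0" "(1 + s)\<^sup>2 > 0" using s0 by (auto simp: add_pos_nonneg)
  \<comment> \<open>At p = 0.046 the ratio p / (1 - p) is about 0.04822, while (9/41)^2 is about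
    0.04819.\<close>
  have s41: "9/41 \<le> s"
  proof -
    have "(9/41)\<^sup>2 \<le> p / (1 - p)" using p by (simp add: field_simps power2_eq_square)
    then show ?thesis unfolding s_def by (rule real_le_rsqrt)
  qed
  have \<delta>0: "59/200 \<le> \<delta>" "\<delta> < 1/2"
  proof -
    have "0 \<le> (s - 9/41) * (1 - s)" using s41 s0 by (intro mult_nonneg_nonneg) auto
    moreover have "(s - 9/41) * (1 - s) = 50/41 * s - s * s - 9/41" by (simp add: field_simps)
    moreover have "(1 + s)\<^sup>2 = 1 + 2 * s + s * s" by (simp add: power2_eq_square algebra_simps)
    ultimately have "59 * (1 + s)\<^sup>2 \<le> 400 * s" using s41 by linarith
    then show "59/200 \<le> \<delta>" unfolding \<delta>_def using pos by (simp add: pos_le_divide_eq)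
    have "0 < (1 - s)\<^sup>2" using s0 by simp
    then have "4 * s < (1 + s)\<^sup>2" by (simp add: power2_eq_square algebra_simps)
    then show "\<delta> < 1/2" unfolding \<delta>_def using pos by (simp add: pos_divide_less_eq)
  qed
  have hR1: "h \<tau> \<le> R"
    using Rbar_lower [OF \<delta>0] R(1) par(5) by (simp add: R1_def \<tau>_def \<delta>_def)
  have sq: "0 < sqrt (\<delta> * (1 - \<delta>))" "sqrt (\<delta> * (1 - \<delta>)) < 1/2"
  proof -
    show "0 < sqrt (\<delta> * (1 - \<delta>))" using \<delta>0 by simp
    have "0 < (1/2 - \<delta>)\<^sup>2" using \<delta>0 by simp
    then have "\<delta> * (1 - \<delta>) < (1/2)\<^sup>2" by (simp add: power2_eq_square algebra_simps)
    then show "sqrt (\<delta> * (1 - \<delta>)) < 1/2" by (intro real_less_lsqrt) auto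
  qed
  have h\<tau>: "0 < h \<tau>"
  proof -
    have \<tau>01: "0 < \<tau>" "\<tau> \<le> 1/2" unfolding \<tau>_def using sq by linarith+
    have "h (\<tau> / 2) < h \<tau>" using \<tau>01 by (intro h_strict_mono) auto
    moreover have "0 \<le> h (\<tau> / 2)" using \<tau>01 by (intro h_nonneg) auto
    ultimately show ?thesis by simp
  qed
  show "0 < R" using h\<tau> hR1 by simp
  have h\<tau>c: "h \<tau> \<le> Rcrit p" using hR1 R(2) by simp
  have Z1: "1 + Z = (1 + s) * (1 + s) / (1 + s\<^sup>2)" unfolding Z_def using pos by (simp add: field_simps power2_eq_square)
  have R0: "1 - log 2 (1 + Z) = Dd + Rcrit p"
  proof -
    have "log 2 (1 + Z) = log 2 ((1 + s) * (1 + s)) - log 2 (1 + s\<^sup>2)" unfolding Z1 using pos by (intro log_divide_pos) auto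
    also have "log 2 ((1 + s) * (1 + s)) = log 2 (1 + s) + log 2 (1 + s)" using pos by (intro log_mult_pos) auto
    finally have "log 2 (1 + Z) = log 2 (1 + s) + log 2 (1 + s) - log 2 (1 + s\<^sup>2)" .
    moreover have "log 2 ((1 + s\<^sup>2) / (1 + s)) = log 2 (1 + s\<^sup>2) - log 2 (1 + s)" using pos by (intro log_divide_pos) auto
    ultimately show ?thesis unfolding Dd_def par(6,7) by simp
  qed
  have ErDd: "Dd \<le> Er" using R0 h\<tau>c by (simp add: Er_def)
  have Dd0: "0 \<le> Dd"
  proof -
    have "s / (1 + s) * ((1 - s\<^sup>2) / (1 + s\<^sup>2)) \<le> s / (1 + s) * (- ln s)"
      using neg_ln_ge [OF s0] s0 by (intro mult_left_mono) auto
    moreover have "s / (1 + s) * ((1 - s\<^sup>2) / (1 + s\<^sup>2)) = s * (1 - s) / (1 + s\<^sup>2)"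
    proof -
      have "1 - s\<^sup>2 = (1 + s) * (1 - s)" by (simp add: power2_eq_square algebra_simps)
      then show ?thesis using pos by simp
    qed
    moreover have "1 - (1 + s) / (1 + s\<^sup>2) \<le> ln ((1 + s\<^sup>2) / (1 + s))"
    proof -
      have "ln ((1 + s) / (1 + s\<^sup>2)) \<le> (1 + s) / (1 + s\<^sup>2) - 1" using pos by (intro ln_le_minus_one) auto
      moreover have "ln ((1 + s) / (1 + s\<^sup>2)) = - ln ((1 + s\<^sup>2) / (1 + s))" using pos by (simp add: ln_divide_pos)
      ultimately show ?thesis by simp
    qed
    moreover have "1 - (1 + s) / (1 + s\<^sup>2) = - (s * (1 - s) / (1 + s\<^sup>2))"
      using pos by (simp add: field_simps power2_eq_square)
    ultimately have "0 \<le> ln ((1 + s\<^sup>2) / (1 + s)) - s / (1 + s) * ln s" by simp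
    then have "0 \<le> (ln ((1 + s\<^sup>2) / (1 + s)) - s / (1 + s) * ln s) / ln 2" by simp
    then show ?thesis unfolding Dd_def unfolding par(7) unfolding par(4) log2_eq by (simp add: diff_divide_distrib)
  qed
  have V1: "V \<le> Er"
  proof -
    have "V = (ln ((1 + s ^ 3) / (1 + s\<^sup>2)) - s\<^sup>2 / (1 + s\<^sup>2) * ln s) / ln 2"
      unfolding V_def log2_eq by (subst par(3)) (simp add: diff_divide_distrib)
    also have "\<dots> \<le> (ln ((1 + s\<^sup>2) / (1 + s)) - s / (1 + s) * ln s) / ln 2"
      using exponent_zero_le [OF s0] by (intro divide_right_mono) auto
    also have "\<dots> = Dd" unfolding Dd_def unfolding par(7) unfolding par(4) log2_eq by (simp add: diff_divide_distrib)
    finally show ?thesis using ErDd by simp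
  qed
  have V3: "V + \<delta> * b \<le> Er"
    unfolding V_def b_def Er_def
    by (rule exponent_delta1_le [OF s41 s0(2) par(3) Z_def \<nu>_def \<delta>_def \<tau>_def])
  define \<epsilon>' where "\<epsilon>' = \<epsilon> / 2"
  have \<epsilon>': "0 < \<epsilon>'" "0 < \<epsilon>' / 2" using \<epsilon> by (auto simp: \<epsilon>'_def)
  obtain \<eta> where \<eta>: "\<eta> > 0" and core: "\<forall>\<^sub>F n in sequentially. \<forall>(U::nat set) I (c :: bool list \<Rightarrow> nat set). finite U \<longrightarrow> card U = n \<longrightarrow> finite I \<longrightarrow>
      (\<forall>i\<in>I. c i \<subseteq> U) \<longrightarrow> 2 powr (real n * (h \<tau> - \<eta>)) \<le> real (card I) \<longrightarrow>
      real (card I) * 2 powr (- (real n * (Er + \<epsilon>' / 2))) \<le> tie_mass p U I c"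
    by (rule tie_mass_exponent [OF s0 par(3) Z_def \<nu>_def \<delta>_def \<tau>_def Er_def V_def b_def V1 V3 \<epsilon>'(2), where 'i = "bool list"])
  obtain \<theta> where \<theta>: "0 < \<theta>" "\<theta> \<le> 1" "\<theta> * h \<tau> + (1 - \<theta>) * Rcrit p \<le> R" "R - \<epsilon>' \<le> \<theta> * h \<tau> + (1 - \<theta>) * Rcrit p"
  proof (cases "h \<tau> = Rcrit p")
    case True
    show ?thesis by (rule that [of 1]) (use True hR1 R(2) \<epsilon>' in auto)
  next
    case False
    define \<Delta> where "\<Delta> = Rcrit p - h \<tau>"
    have \<Delta>: "\<Delta> > 0" using False h\<tau>c by (simp add: \<Delta>_def)
    \<comment> \<open>The exact mixing weight, raised to a positive value near
      \<open>R = Rcrit p\<close>, because the suffix must take a positive share of the length. This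
      lowers the rate of the mixture by at most \<open>\<epsilon>'\<close>.\<close>
    define t where "t = max ((Rcrit p - R) / \<Delta>) (min 1 (\<epsilon>' / \<Delta>))"
    have eq: "t * h \<tau> + (1 - t) * Rcrit p = Rcrit p - t * \<Delta>" by (simp add: \<Delta>_def algebra_simps)
    have tD: "t * \<Delta> = max (Rcrit p - R) (min \<Delta> \<epsilon>')"
      unfolding t_def using \<Delta> by (simp add: max_mult_distrib_right min_mult_distrib_right)
    have "(Rcrit p - R) / \<Delta> \<le> 1" using \<Delta> hR1 by (simp add: \<Delta>_def)
    then have "t \<le> 1" by (simp add: t_def)
    moreover have "0 < t" using \<Delta> \<epsilon>' by (simp add: t_def less_max_iff_disj)
    moreover have "Rcrit p - t * \<Delta> \<le> R" unfolding tD by linarith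
    moreover have "R - \<epsilon>' \<le> Rcrit p - t * \<Delta>" unfolding tD using R(2) \<epsilon>' by linarith
    ultimately show ?thesis by (intro that [of t]) (simp_all only: eq)
  qed
  have Rc0: "0 \<le> Rcrit p" using h\<tau> h\<tau>c by simp
  have sl: "\<forall>\<^sub>F n in sequentially. \<forall>I (c :: bool list \<Rightarrow> nat set). finite I \<longrightarrow>
      (\<forall>i\<in>I. c i \<subseteq> {..<n}) \<longrightarrow> 2 powr (real n * R) \<le> real (card I) \<longrightarrow>
      real (card I) * 2 powr (- (real n * (\<theta> * Er + (1 - \<theta>) * Dd + \<epsilon>'))) \<le> tie_mass p {..<n} I c"
    by (rule tie_mass_straight_line [OF s0 par(3) par(4) par(6) Rc0 par(7) [folded Dd_def] Dd0 _ _ \<theta>(1,2,3) \<epsilon>'(1) \<eta> core])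
      (use ErDd Dd0 h\<tau> in auto)
  have exp_le: "\<theta> * Er + (1 - \<theta>) * Dd + \<epsilon>' \<le> E0 R p + \<epsilon>"
  proof -
    have "\<theta> * Er + (1 - \<theta>) * Dd = Dd + Rcrit p - (\<theta> * h \<tau> + (1 - \<theta>) * Rcrit p)"
      unfolding Er_def R0 by (simp add: algebra_simps)
    moreover have "E0 R p = Dd + Rcrit p - R" by (simp add: E0_def Dd_def)
    ultimately show ?thesis using \<theta>(4) unfolding \<epsilon>'_def by linarith
  qed
  show "\<forall>\<^sub>F n in sequentially. \<forall>C \<in> codes n R. 2 powr (- (real n * (E0 R p + \<epsilon>))) \<le> 2 * Pe C n p"
    using sl
  proof (eventually_elim, intro ballI)
    fix n C
    assume sl: "\<forall>I (c :: bool list \<Rightarrow> nat set). finite I \<longrightarrow>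
      (\<forall>i\<in>I. c i \<subseteq> {..<n}) \<longrightarrow> 2 powr (real n * R) \<le> real (card I) \<longrightarrow>
      real (card I) * 2 powr (- (real n * (\<theta> * Er + (1 - \<theta>) * Dd + \<epsilon>'))) \<le> tie_mass p {..<n} I c"
      and "C \<in> codes n R"
    then have C: "C \<subseteq> words n" "card C = nat \<lceil>2 powr (real n * R)\<rceil>" by (auto simp: codes_def)
    have fC: "finite C" using C(1) finite_words finite_subset by auto
    have cC: "2 powr (real n * R) \<le> real (card C)" unfolding C(2) by (rule real_nat_ceiling_ge)
    have cpos: "0 < real (card C)" using cC by (smt (verit) powr_gt_zero)
    then have ne: "C \<noteq> {}" by auto
    have cU: "\<forall>i\<in>C. support i \<subseteq> {..<n}" using C(1) support_bij [of n] by (auto simp: bij_betw_def)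
    have "2 powr (- (real n * (E0 R p + \<epsilon>))) \<le> 2 powr (- (real n * (\<theta> * Er + (1 - \<theta>) * Dd + \<epsilon>')))"
      using exp_le by (intro powr_mono) (auto intro!: mult_left_mono)
    then have "real (card C) * 2 powr (- (real n * (E0 R p + \<epsilon>))) \<le> real (card C) * 2 powr (- (real n * (\<theta> * Er + (1 - \<theta>) * Dd + \<epsilon>')))"
      by (rule mult_left_mono) simp
    also have "\<dots> \<le> tie_mass p {..<n} C support" using sl fC cU cC by blast
    also have "\<dots> \<le> real (card C) * (2 * Pe C n p)" using Pe_ge_tie_mass [OF par(3) p0 p(2) C(1) ne] by simp
    finally show "2 powr (- (real n * (E0 R p + \<epsilon>))) \<le> 2 * Pe C n p" using cpos by simp
  qed
qed

text \<open>The exponent 1 - log 2 (1 + Z) - R of the greedy code equals \<open>E0 R p\<close>.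
  Rounding the code size up at most doubles it because \<open>2 powr (n * R)\<close> is at least 1,
  and R < 1 keeps the code below half of the cube for large n.\<close>

lemma achievability:
  fixes p R :: real
  assumes p: "0 < p" "p < 1/2" and R: "0 < R" "R \<le> Rcrit p"
  shows "\<forall>\<^sub>F n in sequentially. \<exists>C \<in> codes n R. Pe C n p \<le> 4 * 2 powr (- (real n * E0 R p))"
proof -
  define s where "s = sqrt (p / (1 - p))"
  note par = bsc_parameters [OF p s_def]
  have s0: "0 < s" "s < 1" by (rule par)+
  define Z where "Z = 2 * s / (1 + s\<^sup>2)"
  have pos: "1 + s > 0" "1 + s\<^sup>2 > 0" using s0 by (auto simp: add_pos_nonneg)
  have Z0: "0 < Z" using s0 pos by (simp add: Z_def)
  have Z1: "1 + Z = (1 + s) * (1 + s) / (1 + s\<^sup>2)" unfolding Z_def using pos by (simp add: field_simps power2_eq_square)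
  have R0: "1 - log 2 (1 + Z) = E0 R p + R"
  proof -
    have "log 2 (1 + Z) = log 2 ((1 + s) * (1 + s)) - log 2 (1 + s\<^sup>2)" unfolding Z1 using pos by (intro log_divide_pos) auto
    also have "log 2 ((1 + s) * (1 + s)) = log 2 (1 + s) + log 2 (1 + s)" using pos by (intro log_mult_pos) auto
    finally have "log 2 (1 + Z) = log 2 (1 + s) + log 2 (1 + s) - log 2 (1 + s\<^sup>2)" .
    moreover have "log 2 ((1 + s\<^sup>2) / (1 + s)) = log 2 (1 + s\<^sup>2) - log 2 (1 + s)" using pos by (intro log_divide_pos) auto
    ultimately show ?thesis unfolding E0_def par(6,7) by simp
  qed
  have "0 < log 2 (1 + s)" "log 2 s < 0" using s0 by auto
  moreover have "0 < rho p" using par(4) s0 by simp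
  ultimately have "Rcrit p < 1" unfolding par(6) by (smt (verit) mult_pos_neg)
  then have R1: "R < 1" using R by simp
  have "\<forall>\<^sub>F n in sequentially. 4 * 2 powr (real n * R) \<le> 2 powr real n" using R R1 by real_asymp
  then show ?thesis
  proof eventually_elim
    case (elim n)
    define M where "M = nat \<lceil>2 powr (real n * R)\<rceil>"
    have one: "1 \<le> 2 powr (real n * R)" using R by (intro ge_one_powr_ge_zero) auto
    have M1: "2 powr (real n * R) \<le> real M" unfolding M_def by (rule real_nat_ceiling_ge)
    have M2: "real M \<le> 2 * 2 powr (real n * R)"
    proof -
      have "real M = real_of_int \<lceil>2 powr (real n * R)\<rceil>" using one by (simp add: M_def)
      also have "\<dots> < 2 powr (real n * R) + 1" by linarith
      finally have "real M < 2 powr (real n * R) + 1" .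
      then show ?thesis using one by linarith
    qed
    have "real (2 * M) \<le> 4 * 2 powr (real n * R)" using M2 by simp
    also have "\<dots> \<le> real (2 ^ n)" using elim by (simp add: powr_realpow)
    finally have M3: "2 * M \<le> 2 ^ n" by (simp only: of_nat_le_iff)
    have M0: "0 < M" using one M1 by linarith
    obtain C where C: "C \<subseteq> words n" "card C = M" "Pe C n p \<le> 2 * real M * ((1 + Z) / 2) ^ n"
      using good_code [OF s0 par(3) Z_def M0 M3] by blast
    have "((1 + Z) / 2) ^ n = 2 powr (real n * log 2 ((1 + Z) / 2))" using Z0 by (intro power_eq_two_powr) auto
    also have "log 2 ((1 + Z) / 2) = - (E0 R p + R)" using R0 Z0 by (simp add: log_divide_pos)
    finally have q: "((1 + Z) / 2) ^ n = 2 powr (real n * - (E0 R p + R))" .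
    have "Pe C n p \<le> 2 * (2 * 2 powr (real n * R)) * 2 powr (real n * - (E0 R p + R))"
      using C(3) M2 unfolding q by (smt (verit) mult_right_mono powr_gt_zero)
    also have "\<dots> = 4 * (2 powr (real n * R) * 2 powr (real n * - (E0 R p + R)))" by simp
    also have "2 powr (real n * R) * 2 powr (real n * - (E0 R p + R)) = 2 powr (- (real n * E0 R p))"
      unfolding powr_add [symmetric] by (simp add: algebra_simps)
    finally show ?case using C by (intro bexI [of _ C]) (auto simp: codes_def M_def)
  qed
qed

theorem theorem17:
  fixes p R :: real
  assumes "0.046 \<le> p" and "p < 1/2"
    and "R1 p \<le> R" and "R \<le> Rcrit p"
  shows "reliability R p = ereal (E0 R p)"
proof -
  define a where "a n = (1 / real n) * log 2 (Max ((\<lambda>C. 1 / Pe C n p) ` codes n R))" for n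
  define Ev where "Ev = E0 R p"
  have p0: "0 < p" using assms by simp
  \<comment> \<open>The sequence even converges, which is more than the limsup asks for.\<close>
  have "a \<longlonglongrightarrow> Ev"
  proof (rule tendstoI)
    fix \<epsilon> :: real assume \<epsilon>: "0 < \<epsilon>"
    have R0: "0 < R" by (rule converse_bound(2) [OF assms \<epsilon>])
    have c: "\<forall>\<^sub>F n in sequentially. \<forall>C \<in> codes n R. 2 powr (- (real n * (Ev + \<epsilon> / 2))) \<le> 2 * Pe C n p"
      unfolding Ev_def using converse_bound(1) [OF assms, of "\<epsilon> / 2"] \<epsilon> by simp
    have d: "\<forall>\<^sub>F n in sequentially. \<exists>C \<in> codes n R. Pe C n p \<le> 4 * 2 powr (- (real n * Ev))"
      unfolding Ev_def by (rule achievability [OF p0 assms(2) R0 assms(4)])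
    have e: "\<forall>\<^sub>F n in sequentially. 2 / real n < \<epsilon> / 2" using \<epsilon> by real_asymp
    have f: "\<forall>\<^sub>F n :: nat in sequentially. n > 0" by (rule eventually_gt_at_top)
    show "\<forall>\<^sub>F n in sequentially. dist (a n) Ev < \<epsilon>"
      using c d e f
    proof eventually_elim
      case (elim n)
      define S where "S = (\<lambda>C. 1 / Pe C n p) ` codes n R"
      have "codes n R \<subseteq> Pow (words n)" by (auto simp: codes_def)
      then have "finite (codes n R)" using finite_words [of n] by (meson finite_Pow_iff finite_subset)
      then have fS: "finite S" by (simp add: S_def)
      obtain C0 where C0: "C0 \<in> codes n R" "Pe C0 n p \<le> 4 * 2 powr (- (real n * Ev))" using elim(2) by blast
      \<comment> \<open>Positivity follows from the converse. It excludes the value 1 / 0 = 0, so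
        that small error probabilities do correspond to large reciprocals.\<close>
      have Pe0: "0 < Pe C n p" if "C \<in> codes n R" for C
        using elim(1) that by (smt (verit) powr_gt_zero)
      have up: "Max S \<le> 2 * 2 powr (real n * (Ev + \<epsilon> / 2))"
      proof -
        have "1 / Pe C n p \<le> 2 * 2 powr (real n * (Ev + \<epsilon> / 2))" if C: "C \<in> codes n R" for C
        proof -
          have "1 \<le> 2 powr (real n * (Ev + \<epsilon> / 2)) * (2 * Pe C n p)"
          proof -
            have "1 = 2 powr (real n * (Ev + \<epsilon> / 2)) * 2 powr (- (real n * (Ev + \<epsilon> / 2)))"
              unfolding powr_add [symmetric] by simp
            also have "\<dots> \<le> 2 powr (real n * (Ev + \<epsilon> / 2)) * (2 * Pe C n p)"
              using elim(1) C by (intro mult_left_mono) auto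
            finally show ?thesis .
          qed
          then show ?thesis using Pe0 [OF C] by (simp add: divide_le_eq mult_ac)
        qed
        then show ?thesis using fS C0 by (subst Max_le_iff) (auto simp: S_def)
      qed
      have low: "2 powr (real n * Ev) / 4 \<le> Max S"
      proof -
        have "2 powr (real n * Ev) / 4 = 1 / (4 * 2 powr (- (real n * Ev)))" by (simp add: powr_minus divide_simps)
        also have "\<dots> \<le> 1 / Pe C0 n p" using C0 Pe0 by (intro divide_left_mono) auto
        also have "\<dots> \<le> Max S" using fS C0 by (intro Max_ge) (auto simp: S_def)
        finally show ?thesis .
      qed
      have Spos: "0 < Max S" using low by (smt (verit) powr_gt_zero divide_pos_pos)
      have "log 2 (2 powr (real n * Ev) / 4) \<le> log 2 (Max S)" using low Spos by (subst log_le_cancel_iff) auto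
      moreover have "log 2 (2 powr (real n * Ev) / 4) = real n * Ev - 2"
      proof -
        have "(4::real) = 2 powr 2" by simp
        then have "2 powr (real n * Ev) / 4 = 2 powr (real n * Ev - 2)" by (simp only: powr_diff)
        then show ?thesis by simp
      qed
      moreover have "log 2 (Max S) \<le> log 2 (2 * 2 powr (real n * (Ev + \<epsilon> / 2)))" using up Spos by (subst log_le_cancel_iff) auto
      moreover have "log 2 (2 * 2 powr (real n * (Ev + \<epsilon> / 2))) = 1 + real n * (Ev + \<epsilon> / 2)"
        by (simp add: log_mult_pos)
      ultimately have b: "real n * Ev - 2 \<le> log 2 (Max S)" "log 2 (Max S) \<le> 1 + real n * (Ev + \<epsilon> / 2)" by simp_all
      have an: "a n = log 2 (Max S) / real n" by (simp add: a_def S_def)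
      have "(real n * Ev - 2) / real n \<le> a n" unfolding an using b(1) by (intro divide_right_mono) auto
      moreover have "(real n * Ev - 2) / real n = Ev - 2 / real n" using elim(4) by (simp add: diff_divide_distrib)
      moreover have "a n \<le> (1 + real n * (Ev + \<epsilon> / 2)) / real n" unfolding an using b(2) by (intro divide_right_mono) auto
      moreover have "(1 + real n * (Ev + \<epsilon> / 2)) / real n = Ev + \<epsilon> / 2 + 1 / real n"
        using elim(4) by (simp add: add_divide_distrib)
      moreover have "1 / real n \<le> 2 / real n" by (intro divide_right_mono) auto
      ultimately show ?case using elim(3) \<epsilon> unfolding dist_real_def by linarith
    qed
  qed
  then have "(\<lambda>n. ereal (a n)) \<longlonglongrightarrow> ereal Ev" by simp
  then have "limsup (\<lambda>n. ereal (a n)) = ereal Ev" by (intro lim_imp_Limsup) auto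
  then show ?thesis by (simp add: reliability_def a_def Ev_def)
qed

end
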